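(* Let $N>1$ be an integer and $d>0$, and let $b>0$ be a constant with $\sqrt b\ne \pi j/(2d)$ for all $j=1,2,\dots$ such that the Sturm--Liouville problem (see context) for the triple $(\omega_0,d,u_0)$ with $\omega_0(p)=bp$ has exactly $N$ negative eigenvalues $\lambda_1<\dots<\lambda_N<0$ while all its other eigenvalues are positive. Then there exist functions $\omega_k\in C_0^\infty(0,1)$, $k=1,\dots,N$, such that the Jacobian matrix of the map $$T:\delta=(\delta_1,\dots,\delta_N)\mapsto\mu=(\mu_1,\dots,\mu_N)$$ (defined in the context through $\omega_1,\dots,\omega_N$ in a neighborhood of $\delta=0$) is invertible at $\delta=0$.
   Context: A stream solution for a vorticity function $\omega$ and depth $d>0$ is a pair $(u,d)$ with $u:[0,d]\to\mathbb{R}$, $u''+\omega(u)=0$, $u(0)=0$, $u(d)=1$. For $\omega_0(p)=bp$ with $\sqrt b\neq\pi j/(2d)$ for all $j\ge1$, the unique stream solution is $u_0(z)=\sin(\sqrt b z)/\sin(\sqrt b d)$. The Sturm--Liouville problem for a triple $(\omega,d,u)$, where $(u,d)$ is a stream solution for $\omega$ with $u'(d)\ne0$, is $$-\phi''-\omega'(u)\phi=\mu\phi\ \text{ on }(0,d),\quad \phi(0)=0,\quad \phi'(d)=\kappa\phi(d),\qquad \kappa=\frac1{[u'(d)]^2}-\frac{\omega(1)}{u'(d)}.$$ Its eigenvalues are real and simple. Given $\omega_1,\dots,\omega_N\in C_0^\infty(0,1)$ (smooth, compactly supported in $(0,1)$, extended by zero to $\mathbb{R}$), for $\delta\in\mathbb{R}^N$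 put $\omega_\delta(p)=bp+\delta_1\omega_1(p)+\dots+\delta_N\omega_N(p)$. For all small $\delta$ there is a unique stream solution $(u_\delta,d)$ for $\omega_\delta$, and $u_\delta'(d)\neq0$. $T(\delta)=(\mu_1,\dots,\mu_N)$ with $\mu_1<\dots<\mu_N$ denotes the vector of all negative eigenvalues of the Sturm--Liouville problem for $(\omega_\delta,d,u_\delta)$ for small $\delta$; so $T(0)=(\lambda_1,\dots,\lambda_N)$, and $T$ is analytic in a neighborhood of $\delta=0$. *)

theory Defs
  imports "HOL-Analysis.Analysis"
begin

text \<open>Derivative of a function on the closed interval from \<open>0\<close> to \<open>d\<close>; one-sided at the two
  endpoints, so the values of the function outside the interval are irrelevant.\<close>

definition deriv_on_depth :: "real \<Rightarrow> (real \<Rightarrow> real) \<Rightarrow> real \<Rightarrow> real" where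
  "deriv_on_depth d f z = vector_derivative f (at z within {0..d})"

text \<open>A function on the interval is represented by a total function, two such functions being
  the same iff they agree on \<open>{0..d}\<close>. For continuous \<open>\<omega>\<close>, \<open>u\<close> is automatically
  twice continuously differentiable on \<open>{0..d}\<close>.\<close>

definition stream_solution :: "(real \<Rightarrow> real) \<Rightarrow> real \<Rightarrow> (real \<Rightarrow> real) \<Rightarrow> bool" where
  "stream_solution \<omega> d u \<longleftrightarrow>
     0 < d \<and>
     (\<exists>u'. \<forall>z\<in>{0..d}.
        (u has_real_derivative u' z) (at z within {0..d}) \<and>
        (u' has_real_derivative - \<omega> (u z)) (at z within {0..d})) \<and>
     u 0 = 0 \<and> u d = 1"

definition kappa :: "(real \<Rightarrow> real) \<Rightarrow> real \<Rightarrow> (real \<Rightarrow> real) \<Rightarrow> real" where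
  "kappa \<omega> d u = 1 / (deriv_on_depth d u d)\<^sup>2 - \<omega> 1 / deriv_on_depth d u d"

text \<open>The eigenfunction \<open>\<phi>\<close> is continuously differentiable up to the boundary and satisfies
  the equation, solved here for the second derivative, in the open interval.\<close>

definition sl_eigenvalue ::
  "(real \<Rightarrow> real) \<Rightarrow> real \<Rightarrow> (real \<Rightarrow> real) \<Rightarrow> real \<Rightarrow> bool" where
  "sl_eigenvalue \<omega> d u \<mu> \<longleftrightarrow>
     (\<exists>\<phi> \<phi>'.
        (\<forall>z\<in>{0..d}. (\<phi> has_real_derivative \<phi>' z) (at z within {0..d})) \<and>
        continuous_on {0..d} \<phi>' \<and>
        (\<forall>z\<in>{0<..<d}. (\<phi>' has_real_derivative - deriv \<omega> (u z) * \<phi> z - \<mu> * \<phi> z) (at z)) \<and>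
        \<phi> 0 = 0 \<and> \<phi>' d = kappa \<omega> d u * \<phi> d \<and>
        (\<exists>z\<in>{0..d}. \<phi> z \<noteq> 0))"

text \<open>\<open>\<mu>\<close> lists all negative eigenvalues in increasing order. The linearly ordered finite index
  type \<open>'n\<close> plays the role of \<open>1, \<dots>, N\<close>.\<close>

definition negative_eigenvalue_vector ::
  "(real \<Rightarrow> real) \<Rightarrow> real \<Rightarrow> (real \<Rightarrow> real) \<Rightarrow> real^'n::{finite,linorder} \<Rightarrow> bool" where
  "negative_eigenvalue_vector \<omega> d u \<mu> \<longleftrightarrow>
     strict_mono (\<lambda>i. \<mu> $ i) \<and> range (\<lambda>i. \<mu> $ i) = {m. sl_eigenvalue \<omega> d u m \<and> m < 0}"

definition linear_vorticity :: "real \<Rightarrow> real \<Rightarrow> real" where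
  "linear_vorticity b p = b * p"

definition linear_stream :: "real \<Rightarrow> real \<Rightarrow> real \<Rightarrow> real" where
  "linear_stream b d z = sin (sqrt b * z) / sin (sqrt b * d)"

definition test_function_01 :: "(real \<Rightarrow> real) \<Rightarrow> bool" where
  "test_function_01 f \<longleftrightarrow>
     (\<forall>n x. (deriv ^^ n) f differentiable (at x)) \<and>
     compact (closure {x. f x \<noteq> 0}) \<and> closure {x. f x \<noteq> 0} \<subseteq> {0<..<1}"

definition perturbed_vorticity ::
  "real \<Rightarrow> ('n \<Rightarrow> real \<Rightarrow> real) \<Rightarrow> real^'n::finite \<Rightarrow> real \<Rightarrow> real" where
  "perturbed_vorticity b \<omega> \<delta> p = b * p + (\<Sum>k\<in>UNIV. \<delta> $ k * \<omega> k p)"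

text \<open>The description need not denote for every \<open>\<delta>\<close>; it does whenever the predicate
  \<open>T_well_defined\<close> below holds.\<close>

definition T_map ::
  "real \<Rightarrow> real \<Rightarrow> ('n \<Rightarrow> real \<Rightarrow> real) \<Rightarrow> real^'n::{finite,linorder} \<Rightarrow> real^'n::{finite,linorder}" where
  "T_map b d \<omega> \<delta> =
     (THE \<mu>. \<exists>u. stream_solution (perturbed_vorticity b \<omega> \<delta>) d u \<and>
                 negative_eigenvalue_vector (perturbed_vorticity b \<omega> \<delta>) d u \<mu>)"

definition T_well_defined ::
  "real \<Rightarrow> real \<Rightarrow> ('n \<Rightarrow> real \<Rightarrow> real) \<Rightarrow> real^'n::{finite,linorder} \<Rightarrow> bool" where
  "T_well_defined b d \<omega> \<delta> \<longleftrightarrow>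
     (\<exists>u. stream_solution (perturbed_vorticity b \<omega> \<delta>) d u \<and>
          (\<forall>v. stream_solution (perturbed_vorticity b \<omega> \<delta>) d v \<longrightarrow> (\<forall>z\<in>{0..d}. v z = u z)) \<and>
          deriv_on_depth d u d \<noteq> 0 \<and>
          negative_eigenvalue_vector (perturbed_vorticity b \<omega> \<delta>) d u (T_map b d \<omega> \<delta>))"

end

theory Submission
  imports Defs
begin

text \<open>
  The perturbations \<open>\<omega> k\<close> are chosen so that the Jacobian matrix is the identity. Write \<open>u0\<close> for the
  linear stream, \<open>\<phi>\<close> for the \<open>j\<close>-th unperturbed eigenfunction and \<open>\<mu>\<close> for the \<open>j\<close>-th perturbed
  eigenvalue, with eigenfunction \<open>\<psi>\<close>; eigenfunctions are normalised by \<open>\<phi> 0 = 0\<close>, \<open>\<phi>' 0 = 1\<close>.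

  \<^emph>\<open>Expansion.\<close> For small \<open>\<delta>\<close> there is exactly one stream solution \<open>u\<close>, it is close to \<open>u0\<close> together
  with its derivative (\<open>stream_solution_perturbation\<close>), and the negative eigenvalues are one close
  to each \<open>lam $ j\<close> and no others (\<open>robin_eigenvalues_perturbation\<close>). Lagrange's identity for \<open>\<psi>\<close>
  and \<open>\<phi>\<close> expresses \<open>(\<mu> - lam $ j) * \<integral>\<psi>\<phi>\<close> through the change of the potential and of \<open>\<kappa>\<close>; the
  same identity for \<open>u\<close> and \<open>u0\<close> expresses the change of the slope \<open>u' d\<close>, on which \<open>\<kappa>\<close> depends.
  Together they give an exact formula \<open>\<mu> - lam $ j = (\<Sum>k. \<delta> $ k * g k \<delta>)\<close>. Differentiability at
  \<open>\<delta> = 0\<close> then needs only that \<open>u\<close> and \<open>\<psi>\<close> depend continuously on \<open>\<delta>\<close>; the partial derivatives are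
  the values at \<open>\<omega> k\<close> of the linear functional \<open>response\<close> (\<open>eigenvalue_map_first_order\<close>).

  \<^emph>\<open>Independence.\<close> Suppose a combination of these functionals with coefficients \<open>c j\<close> vanishes on all
  test functions. In the variable \<open>t = sqrt b * z\<close> the stream is \<open>sin t / sin \<theta>\<close> with \<open>\<theta> = sqrt b * d\<close>,
  so a level \<open>p\<close> in \<open>(0,1)\<close> is attained at \<open>t\<close> equal to \<open>\<plusminus>a\<close> plus certain multiples of \<open>\<pi>\<close>, where
  \<open>sin a = p * \<bar>sin \<theta>\<bar>\<close>. Summing over these branches turns the hypothesis, by the fundamental lemma
  of the calculus of variations, into \<open>(\<Sum>j. c j * F j a) = A * (cos a)\<^sup>2 + C * cos a\<close>, where \<open>F j\<close> is
  the branch sum of the square of the \<open>j\<close>-th eigenfunction. The derivative of \<open>F j\<close> is an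
  eigenfunction of the second derivative with eigenvalue \<open>- 4 * \<tau> j\<close>, \<open>\<tau> j = 1 + lam $ j / b < 1\<close>.
  The derivative of the right-hand side contributes the eigenvalues \<open>-1\<close> and \<open>-4\<close> only. Nonzero
  eigenfunctions for distinct eigenvalues are independent, so \<open>c j = 0\<close> unless \<open>\<tau> j = 1/4\<close>; in that resonant case
  the constant part of \<open>F j\<close> gives \<open>c j = 0\<close> (\<open>vorticity_functionals_independent\<close>).

  \<^emph>\<open>Conclusion.\<close> Hence the vectors of responses of test functions form a subspace with trivial
  orthogonal complement, and there are test functions whose responses are the unit vectors
  (\<open>responses_span\<close>).
\<close>

section \<open>Second-order equations on an interval\<close>

text \<open>This is the regularity that an eigenfunction is required to have: the second derivative \<open>r\<close> is
  prescribed in the open interval only.\<close>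

definition ode2 :: "real \<Rightarrow> (real \<Rightarrow> real) \<Rightarrow> (real \<Rightarrow> real) \<Rightarrow> (real \<Rightarrow> real) \<Rightarrow> bool" where
  "ode2 d f f' r \<longleftrightarrow>
     (\<forall>z\<in>{0..d}. (f has_real_derivative f' z) (at z within {0..d})) \<and>
     continuous_on {0..d} f' \<and>
     (\<forall>z\<in>{0<..<d}. (f' has_real_derivative r z) (at z))"

lemma ode2_cont:
  assumes "ode2 d f f' r"
  shows "continuous_on {0..d} f" "continuous_on {0..d} f'"
  using assms DERIV_continuous_on unfolding ode2_def by blast+

lemma ode2_deriv:
  assumes "ode2 d f f' r" "z \<in> {0<..<d}"
  shows "(f has_real_derivative f' z) (at z)" "(f' has_real_derivative r z) (at z)"
proof -
  have "(f has_real_derivative f' z) (at z within {0..d})"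
    using assms by (auto simp: ode2_def)
  then show "(f has_real_derivative f' z) (at z)"
    using assms(2) by (simp add: at_within_Icc_at)
qed (use assms in \<open>auto simp: ode2_def\<close>)

lemma ode2_diff:
  assumes "ode2 d f f' r" "ode2 d g g' s"
  shows "ode2 d (\<lambda>z. f z - g z) (\<lambda>z. f' z - g' z) (\<lambda>z. r z - s z)"
  using assms unfolding ode2_def by (auto intro!: derivative_intros continuous_intros)

lemma ode2_cmult:
  assumes "ode2 d f f' r"
  shows "ode2 d (\<lambda>z. c * f z) (\<lambda>z. c * f' z) (\<lambda>z. c * r z)"
  using assms unfolding ode2_def by (auto intro!: derivative_intros continuous_intros DERIV_cmult)

lemma ode2_closed:
  assumes "\<And>z. z \<in> {0..d} \<Longrightarrow> (f has_real_derivative f' z) (at z within {0..d})"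
    and "\<And>z. z \<in> {0..d} \<Longrightarrow> (f' has_real_derivative r z) (at z within {0..d})"
  shows "ode2 d f f' r"
proof -
  have "continuous_on {0..d} f'" using assms(2) DERIV_continuous_on by blast
  moreover have "(f' has_real_derivative r z) (at z)" if "z \<in> {0<..<d}" for z
  proof -
    have "(f' has_real_derivative r z) (at z within {0..d})" using assms(2) that by auto
    then show ?thesis using that by (simp add: at_within_Icc_at)
  qed
  ultimately show ?thesis using assms(1) by (auto simp: ode2_def)
qed

text \<open>The constant of the energy estimate below; it depends on the equation only through the length
  of the interval and the bound \<open>A\<close> on the potential, which makes all later estimates uniform.\<close>

definition growth :: "real \<Rightarrow> real \<Rightarrow> real" where
  "growth d A = exp ((2 + A) * d) * (1 + d)"

lemma growth_ge_1: "0 < d \<Longrightarrow> 0 \<le> A \<Longrightarrow> 1 \<le> growth d A"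
  unfolding growth_def by (smt (verit) mult_nonneg_nonneg one_le_exp_iff mult_le_cancel_left1 mult_less_cancel_left1)

text \<open>With \<open>c = 2 + A\<close>, the energy \<open>w\<^sup>2 + w'\<^sup>2\<close> satisfies \<open>E' \<le> c * E + e\<^sup>2\<close>, so
  \<open>exp (- c * z) * E z - e\<^sup>2 * z\<close> decreases. Uniqueness, boundedness and continuous dependence of
  solutions are all instances of this estimate, applied to a solution or to a difference of two.\<close>

lemma ode2_energy_estimate:
  assumes ode: "ode2 d w w' r" and d: "0 < d" and A: "0 \<le> A" and e: "0 \<le> e"
    and r: "\<And>z. z \<in> {0<..<d} \<Longrightarrow> \<bar>r z\<bar> \<le> A * \<bar>w z\<bar> + e"
    and z: "z \<in> {0..d}"
  shows "\<bar>w z\<bar> \<le> growth d A * (\<bar>w 0\<bar> + \<bar>w' 0\<bar> + e)"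
    and "\<bar>w' z\<bar> \<le> growth d A * (\<bar>w 0\<bar> + \<bar>w' 0\<bar> + e)"
proof -
  define c where "c = 2 + A"
  define X where "X = (\<lambda>z. exp (- c * z) * ((w z)\<^sup>2 + (w' z)\<^sup>2) - e\<^sup>2 * z)"
  have cont: "continuous_on {0..d} X"
    unfolding X_def using ode2_cont[OF ode] by (intro continuous_intros)
  have der: "(X has_real_derivative
      exp (- c * x) * (2 * w x * w' x + 2 * w' x * r x - c * ((w x)\<^sup>2 + (w' x)\<^sup>2)) - e\<^sup>2) (at x)"
    if x: "x \<in> {0<..<d}" for x
    unfolding X_def
    by (rule derivative_eq_intros ode2_deriv[OF ode x] refl)+ (simp add: algebra_simps)
  have neg: "exp (- c * x) * (2 * w x * w' x + 2 * w' x * r x - c * ((w x)\<^sup>2 + (w' x)\<^sup>2)) - e\<^sup>2 \<le> 0"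
    if x: "x \<in> {0<..<d}" for x
  proof -
    have a: "2 * w x * w' x \<le> (w x)\<^sup>2 + (w' x)\<^sup>2"
      by (rule sum_squares_bound)
    have b: "2 * (\<bar>w x\<bar> * \<bar>w' x\<bar>) \<le> (w x)\<^sup>2 + (w' x)\<^sup>2"
      using sum_squares_bound[of "\<bar>w x\<bar>" "\<bar>w' x\<bar>"] by simp
    have "2 * w' x * r x \<le> 2 * (\<bar>w' x\<bar> * \<bar>r x\<bar>)"
      by (metis abs_ge_self abs_mult mult.assoc mult_left_mono zero_le_numeral)
    also have "\<dots> \<le> 2 * (\<bar>w' x\<bar> * (A * \<bar>w x\<bar> + e))"
      using r[OF x] by (intro mult_left_mono) auto
    also have "\<dots> = A * (2 * (\<bar>w x\<bar> * \<bar>w' x\<bar>)) + 2 * \<bar>w' x\<bar> * e" by (simp add: algebra_simps)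
    also have "\<dots> \<le> A * ((w x)\<^sup>2 + (w' x)\<^sup>2) + ((w' x)\<^sup>2 + e\<^sup>2)"
      using mult_left_mono[OF b A] sum_squares_bound[of "\<bar>w' x\<bar>" e] by simp
    finally have "2 * w x * w' x + 2 * w' x * r x - c * ((w x)\<^sup>2 + (w' x)\<^sup>2) \<le> e\<^sup>2"
      using a unfolding c_def by (simp add: algebra_simps) (smt (verit) zero_le_power2)
    then have "exp (- c * x) * (2 * w x * w' x + 2 * w' x * r x - c * ((w x)\<^sup>2 + (w' x)\<^sup>2)) \<le> exp (- c * x) * e\<^sup>2"
      by (intro mult_left_mono) auto
    also have "\<dots> \<le> 1 * e\<^sup>2"
      using x A unfolding c_def by (intro mult_right_mono) (auto simp: mult_nonpos_nonneg)
    finally show ?thesis by simp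
  qed
  have "X z \<le> X 0"
  proof (cases "z = 0")
    case False
    have "continuous_on {0..z} X" using cont z by (auto intro: continuous_on_subset)
    moreover have "\<exists>y. (X has_real_derivative y) (at x) \<and> y \<le> 0" if "0 < x" "x < z" for x
      using der[of x] neg[of x] that z by auto
    ultimately show ?thesis
      using z False by (intro DERIV_nonpos_imp_decreasing_open[of 0 z X]) auto
  qed auto
  then have "exp (- c * z) * ((w z)\<^sup>2 + (w' z)\<^sup>2) \<le> (w 0)\<^sup>2 + (w' 0)\<^sup>2 + e\<^sup>2 * z"
    by (simp add: X_def)
  then have "exp (c * z) * (exp (- c * z) * ((w z)\<^sup>2 + (w' z)\<^sup>2)) \<le> exp (c * z) * ((w 0)\<^sup>2 + (w' 0)\<^sup>2 + e\<^sup>2 * z)"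
    by (intro mult_left_mono) auto
  then have "(w z)\<^sup>2 + (w' z)\<^sup>2 \<le> exp (c * z) * ((w 0)\<^sup>2 + (w' 0)\<^sup>2 + e\<^sup>2 * z)"
    by (simp add: mult.assoc[symmetric] exp_add[symmetric])
  also have "\<dots> \<le> exp (c * d) * ((1 + d) * ((w 0)\<^sup>2 + (w' 0)\<^sup>2 + e\<^sup>2))"
  proof (rule mult_mono)
    show "exp (c * z) \<le> exp (c * d)" using z A by (auto simp: c_def)
    have "e\<^sup>2 * z \<le> e\<^sup>2 * d" using z by (intro mult_left_mono) auto
    then show "(w 0)\<^sup>2 + (w' 0)\<^sup>2 + e\<^sup>2 * z \<le> (1 + d) * ((w 0)\<^sup>2 + (w' 0)\<^sup>2 + e\<^sup>2)"
      using d by (simp add: algebra_simps) (smt (verit) mult_nonneg_nonneg zero_le_power2)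
    show "0 \<le> (w 0)\<^sup>2 + (w' 0)\<^sup>2 + e\<^sup>2 * z" using z by auto
  qed auto
  also have "\<dots> = growth d A * ((w 0)\<^sup>2 + (w' 0)\<^sup>2 + e\<^sup>2)"
    by (simp add: growth_def c_def mult_ac)
  also have "\<dots> \<le> (growth d A)\<^sup>2 * (\<bar>w 0\<bar> + \<bar>w' 0\<bar> + e)\<^sup>2"
  proof (rule mult_mono)
    show "growth d A \<le> (growth d A)\<^sup>2"
      using growth_ge_1[OF d A] by (simp add: power2_eq_square)
    have "(w 0)\<^sup>2 + (w' 0)\<^sup>2 + e\<^sup>2 = \<bar>w 0\<bar>\<^sup>2 + \<bar>w' 0\<bar>\<^sup>2 + e\<^sup>2" by simp
    also have "\<dots> \<le> (\<bar>w 0\<bar> + \<bar>w' 0\<bar> + e)\<^sup>2"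
    proof -
      have "0 \<le> \<bar>w 0\<bar> * \<bar>w' 0\<bar>" "0 \<le> \<bar>w 0\<bar> * e" "0 \<le> \<bar>w' 0\<bar> * e" using e by auto
      then show ?thesis by (simp add: power2_eq_square algebra_simps)
    qed
    finally show "(w 0)\<^sup>2 + (w' 0)\<^sup>2 + e\<^sup>2 \<le> (\<bar>w 0\<bar> + \<bar>w' 0\<bar> + e)\<^sup>2" .
  qed auto
  finally have *: "(w z)\<^sup>2 + (w' z)\<^sup>2 \<le> (growth d A * (\<bar>w 0\<bar> + \<bar>w' 0\<bar> + e))\<^sup>2"
    by (simp add: power_mult_distrib)
  have g: "0 \<le> growth d A * (\<bar>w 0\<bar> + \<bar>w' 0\<bar> + e)"
    using growth_ge_1[OF d A] e by (intro mult_nonneg_nonneg) auto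
  have "(w z)\<^sup>2 \<le> (growth d A * (\<bar>w 0\<bar> + \<bar>w' 0\<bar> + e))\<^sup>2" using * by (smt (verit) zero_le_power2)
  then show "\<bar>w z\<bar> \<le> growth d A * (\<bar>w 0\<bar> + \<bar>w' 0\<bar> + e)"
    using g by (metis abs_le_square_iff abs_of_nonneg)
  have "(w' z)\<^sup>2 \<le> (growth d A * (\<bar>w 0\<bar> + \<bar>w' 0\<bar> + e))\<^sup>2" using * by (smt (verit) zero_le_power2)
  then show "\<bar>w' z\<bar> \<le> growth d A * (\<bar>w 0\<bar> + \<bar>w' 0\<bar> + e)"
    using g by (metis abs_le_square_iff abs_of_nonneg)
qed

text \<open>The integrand is the derivative of the Wronskian \<open>f' * g - f * g'\<close>. The identity compares
  solutions of different equations exactly, without any approximation.\<close>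

lemma lagrange_identity:
  assumes f: "ode2 d f f' r" and g: "ode2 d g g' s" and d: "0 < d"
  shows "((\<lambda>z. r z * g z - f z * s z) has_integral
           (f' d * g d - f d * g' d) - (f' 0 * g 0 - f 0 * g' 0)) {0..d}"
proof (rule fundamental_theorem_of_calculus_interior)
  show "0 \<le> d" using d by simp
  show "continuous_on {0..d} (\<lambda>z. f' z * g z - f z * g' z)"
    using ode2_cont[OF f] ode2_cont[OF g] by (intro continuous_intros)
  show "((\<lambda>z. f' z * g z - f z * g' z) has_vector_derivative r z * g z - f z * s z) (at z)"
    if "z \<in> {0<..<d}" for z
    unfolding has_real_derivative_iff_has_vector_derivative[symmetric]
    by (rule derivative_eq_intros ode2_deriv[OF f that] ode2_deriv[OF g that] refl)+
       (simp add: algebra_simps)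
qed

lemma continuous_on_Icc_bound:
  fixes f :: "real \<Rightarrow> real"
  assumes "continuous_on {0..d} f"
  obtains M where "0 \<le> M" "\<And>z. z \<in> {0..d} \<Longrightarrow> \<bar>f z\<bar> \<le> M"
proof -
  have "bounded (f ` {0..d})"
    using assms by (intro compact_imp_bounded compact_continuous_image) auto
  then obtain M where "\<forall>y\<in>f ` {0..d}. norm y \<le> M" by (auto simp: bounded_iff)
  then show thesis using that[of "\<bar>M\<bar>"] by force
qed

text \<open>Banach's fixed point theorem for the weighted supremum norm on \<open>{0..d}\<close>. Operators act on total
  functions, and contraction is expressed by pointwise bounds on the interval.\<close>

lemma weighted_contraction_fixpoint:
  fixes F :: "(real \<Rightarrow> real) \<Rightarrow> real \<Rightarrow> real" and wt :: "real \<Rightarrow> real"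
  assumes c: "0 \<le> c" "c < 1"
    and wt: "continuous_on {0..d} wt" "\<And>z. z \<in> {0..d} \<Longrightarrow> 1 \<le> wt z"
    and cont: "\<And>f. continuous_on {0..d} f \<Longrightarrow> continuous_on {0..d} (F f)"
    and contr: "\<And>f g M. continuous_on {0..d} f \<Longrightarrow> continuous_on {0..d} g \<Longrightarrow>
        (\<And>z. z \<in> {0..d} \<Longrightarrow> \<bar>f z - g z\<bar> \<le> M * wt z) \<Longrightarrow>
        (\<And>z. z \<in> {0..d} \<Longrightarrow> \<bar>F f z - F g z\<bar> \<le> c * M * wt z)"
  obtains f where "continuous_on {0..d} f" "\<And>z. z \<in> {0..d} \<Longrightarrow> F f z = f z"
proof -
  define s where "s = (\<lambda>n. (F ^^ n) (\<lambda>_. 0))"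
  have s_Suc: "s (Suc n) = F (s n)" for n by (simp add: s_def)
  have s_cont: "continuous_on {0..d} (s n)" for n
    by (induction n) (auto simp: s_Suc cont, simp add: s_def)
  obtain M1 where M1: "0 \<le> M1" "\<And>z. z \<in> {0..d} \<Longrightarrow> \<bar>F (\<lambda>_. 0) z\<bar> \<le> M1"
    using continuous_on_Icc_bound[OF cont[OF continuous_on_const]] by metis
  obtain W where W: "\<And>z. z \<in> {0..d} \<Longrightarrow> \<bar>wt z\<bar> \<le> W"
    using continuous_on_Icc_bound[OF wt(1)] by metis
  have step: "\<bar>s (Suc n) z - s n z\<bar> \<le> c ^ n * M1 * wt z" if "z \<in> {0..d}" for n z
    using that
  proof (induction n arbitrary: z)
    case 0
    have "\<bar>F (\<lambda>_. 0) z\<bar> \<le> M1 * 1" using M1(2)[OF 0] by simp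
    also have "\<dots> \<le> M1 * wt z" using wt(2)[OF 0] by (intro mult_left_mono) (use M1 in auto)
    finally show ?case by (simp add: s_def)
  next
    case (Suc n)
    then show ?case
      using contr[OF s_cont[of "Suc n"] s_cont[of n], of "c ^ n * M1" z]
      by (simp add: s_Suc mult_ac)
  qed
  have "uniform_limit {0..d} (\<lambda>n z. \<Sum>i<n. s (Suc i) z - s i z) (\<lambda>z. \<Sum>i. s (Suc i) z - s i z) sequentially"
  proof (rule Weierstrass_m_test)
    show "norm (s (Suc n) z - s n z) \<le> c ^ n * (M1 * W)" if "z \<in> {0..d}" for n z
    proof -
      have "\<bar>s (Suc n) z - s n z\<bar> \<le> c ^ n * M1 * wt z" by (rule step[OF that])
      also have "\<dots> \<le> c ^ n * M1 * W"
        using W[OF that] c by (intro mult_left_mono) (use M1 in auto)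
      finally show ?thesis by (simp add: mult_ac)
    qed
    show "summable (\<lambda>n. c ^ n * (M1 * W))" using c by (intro summable_mult2 summable_geometric) auto
  qed
  moreover have "(\<Sum>i<n. s (Suc i) z - s i z) = s n z" for n z
    using sum_lessThan_telescope[of "\<lambda>i. s i z" n] by (simp add: s_def)
  ultimately obtain f where ul: "uniform_limit {0..d} s f sequentially" by auto
  have f_cont: "continuous_on {0..d} f"
    by (rule uniform_limit_theorem[OF _ ul]) (auto simp: s_cont)
  have "F f z = f z" if z: "z \<in> {0..d}" for z
  proof -
    have "(\<lambda>n. s (Suc n) z) \<longlonglongrightarrow> F f z"
    proof (rule LIMSEQ_I)
      fix r :: real assume r: "0 < r"
      have W1: "1 \<le> W" using wt(2)[OF z] W[OF z] by linarith
      define M2 where "M2 = r / (2 * W)"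
      have "\<forall>\<^sub>F n in sequentially. \<forall>x\<in>{0..d}. dist (s n x) (f x) < M2"
        using ul r W1 unfolding uniform_limit_iff M2_def by simp
      then obtain n0 where n0: "\<And>n x. n \<ge> n0 \<Longrightarrow> x \<in> {0..d} \<Longrightarrow> dist (s n x) (f x) < M2"
        unfolding eventually_sequentially by metis
      have "norm (s (Suc n) z - F f z) < r" if n: "n \<ge> n0" for n
      proof -
        have pM: "0 < M2" using r W1 by (auto simp: M2_def)
        have "\<bar>s n x - f x\<bar> \<le> M2 * wt x" if "x \<in> {0..d}" for x
        proof -
          have "\<bar>s n x - f x\<bar> \<le> M2 * 1" using n0[OF n that] by (simp add: dist_real_def)
          also have "\<dots> \<le> M2 * wt x" using wt(2)[OF that] pM by (intro mult_left_mono) auto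
          finally show ?thesis .
        qed
        from contr[OF s_cont f_cont this z] have "\<bar>s (Suc n) z - F f z\<bar> \<le> c * M2 * wt z"
          by (simp add: s_Suc)
        also have "\<dots> \<le> 1 * M2 * W"
          using c pM W[OF z] wt(2)[OF z] by (intro mult_mono) auto
        also have "\<dots> < r" using r W1 by (simp add: M2_def)
        finally show ?thesis by simp
      qed
      then show "\<exists>no. \<forall>n\<ge>no. norm (s (Suc n) z - F f z) < r" by blast
    qed
    moreover have "(\<lambda>n. s (Suc n) z) \<longlonglongrightarrow> f z"
      using tendsto_uniform_limitI[OF ul z] by (rule LIMSEQ_Suc)
    ultimately show ?thesis by (rule LIMSEQ_unique)
  qed
  with f_cont that show thesis by blast
qed

text \<open>The fixed point of \<open>u \<mapsto> (\<lambda>z. a * z - \<integral> (z - t) * g t (u t))\<close>, the integral being over \<open>{0..z}\<close>. The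
  weight \<open>exp (K * z)\<close> makes this a contraction on the whole interval, whatever its length.\<close>

lemma ivp_existence:
  fixes g :: "real \<Rightarrow> real \<Rightarrow> real"
  assumes d: "0 < d" and L: "0 \<le> L"
    and cont: "\<And>f. continuous_on {0..d} f \<Longrightarrow> continuous_on {0..d} (\<lambda>z. g z (f z))"
    and lip: "\<And>z x y. z \<in> {0..d} \<Longrightarrow> \<bar>g z x - g z y\<bar> \<le> L * \<bar>x - y\<bar>"
  obtains u u' where "u 0 = 0" "u' 0 = a"
    "\<And>z. z \<in> {0..d} \<Longrightarrow> (u has_real_derivative u' z) (at z within {0..d})"
    "\<And>z. z \<in> {0..d} \<Longrightarrow> (u' has_real_derivative - g z (u z)) (at z within {0..d})"
proof -
  define I where "I = (\<lambda>f z. integral {0..z} (\<lambda>t. g t (f t)))"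
  define F where "F = (\<lambda>f z. a * z - integral {0..z} (\<lambda>t. (z - t) * g t (f t)))"
  define J where "J = (\<lambda>f z. integral {0..z} (\<lambda>t. t * g t (f t)))"
  have int: "(\<lambda>t. p t * g t (f t)) integrable_on {0..z}"
    if "continuous_on {0..d} f" "continuous_on {0..d} p" "z \<in> {0..d}" for f p z
  proof -
    have "continuous_on {0..d} (\<lambda>t. p t * g t (f t))" by (intro continuous_intros cont that)
    then have "continuous_on {0..z} (\<lambda>t. p t * g t (f t))"
      using that(3) by (auto intro: continuous_on_subset)
    then show ?thesis by (rule integrable_continuous_interval)
  qed
  \<comment> \<open>The kernel \<open>z - t\<close> is split so that both integrals can be differentiated in their upper limit.\<close>
  have F_eq: "F f z = a * z - (z * I f z - J f z)" if "continuous_on {0..d} f" "z \<in> {0..d}" for f z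
  proof -
    have "integral {0..z} (\<lambda>t. (z - t) * g t (f t)) =
          integral {0..z} (\<lambda>t. z * g t (f t) - t * g t (f t))"
      by (simp add: algebra_simps)
    also have "\<dots> = integral {0..z} (\<lambda>t. z * g t (f t)) - J f z"
      unfolding J_def using that by (intro Henstock_Kurzweil_Integration.integral_diff int continuous_intros)
    finally show ?thesis by (simp add: F_def I_def)
  qed
  have dI: "(I f has_real_derivative g z (f z)) (at z within {0..d})"
    if "continuous_on {0..d} f" "z \<in> {0..d}" for f z
    unfolding I_def using that by (intro integral_has_real_derivative cont)
  have dJ: "(J f has_real_derivative z * g z (f z)) (at z within {0..d})"
    if "continuous_on {0..d} f" "z \<in> {0..d}" for f z
    unfolding J_def using that by (intro integral_has_real_derivative continuous_intros cont)
  have dF: "(F f has_real_derivative a - I f z) (at z within {0..d})"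
    if "continuous_on {0..d} f" "z \<in> {0..d}" for f z
  proof -
    have "((\<lambda>z. a * z - (z * I f z - J f z)) has_real_derivative a - I f z) (at z within {0..d})"
      by (rule derivative_eq_intros dI[OF that] dJ[OF that] refl)+ simp
    then show ?thesis
      by (rule has_field_derivative_transform_within[of _ _ _ _ 1]) (use that F_eq in auto)
  qed
  \<comment> \<open>Any weight with \<open>L * d / K < 1\<close> works.\<close>
  define K where "K = 2 * L * d + 1"
  have K: "K > 0" using L d by (auto simp: K_def intro: add_nonneg_pos)
  have c1: "L * d / K \<le> 1/2" using pos_divide_le_eq[OF K, of "L * d" "1/2"] by (simp add: K_def)
  have c0: "0 \<le> L * d / K" using K L d by simp
  have "\<exists>u. continuous_on {0..d} u \<and> (\<forall>z\<in>{0..d}. F u z = u z)"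
  proof (rule weighted_contraction_fixpoint[of "L * d / K" d "\<lambda>z. exp (K * z)" F])
    show "0 \<le> L * d / K" by (rule c0)
    show "L * d / K < 1" by (rule order.strict_trans1[OF c1]) simp
    show "continuous_on {0..d} (\<lambda>z. exp (K * z))" by (intro continuous_intros)
    show "1 \<le> exp (K * z)" if "z \<in> {0..d}" for z using that K by (simp add: mult_nonneg_nonneg)
    show "continuous_on {0..d} (F f)" if "continuous_on {0..d} f" for f
      by (rule DERIV_continuous_on, rule dF[OF that])
    show "\<bar>F f z - F h z\<bar> \<le> L * d / K * M * exp (K * z)"
      if f: "continuous_on {0..d} f" and h: "continuous_on {0..d} h"
        and fh: "\<And>z. z \<in> {0..d} \<Longrightarrow> \<bar>f z - h z\<bar> \<le> M * exp (K * z)"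
        and z: "z \<in> {0..d}" for f h M z
    proof -
      have M0: "0 \<le> M" using fh[of 0] d by simp
      have "F f z - F h z = - integral {0..z} (\<lambda>t. (z - t) * g t (f t) - (z - t) * g t (h t))"
        unfolding F_def
        by (subst Henstock_Kurzweil_Integration.integral_diff[OF int int])
           (use f h z in \<open>auto intro!: continuous_intros\<close>)
      then have "\<bar>F f z - F h z\<bar> = \<bar>integral {0..z} (\<lambda>t. (z - t) * g t (f t) - (z - t) * g t (h t))\<bar>"
        by simp
      also have "\<dots> \<le> integral {0..z} (\<lambda>t. L * d * M * exp (K * t))"
        unfolding real_norm_def[symmetric]
      proof (rule integral_norm_bound_integral)
        show "(\<lambda>t. (z - t) * g t (f t) - (z - t) * g t (h t)) integrable_on {0..z}"
          using f h z by (intro integrable_diff int continuous_intros)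
        show "(\<lambda>t. L * d * M * exp (K * t)) integrable_on {0..z}"
          by (intro integrable_continuous_interval continuous_intros)
        fix t assume t: "t \<in> {0..z}"
        have "norm ((z - t) * g t (f t) - (z - t) * g t (h t)) = (z - t) * \<bar>g t (f t) - g t (h t)\<bar>"
          using t by (simp add: right_diff_distrib[symmetric] abs_mult)
        also have "\<dots> \<le> d * (L * (M * exp (K * t)))"
        proof (rule mult_mono)
          have "\<bar>g t (f t) - g t (h t)\<bar> \<le> L * \<bar>f t - h t\<bar>" using lip t z by auto
          also have "\<dots> \<le> L * (M * exp (K * t))" using fh[of t] t z L by (intro mult_left_mono) auto
          finally show "\<bar>g t (f t) - g t (h t)\<bar> \<le> L * (M * exp (K * t))" .
        qed (use t z d in auto)
        finally show "norm ((z - t) * g t (f t) - (z - t) * g t (h t)) \<le> L * d * M * exp (K * t)"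
          by (simp add: mult_ac)
      qed
      also have "\<dots> = L * d * M * ((exp (K * z) - 1) / K)"
      proof -
        have "((\<lambda>t. exp (K * t) / K) has_real_derivative exp (K * t)) (at t within {0..z})" for t
          using K by (auto intro!: derivative_eq_intros)
        then have "((\<lambda>t. exp (K * t)) has_integral exp (K * z) / K - exp (K * 0) / K) {0..z}"
          using z by (intro fundamental_theorem_of_calculus)
            (simp_all add: has_real_derivative_iff_has_vector_derivative)
        then have "integral {0..z} (\<lambda>t. exp (K * t)) = (exp (K * z) - 1) / K"
          by (simp add: integral_unique diff_divide_distrib)
        then show ?thesis by simp
      qed
      also have "\<dots> \<le> L * d * M * (exp (K * z) / K)"
        by (intro mult_left_mono divide_right_mono mult_nonneg_nonneg)
           (simp_all add: L M0 less_imp_le[OF d] less_imp_le[OF K])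
      finally show ?thesis by simp
    qed
    show "\<exists>u. continuous_on {0..d} u \<and> (\<forall>z\<in>{0..d}. F u z = u z)"
      if "continuous_on {0..d} f" "\<And>z. z \<in> {0..d} \<Longrightarrow> F f z = f z" for f
      using that by blast
  qed
  then obtain u where u: "continuous_on {0..d} u" "\<And>z. z \<in> {0..d} \<Longrightarrow> F u z = u z"
    by blast
  show thesis
  proof
    show "F u 0 = 0" by (simp add: F_def)
    show "a - I u 0 = a" by (simp add: I_def)
    show "(F u has_real_derivative a - I u z) (at z within {0..d})" if "z \<in> {0..d}" for z
      by (rule dF[OF u(1) that])
    show "((\<lambda>z. a - I u z) has_real_derivative - g z (F u z)) (at z within {0..d})" if "z \<in> {0..d}" for z
    proof -
      have "((\<lambda>z. a - I u z) has_real_derivative 0 - g z (u z)) (at z within {0..d})"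
        by (intro DERIV_diff DERIV_const dI[OF u(1) that])
      then show ?thesis by (simp add: u(2)[OF that])
    qed
  qed
qed

section \<open>Robin eigenvalues and their stability\<close>

definition ivp_solution ::
  "real \<Rightarrow> (real \<Rightarrow> real) \<Rightarrow> (real \<Rightarrow> real) \<Rightarrow> (real \<Rightarrow> real) \<Rightarrow> bool" where
  "ivp_solution d q f f' \<longleftrightarrow> ode2 d f f' (\<lambda>z. - (q z * f z)) \<and> f 0 = 0 \<and> f' 0 = 1"

lemma ivp_solution_exists:
  assumes d: "0 < d" and q: "continuous_on {0..d} q"
  obtains f f' where "ivp_solution d q f f'"
proof -
  obtain L where L: "0 \<le> L" "\<And>z. z \<in> {0..d} \<Longrightarrow> \<bar>q z\<bar> \<le> L"
    using continuous_on_Icc_bound[OF q] by metis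
  have lip: "\<bar>q z * x - q z * y\<bar> \<le> L * \<bar>x - y\<bar>" if "z \<in> {0..d}" for z x y
    using L(2)[OF that] by (simp add: right_diff_distrib[symmetric] abs_mult mult_right_mono)
  obtain u u' where "u 0 = 0" "u' 0 = 1"
    "\<And>z. z \<in> {0..d} \<Longrightarrow> (u has_real_derivative u' z) (at z within {0..d})"
    "\<And>z. z \<in> {0..d} \<Longrightarrow> (u' has_real_derivative - (q z * u z)) (at z within {0..d})"
    by (rule ivp_existence[OF d L(1), of "\<lambda>z x. q z * x" 1])
       (use lip q in \<open>auto intro: continuous_intros\<close>)
  then have "ivp_solution d q u u'"
    unfolding ivp_solution_def by (intro conjI ode2_closed)
  then show thesis by (rule that)
qed

lemma ivp_solution_bound:
  assumes f: "ivp_solution d q f f'" and d: "0 < d" and A: "0 \<le> A"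
    and q: "\<And>z. z \<in> {0<..<d} \<Longrightarrow> \<bar>q z\<bar> \<le> A" and z: "z \<in> {0..d}"
  shows "\<bar>f z\<bar> \<le> growth d A" "\<bar>f' z\<bar> \<le> growth d A"
proof -
  have r: "\<bar>- (q z * f z)\<bar> \<le> A * \<bar>f z\<bar> + 0" if "z \<in> {0<..<d}" for z
    using q[OF that] by (simp add: abs_mult mult_right_mono)
  have o: "ode2 d f f' (\<lambda>z. - (q z * f z))" "f 0 = 0" "f' 0 = 1"
    using f by (auto simp: ivp_solution_def)
  show "\<bar>f z\<bar> \<le> growth d A" "\<bar>f' z\<bar> \<le> growth d A"
    using ode2_energy_estimate[OF o(1) d A _ r z] o by auto
qed

lemma ivp_solution_lipschitz:
  assumes f: "ivp_solution d p f f'" and g: "ivp_solution d q g g'"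
    and d: "0 < d" and A: "0 \<le> A" and e: "0 \<le> e"
    and p: "\<And>z. z \<in> {0<..<d} \<Longrightarrow> \<bar>p z\<bar> \<le> A"
    and q: "\<And>z. z \<in> {0<..<d} \<Longrightarrow> \<bar>q z\<bar> \<le> A"
    and pq: "\<And>z. z \<in> {0<..<d} \<Longrightarrow> \<bar>p z - q z\<bar> \<le> e" and z: "z \<in> {0..d}"
  shows "\<bar>f z - g z\<bar> \<le> (growth d A)\<^sup>2 * e" "\<bar>f' z - g' z\<bar> \<le> (growth d A)\<^sup>2 * e"
proof -
  have of: "ode2 d f f' (\<lambda>z. - (p z * f z))" "f 0 = 0" "f' 0 = 1"
    and og: "ode2 d g g' (\<lambda>z. - (q z * g z))" "g 0 = 0" "g' 0 = 1"
    using f g by (auto simp: ivp_solution_def)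
  have r: "\<bar>- (p z * f z) - - (q z * g z)\<bar> \<le> A * \<bar>f z - g z\<bar> + growth d A * e"
    if z: "z \<in> {0<..<d}" for z
  proof -
    have "- (p z * f z) - - (q z * g z) = - (p z * (f z - g z)) - (p z - q z) * g z"
      by (simp add: algebra_simps)
    also have "\<bar>\<dots>\<bar> \<le> \<bar>p z\<bar> * \<bar>f z - g z\<bar> + \<bar>p z - q z\<bar> * \<bar>g z\<bar>"
      by (metis abs_minus_cancel abs_mult abs_triangle_ineq4)
    also have "\<dots> \<le> A * \<bar>f z - g z\<bar> + e * growth d A"
      using p[OF z] pq[OF z] ivp_solution_bound(1)[OF g d A q, of z] z e
      by (intro add_mono mult_mono mult_right_mono) auto
    finally show ?thesis by (simp add: mult_ac)
  qed
  have ge: "0 \<le> growth d A * e" using growth_ge_1[OF d A] e by auto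
  show "\<bar>f z - g z\<bar> \<le> (growth d A)\<^sup>2 * e" "\<bar>f' z - g' z\<bar> \<le> (growth d A)\<^sup>2 * e"
    using ode2_energy_estimate[OF ode2_diff[OF of(1) og(1)] d A ge r z] of og
    by (auto simp: power2_eq_square mult_ac)
qed

text \<open>A difference of two solutions with the same initial data has zero energy.\<close>

lemma ivp_solution_unique:
  assumes f: "ode2 d f f' (\<lambda>z. - (q z * f z))" "f 0 = 0"
    and g: "ivp_solution d q g g'"
    and d: "0 < d" and q: "continuous_on {0..d} q" and z: "z \<in> {0..d}"
  shows "f z = f' 0 * g z" "f' z = f' 0 * g' z"
proof -
  obtain A where A: "0 \<le> A" "\<And>z. z \<in> {0..d} \<Longrightarrow> \<bar>q z\<bar> \<le> A"
    using continuous_on_Icc_bound[OF q] by metis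
  have og: "ode2 d g g' (\<lambda>z. - (q z * g z))" "g 0 = 0" "g' 0 = 1"
    using g by (auto simp: ivp_solution_def)
  have r: "\<bar>- (q z * f z) - f' 0 * - (q z * g z)\<bar> \<le> A * \<bar>f z - f' 0 * g z\<bar> + 0"
    if z: "z \<in> {0<..<d}" for z
  proof -
    have "- (q z * f z) - f' 0 * - (q z * g z) = - (q z * (f z - f' 0 * g z))"
      by (simp add: algebra_simps)
    then show ?thesis using A(2)[of z] z by (simp add: abs_mult mult_right_mono)
  qed
  show "f z = f' 0 * g z" "f' z = f' 0 * g' z"
    using ode2_energy_estimate[OF ode2_diff[OF f(1) ode2_cmult[OF og(1)]] d A(1) _ r z] f og
    by auto
qed

text \<open>The Sturm--Liouville problem of the statement with an arbitrary potential \<open>q\<close> and an arbitrary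
  constant \<open>\<kappa>\<close> in the boundary condition, which here vary independently of each other.\<close>

definition robin_eigenvalue :: "real \<Rightarrow> (real \<Rightarrow> real) \<Rightarrow> real \<Rightarrow> real \<Rightarrow> bool" where
  "robin_eigenvalue d q \<kappa> \<mu> \<longleftrightarrow>
     (\<exists>f f'. ode2 d f f' (\<lambda>z. - ((q z + \<mu>) * f z)) \<and> f 0 = 0 \<and> f' d = \<kappa> * f d \<and>
             (\<exists>z\<in>{0..d}. f z \<noteq> 0))"

lemma ivp_solution_nontrivial:
  assumes "ivp_solution d q f f'" and d: "0 < d"
  shows "\<exists>z\<in>{0..d}. f z \<noteq> 0"
proof (rule ccontr)
  assume "\<not> (\<exists>z\<in>{0..d}. f z \<noteq> 0)"
  then have z: "\<And>z. z \<in> {0..d} \<Longrightarrow> f z = 0" by blast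
  have "(f has_real_derivative f' 0) (at 0 within {0..d})"
    using assms unfolding ivp_solution_def ode2_def by (meson atLeastAtMost_iff less_imp_le order_refl)
  moreover have "(f has_real_derivative 0) (at 0 within {0..d})"
    by (rule has_field_derivative_transform_within[of "\<lambda>_. 0" _ _ _ 1]) (use z d in auto)
  ultimately have "f' 0 = 0"
    using d by (metis has_real_derivative_iff_has_vector_derivative
        vector_derivative_unique_within_closed_interval atLeastAtMost_iff less_eq_real_def box_real(2))
  then show False using assms by (auto simp: ivp_solution_def)
qed

lemma robin_eigenvalue_iff:
  assumes g: "ivp_solution d (\<lambda>z. q z + \<mu>) g g'" and d: "0 < d" and q: "continuous_on {0..d} q"
  shows "robin_eigenvalue d q \<kappa> \<mu> \<longleftrightarrow> g' d = \<kappa> * g d"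
proof
  assume "robin_eigenvalue d q \<kappa> \<mu>"
  then obtain f f' where f: "ode2 d f f' (\<lambda>z. - ((q z + \<mu>) * f z))" "f 0 = 0" "f' d = \<kappa> * f d"
     "\<exists>z\<in>{0..d}. f z \<noteq> 0" by (auto simp: robin_eigenvalue_def)
  have c: "continuous_on {0..d} (\<lambda>z. q z + \<mu>)" using q by (intro continuous_intros)
  note u = ivp_solution_unique[OF f(1,2) g d c]
  have "f' 0 \<noteq> 0" using f(4) u(1) by force
  then show "g' d = \<kappa> * g d" using u[of d] f(3) d by auto
next
  assume "g' d = \<kappa> * g d"
  then show "robin_eigenvalue d q \<kappa> \<mu>"
    using g ivp_solution_nontrivial[OF g d] unfolding robin_eigenvalue_def ivp_solution_def by blast
qed

lemma continuous_square_integral_pos: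
  fixes f :: "real \<Rightarrow> real"
  assumes "continuous_on {0..d} f" "z \<in> {0..d}" "f z \<noteq> 0" "0 < d"
  shows "0 < integral {0..d} (\<lambda>z. (f z)\<^sup>2)"
proof -
  have c: "continuous_on {0..d} (\<lambda>z. (f z)\<^sup>2)" by (intro continuous_intros assms)
  have "integral {0..d} (\<lambda>z. (f z)\<^sup>2) \<noteq> 0"
    using integral_eq_0_iff[OF c assms(4)] assms(2,3) by auto
  moreover have "0 \<le> integral {0..d} (\<lambda>z. (f z)\<^sup>2)"
    by (intro integral_nonneg integrable_continuous_interval c) auto
  ultimately show ?thesis by simp
qed

text \<open>For an eigenfunction \<open>f\<close>, the function \<open>f * f' - \<kappa> * f\<^sup>2\<close> vanishes at both ends, while its
  derivative is \<open>(f' - \<kappa> * f)\<^sup>2 + (- q - \<mu> - \<kappa>\<^sup>2) * f\<^sup>2\<close>, which would have positive integral for very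
  negative \<open>\<mu>\<close>.\<close>

lemma robin_eigenvalue_lower_bound:
  assumes ev: "robin_eigenvalue d q \<kappa> \<mu>" and d: "0 < d"
    and q: "continuous_on {0..d} q" "\<And>z. z \<in> {0..d} \<Longrightarrow> \<bar>q z\<bar> \<le> A"
  shows "- (A + \<kappa>\<^sup>2) \<le> \<mu>"
proof (rule ccontr)
  assume "\<not> - (A + \<kappa>\<^sup>2) \<le> \<mu>"
  then have c: "0 < - \<mu> - A - \<kappa>\<^sup>2" by simp
  obtain f f' z0 where f: "ode2 d f f' (\<lambda>z. - ((q z + \<mu>) * f z))" "f 0 = 0" "f' d = \<kappa> * f d"
     "z0\<in>{0..d}" "f z0 \<noteq> 0" using ev by (auto simp: robin_eigenvalue_def)
  define X where "X = (\<lambda>z. f z * f' z - \<kappa> * (f z)\<^sup>2)"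
  define X' where "X' = (\<lambda>z. (f' z)\<^sup>2 - (q z + \<mu>) * (f z)\<^sup>2 - 2 * \<kappa> * f z * f' z)"
  note cont = ode2_cont[OF f(1)]
  have "(X' has_integral X d - X 0) {0..d}"
  proof (rule fundamental_theorem_of_calculus_interior)
    show "continuous_on {0..d} X" unfolding X_def by (intro continuous_intros cont)
    show "(X has_vector_derivative X' z) (at z)" if "z \<in> {0<..<d}" for z
      unfolding has_real_derivative_iff_has_vector_derivative[symmetric] X_def X'_def
      by (rule derivative_eq_intros ode2_deriv[OF f(1) that] refl)+
         (simp add: algebra_simps power2_eq_square)
  qed (use d in simp)
  moreover have "X d - X 0 = 0" using f by (simp add: X_def power2_eq_square)
  ultimately have I: "(X' has_integral 0) {0..d}" by simp
  have "(\<lambda>z. (- \<mu> - A - \<kappa>\<^sup>2) * (f z)\<^sup>2) integrable_on {0..d}"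
    by (intro integrable_continuous_interval continuous_intros cont)
  then have "integral {0..d} (\<lambda>z. (- \<mu> - A - \<kappa>\<^sup>2) * (f z)\<^sup>2) \<le> 0"
  proof (rule has_integral_le[OF integrable_integral I])
    fix z assume z: "z \<in> {0..d}"
    have "X' z - (- \<mu> - A - \<kappa>\<^sup>2) * (f z)\<^sup>2 = (f' z - \<kappa> * f z)\<^sup>2 + (A - q z) * (f z)\<^sup>2"
      by (simp add: X'_def power2_eq_square algebra_simps)
    also have "\<dots> \<ge> 0" using q(2)[OF z] by (intro add_nonneg_nonneg mult_nonneg_nonneg) auto
    finally show "(- \<mu> - A - \<kappa>\<^sup>2) * (f z)\<^sup>2 \<le> X' z" by simp
  qed
  moreover have "0 < integral {0..d} (\<lambda>z. (f z)\<^sup>2)"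
    by (rule continuous_square_integral_pos[OF cont(1) f(4,5) d])
  ultimately show False using c by (simp add: mult_le_0_iff)
qed

text \<open>A choice of the normalised solution and its derivative, the values outside \<open>{0..d}\<close> being
  irrelevant.\<close>

definition shoot :: "real \<Rightarrow> (real \<Rightarrow> real) \<Rightarrow> (real \<Rightarrow> real) \<times> (real \<Rightarrow> real)" where
  "shoot d q = (SOME p. ivp_solution d q (fst p) (snd p))"

text \<open>The characteristic function of the eigenvalue problem: for the potential \<open>q + \<mu>\<close> it vanishes
  exactly when \<open>\<mu>\<close> is an eigenvalue.\<close>

definition robin_defect :: "real \<Rightarrow> (real \<Rightarrow> real) \<Rightarrow> real \<Rightarrow> real" where
  "robin_defect d q \<kappa> = snd (shoot d q) d - \<kappa> * fst (shoot d q) d"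

lemma shoot_ivp:
  assumes "0 < d" "continuous_on {0..d} q"
  shows "ivp_solution d q (fst (shoot d q)) (snd (shoot d q))"
  unfolding shoot_def
  by (rule someI_ex) (use ivp_solution_exists[OF assms] in \<open>metis fst_conv snd_conv\<close>)

lemma robin_eigenvalue_iff_defect:
  assumes d: "0 < d" and q: "continuous_on {0..d} q"
  shows "robin_eigenvalue d q \<kappa> \<mu> \<longleftrightarrow> robin_defect d (\<lambda>z. q z + \<mu>) \<kappa> = 0"
proof -
  have "continuous_on {0..d} (\<lambda>z. q z + \<mu>)" using q by (intro continuous_intros)
  from robin_eigenvalue_iff[OF shoot_ivp[OF d this] d q] show ?thesis
    by (auto simp: robin_defect_def)
qed

lemma robin_defect_lipschitz:
  assumes d: "0 < d" and p: "continuous_on {0..d} p" and q: "continuous_on {0..d} q"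
    and A: "0 \<le> A" and e: "0 \<le> e"
    and pA: "\<And>z. z \<in> {0..d} \<Longrightarrow> \<bar>p z\<bar> \<le> A" and qA: "\<And>z. z \<in> {0..d} \<Longrightarrow> \<bar>q z\<bar> \<le> A"
    and pq: "\<And>z. z \<in> {0..d} \<Longrightarrow> \<bar>p z - q z\<bar> \<le> e"
    and k: "\<bar>\<kappa>\<bar> \<le> A" "\<bar>\<kappa> - \<kappa>'\<bar> \<le> e"
  shows "\<bar>robin_defect d p \<kappa> - robin_defect d q \<kappa>'\<bar> \<le> ((growth d A)\<^sup>2 * (1 + A) + growth d A) * e"
proof -
  define f f' g g' where "f = fst (shoot d p)" "f' = snd (shoot d p)"
    "g = fst (shoot d q)" "g' = snd (shoot d q)"
  note defs = this
  have f: "ivp_solution d p f f'" and g: "ivp_solution d q g g'"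
    using shoot_ivp[OF d p] shoot_ivp[OF d q] by (auto simp: defs)
  have dd: "d \<in> {0..d}" using d by simp
  have a: "\<bar>f d - g d\<bar> \<le> (growth d A)\<^sup>2 * e" and b: "\<bar>f' d - g' d\<bar> \<le> (growth d A)\<^sup>2 * e"
    by (rule ivp_solution_lipschitz[OF f g d A e _ _ _ dd]; use pA qA pq in force)+
  have c: "\<bar>g d\<bar> \<le> growth d A"
    by (rule ivp_solution_bound[OF g d A _ dd]) (use qA in force)
  have "robin_defect d p \<kappa> - robin_defect d q \<kappa>' = (f' d - g' d) - \<kappa> * (f d - g d) - (\<kappa> - \<kappa>') * g d"
    by (simp add: robin_defect_def defs algebra_simps)
  also have "\<bar>\<dots>\<bar> \<le> \<bar>f' d - g' d\<bar> + \<bar>\<kappa>\<bar> * \<bar>f d - g d\<bar> + \<bar>\<kappa> - \<kappa>'\<bar> * \<bar>g d\<bar>"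
    unfolding abs_mult[symmetric] by linarith
  also have "\<dots> \<le> (growth d A)\<^sup>2 * e + A * ((growth d A)\<^sup>2 * e) + e * growth d A"
    by (intro add_mono mult_mono a b c k) (use A e in auto)
  finally show ?thesis by (simp add: algebra_simps)
qed

text \<open>Near a fixed potential all normalised solutions are close to one solution \<open>f\<close>, so products of two
  of them have integral close to that of \<open>f\<^sup>2\<close>. Two eigenfunctions of one problem with distinct
  eigenvalues are orthogonal, hence cannot both belong to potentials in this neighbourhood: this
  is what makes perturbed eigenvalues locally unique.\<close>

lemma ivp_products_positive_nearby:
  assumes f: "ivp_solution d q f f'" and d: "0 < d" and q: "continuous_on {0..d} q"
  shows "\<exists>\<rho>>0. \<forall>p p' g g' h h'. ivp_solution d p g g' \<longrightarrow> ivp_solution d p' h h' \<longrightarrow>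
       (\<forall>z\<in>{0..d}. \<bar>p z - q z\<bar> \<le> \<rho>) \<longrightarrow> (\<forall>z\<in>{0..d}. \<bar>p' z - q z\<bar> \<le> \<rho>) \<longrightarrow>
       0 < integral {0..d} (\<lambda>z. g z * h z)"
proof -
  obtain A0 where A0: "0 \<le> A0" "\<And>z. z \<in> {0..d} \<Longrightarrow> \<bar>q z\<bar> \<le> A0"
    using continuous_on_Icc_bound[OF q] by metis
  define A where "A = A0 + 1"
  define G where "G = growth d A"
  have A: "0 \<le> A" using A0 by (simp add: A_def)
  have G: "1 \<le> G" using growth_ge_1[OF d A] by (simp add: G_def)
  have fc: "continuous_on {0..d} f" using f ode2_cont(1) by (auto simp: ivp_solution_def)
  define I where "I = integral {0..d} (\<lambda>z. (f z)\<^sup>2)"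
  obtain z0 where "z0 \<in> {0..d}" "f z0 \<noteq> 0" using ivp_solution_nontrivial[OF f d] by blast
  then have I: "0 < I" unfolding I_def using continuous_square_integral_pos[OF fc] d by blast
  define \<rho> where "\<rho> = min 1 (I / (4 * G ^ 3 * d))"
  have rho: "0 < \<rho>" "\<rho> \<le> 1" "\<rho> \<le> I / (4 * G ^ 3 * d)" using I G d by (auto simp: \<rho>_def)
  show ?thesis
  proof (intro exI conjI allI impI)
    show "0 < \<rho>" by (rule rho)
    fix p p' g g' h h'
    assume g: "ivp_solution d p g g'" and h: "ivp_solution d p' h h'"
      and "\<forall>z\<in>{0..d}. \<bar>p z - q z\<bar> \<le> \<rho>" "\<forall>z\<in>{0..d}. \<bar>p' z - q z\<bar> \<le> \<rho>"
    then have p: "\<And>z. z \<in> {0..d} \<Longrightarrow> \<bar>p z - q z\<bar> \<le> \<rho>" and p': "\<And>z. z \<in> {0..d} \<Longrightarrow> \<bar>p' z - q z\<bar> \<le> \<rho>"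
      by auto
    have pA: "\<bar>p z\<bar> \<le> A" and pA': "\<bar>p' z\<bar> \<le> A" and qA: "\<bar>q z\<bar> \<le> A" if "z \<in> {0..d}" for z
      using p[OF that] p'[OF that] A0(2)[OF that] rho by (auto simp: A_def)
    have low: "(f z)\<^sup>2 - 2 * G ^ 3 * \<rho> \<le> g z * h z" if z: "z \<in> {0..d}" for z
    proof -
      have a: "\<bar>g z - f z\<bar> \<le> G\<^sup>2 * \<rho>" unfolding G_def
        by (rule ivp_solution_lipschitz[OF g f d A _ _ _ _ z]) (use pA qA p rho in \<open>auto intro: less_imp_le\<close>)
      have b: "\<bar>h z - f z\<bar> \<le> G\<^sup>2 * \<rho>" unfolding G_def
        by (rule ivp_solution_lipschitz[OF h f d A _ _ _ _ z]) (use pA' qA p' rho in \<open>auto intro: less_imp_le\<close>)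
      have c: "\<bar>h z\<bar> \<le> G" unfolding G_def
        by (rule ivp_solution_bound[OF h d A _ z]) (use pA' in auto)
      have e: "\<bar>f z\<bar> \<le> G" unfolding G_def
        by (rule ivp_solution_bound[OF f d A _ z]) (use qA in auto)
      have "(f z)\<^sup>2 - g z * h z = (f z - g z) * h z + f z * (f z - h z)"
        by (simp add: power2_eq_square algebra_simps)
      also have "\<dots> \<le> \<bar>f z - g z\<bar> * \<bar>h z\<bar> + \<bar>f z\<bar> * \<bar>f z - h z\<bar>"
        unfolding abs_mult[symmetric] by linarith
      also have "\<dots> \<le> (G\<^sup>2 * \<rho>) * G + G * (G\<^sup>2 * \<rho>)"
        using a b by (intro add_mono mult_mono c e) (use G rho in \<open>auto simp: abs_minus_commute\<close>)
      finally show ?thesis by (simp add: power3_eq_cube power2_eq_square)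
    qed
    have cg: "continuous_on {0..d} g" "continuous_on {0..d} h"
      using g h ode2_cont(1) by (auto simp: ivp_solution_def)
    have "integral {0..d} (\<lambda>z. (f z)\<^sup>2 - 2 * G ^ 3 * \<rho>) \<le> integral {0..d} (\<lambda>z. g z * h z)"
      by (intro integral_le integrable_continuous_interval continuous_intros fc cg low)
    moreover have "integral {0..d} (\<lambda>z. (f z)\<^sup>2 - 2 * G ^ 3 * \<rho>) = I - 2 * G ^ 3 * \<rho> * d"
    proof -
      have "integral {0..d} (\<lambda>z. (f z)\<^sup>2 - 2 * G ^ 3 * \<rho>) = I - integral {0..d} (\<lambda>z. 2 * G ^ 3 * \<rho>)"
        unfolding I_def
        by (intro Henstock_Kurzweil_Integration.integral_diff integrable_continuous_interval continuous_intros fc)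
      then show ?thesis using d by simp
    qed
    moreover have "2 * G ^ 3 * \<rho> * d < I"
    proof -
      have "0 < 4 * G ^ 3 * d" using G d by simp
      then have "\<rho> * (4 * G ^ 3 * d) \<le> I" using rho(3) by (simp add: pos_le_divide_eq)
      then show ?thesis using I by (simp add: mult_ac)
    qed
    ultimately show "0 < integral {0..d} (\<lambda>z. g z * h z)" by linarith
  qed
qed

text \<open>Lagrange's identity for normalised solutions, with the boundary terms written by means of the
  defects. It yields the orthogonality of eigenfunctions, the sign change of the defect at an
  eigenvalue and the variation of an eigenvalue.\<close>

lemma robin_defect_product:
  assumes f: "ivp_solution d p f f'" and g: "ivp_solution d q g g'" and d: "0 < d"
  shows "((\<lambda>z. (p z - q z) * (f z * g z)) has_integral
     f d * (g' d - \<kappa> * g d) - (f' d - \<kappa> * f d) * g d) {0..d}"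
proof -
  have "((\<lambda>z. - (- (p z * f z) * g z - f z * - (q z * g z))) has_integral
      - ((f' d * g d - f d * g' d) - (f' 0 * g 0 - f 0 * g' 0))) {0..d}"
    using f g by (intro has_integral_neg lagrange_identity d) (auto simp: ivp_solution_def)
  then show ?thesis using f g by (simp add: ivp_solution_def algebra_simps)
qed


text \<open>The defect is a continuous function of the parameter that is uniformly close to the unperturbed
  one on the compact interval \<open>{-R..0}\<close> to which nonpositive eigenvalues are confined. At each
  \<open>lam $ j\<close> the unperturbed defect changes sign, so the perturbed defect has a zero close by, and only
  one because of the orthogonality of eigenfunctions. On the rest of \<open>{-R..0}\<close> the unperturbed defect
  is bounded away from zero; this uses that \<open>0\<close> is not an eigenvalue.\<close>

theorem robin_eigenvalues_perturbation:
  fixes lam :: "real^'n::{finite,linorder}"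
  assumes d: "0 < d" and q0: "continuous_on {0..d} q0"
    and mono: "strict_mono (\<lambda>i. lam $ i)"
    and range: "range (\<lambda>i. lam $ i) = {m. robin_eigenvalue d q0 \<kappa>0 m \<and> m < 0}"
    and zero: "\<not> robin_eigenvalue d q0 \<kappa>0 0" and r: "0 < r"
  shows "\<exists>e>0. \<forall>q \<kappa>. continuous_on {0..d} q \<longrightarrow> (\<forall>z\<in>{0..d}. \<bar>q z - q0 z\<bar> \<le> e) \<longrightarrow>
       \<bar>\<kappa> - \<kappa>0\<bar> \<le> e \<longrightarrow>
       (\<exists>\<mu>::real^'n::{finite,linorder}. strict_mono (\<lambda>i. \<mu> $ i) \<and>
         range (\<lambda>i. \<mu> $ i) = {m. robin_eigenvalue d q \<kappa> m \<and> m < 0} \<and> (\<forall>i. \<bar>\<mu> $ i - lam $ i\<bar> < r))"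
proof -
  obtain A0 where A0: "0 \<le> A0" "\<And>z. z \<in> {0..d} \<Longrightarrow> \<bar>q0 z\<bar> \<le> A0"
    using continuous_on_Icc_bound[OF q0] by metis
  define A1 where "A1 = A0 + 1"
  define K1 where "K1 = \<bar>\<kappa>0\<bar> + 1"
  define R where "R = A1 + K1\<^sup>2 + 1"
  define A where "A = A1 + R + K1"
  define C where "C = (growth d A)\<^sup>2 * (1 + A) + growth d A"
  have pos: "0 \<le> A1" "0 \<le> K1" "0 \<le> R" "0 \<le> A" using A0 by (auto simp: A1_def K1_def R_def A_def)
  have C: "1 \<le> C" using growth_ge_1[OF d pos(4)] pos(4) by (auto simp: C_def intro: add_increasing)
  define D where "D = (\<lambda>q \<kappa> \<mu>. robin_defect d (\<lambda>z. q z + \<mu>) \<kappa>)"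
  define D0 where "D0 = D q0 \<kappa>0"
  have cq0: "continuous_on {0..d} (\<lambda>z. q0 z + \<mu>)" for \<mu> using q0 by (intro continuous_intros)
  \<comment> \<open>\<open>adm e q \<kappa>\<close>: the problem given by \<open>q\<close> and \<open>\<kappa>\<close> is \<open>e\<close>-close to the unperturbed one.\<close>
  define adm where "adm = (\<lambda>e q \<kappa>. continuous_on {0..d} q \<and> (\<forall>z\<in>{0..d}. \<bar>q z - q0 z\<bar> \<le> e) \<and> \<bar>\<kappa> - \<kappa>0\<bar> \<le> (e::real))"
  have lip: "\<bar>D q \<kappa> \<mu> - D p \<kappa>' \<nu>\<bar> \<le> C * e"
    if "adm 1 q \<kappa>" "adm 1 p \<kappa>'" "\<mu> \<in> {-R..0}" "\<nu> \<in> {-R..0}" "0 \<le> e"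
      "\<And>z. z \<in> {0..d} \<Longrightarrow> \<bar>(q z + \<mu>) - (p z + \<nu>)\<bar> \<le> e" "\<bar>\<kappa> - \<kappa>'\<bar> \<le> e" for q \<kappa> p \<kappa>' \<mu> \<nu> e
    unfolding D_def C_def
  proof (rule robin_defect_lipschitz)
    show "continuous_on {0..d} (\<lambda>z. q z + \<mu>)" "continuous_on {0..d} (\<lambda>z. p z + \<nu>)"
      using that(1,2) by (auto simp: adm_def intro!: continuous_intros)
    show "\<bar>q z + \<mu>\<bar> \<le> A" "\<bar>p z + \<nu>\<bar> \<le> A" if z: "z \<in> {0..d}" for z
    proof -
      have "\<bar>q z - q0 z\<bar> \<le> 1" "\<bar>p z - q0 z\<bar> \<le> 1" using \<open>adm 1 q \<kappa>\<close> \<open>adm 1 p \<kappa>'\<close> z by (auto simp: adm_def)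
      then show "\<bar>q z + \<mu>\<bar> \<le> A" "\<bar>p z + \<nu>\<bar> \<le> A"
        using A0(2)[OF z] \<open>\<mu> \<in> {-R..0}\<close> \<open>\<nu> \<in> {-R..0}\<close> pos by (auto simp: A_def A1_def)
    qed
    show "\<bar>\<kappa>\<bar> \<le> A" using that(1) pos by (auto simp: adm_def A_def K1_def)
  qed (use that d pos in auto)
  have adm0: "adm 1 q0 \<kappa>0" using q0 by (auto simp: adm_def)
  have adm_mono: "adm 1 q \<kappa>" if "adm e q \<kappa>" "e \<le> 1" for e q \<kappa>
    using that unfolding adm_def by force
  have Dcont: "continuous_on {-R..0} (D q \<kappa>)" if "adm 1 q \<kappa>" for q \<kappa>
  proof (rule continuous_onI)
    fix x e :: real assume x: "x \<in> {-R..0}" and e: "0 < e"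
    show "\<exists>t>0. \<forall>y\<in>{-R..0}. dist y x < t \<longrightarrow> dist (D q \<kappa> y) (D q \<kappa> x) \<le> e"
    proof (intro exI conjI ballI impI)
      show "0 < e / C" using e C by simp
      fix y assume y: "y \<in> {-R..0}" "dist y x < e / C"
      have "\<bar>D q \<kappa> y - D q \<kappa> x\<bar> \<le> C * (e / C)"
        using y e C by (intro lip[OF that that y(1) x]) (auto simp: dist_real_def)
      then show "dist (D q \<kappa> y) (D q \<kappa> x) \<le> e" using C by (simp add: dist_real_def)
    qed
  qed
  have ev: "robin_eigenvalue d q \<kappa> \<mu> \<longleftrightarrow> D q \<kappa> \<mu> = 0" if "continuous_on {0..d} q" for q \<kappa> \<mu>
    using robin_eigenvalue_iff_defect[OF d that] by (simp add: D_def)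
  have lam_ev: "robin_eigenvalue d q0 \<kappa>0 (lam $ j)" and lam_neg: "lam $ j < 0" for j using range by auto
  have low: "- R + 1 \<le> \<mu>" if "robin_eigenvalue d q \<kappa> \<mu>" "adm 1 q \<kappa>" for q \<kappa> \<mu>
  proof -
    have "- (A1 + \<kappa>\<^sup>2) \<le> \<mu>"
    proof (rule robin_eigenvalue_lower_bound[OF that(1) d])
      show "\<bar>q z\<bar> \<le> A1" if "z \<in> {0..d}" for z
        using A0(2)[OF that] \<open>adm 1 q \<kappa>\<close> that unfolding adm_def A1_def by force
    qed (use that in \<open>auto simp: adm_def\<close>)
    moreover have "\<kappa>\<^sup>2 \<le> K1\<^sup>2"
      using that(2) by (intro power2_le_iff_abs_le[THEN iffD2]) (auto simp: adm_def K1_def)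
    ultimately show ?thesis by (simp add: R_def)
  qed
  define f where "f = (\<lambda>j. fst (shoot d (\<lambda>z. q0 z + lam $ j)))"
  define f' where "f' = (\<lambda>j. snd (shoot d (\<lambda>z. q0 z + lam $ j)))"
  have f: "ivp_solution d (\<lambda>z. q0 z + lam $ j) (f j) (f' j)" for j
    unfolding f_def f'_def by (rule shoot_ivp[OF d cq0])
  have f_bd: "f' j d - \<kappa>0 * f j d = 0" for j
    using robin_eigenvalue_iff[OF f d q0] lam_ev[of j] by simp
  define near_at where "near_at = (\<lambda>j \<rho>. \<forall>p p' g g' h h'. ivp_solution d p g g' \<longrightarrow> ivp_solution d p' h h' \<longrightarrow>
       (\<forall>z\<in>{0..d}. \<bar>p z - (q0 z + lam $ j)\<bar> \<le> \<rho>) \<longrightarrow>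
       (\<forall>z\<in>{0..d}. \<bar>p' z - (q0 z + lam $ j)\<bar> \<le> \<rho>) \<longrightarrow> 0 < integral {0..d} (\<lambda>z. g z * h z))"
  have "\<exists>\<rho>>0. near_at j \<rho>" for j
    unfolding near_at_def by (rule ivp_products_positive_nearby[OF f[of j] d cq0])
  then obtain \<rho>' where rho': "\<And>j. 0 < \<rho>' j" and rho'_near: "\<And>j. near_at j (\<rho>' j)"
    by metis
  have near: "0 < integral {0..d} (\<lambda>z. g z * h z)"
    if "ivp_solution d p g g'" "ivp_solution d p' h h'"
      "\<And>z. z \<in> {0..d} \<Longrightarrow> \<bar>p z - (q0 z + lam $ j)\<bar> \<le> \<rho>' j"
      "\<And>z. z \<in> {0..d} \<Longrightarrow> \<bar>p' z - (q0 z + lam $ j)\<bar> \<le> \<rho>' j" for j p p' g g' h h'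
    using rho'_near[of j] that unfolding near_at_def by blast
  have less: "\<forall>\<^sub>F x in at_right 0. x < c" if "0 < c" for c :: real
    using that by (rule order_tendstoD(2)[OF tendsto_ident_at])
  have sep: "0 < \<bar>lam $ i - lam $ j\<bar>" if "i \<noteq> j" for i j
    using strict_mono_eq[OF mono, of i j] that by simp
  \<comment> \<open>The radius of the intervals around the \<open>lam $ j\<close>: they are disjoint, negative and inside the
      neighbourhoods in which products of solutions have positive integral even after a
      perturbation of the potential by \<open>\<rho>\<close>.\<close>
  define small where "small \<rho> \<longleftrightarrow> (0 < \<rho> \<and> \<rho> < r \<and> \<rho> < 1 \<and> (\<forall>j. \<rho> < \<rho>' j / 2) \<and> (\<forall>j. \<rho> < - lam $ j) \<and>
      (\<forall>i j. i \<noteq> j \<longrightarrow> \<rho> < \<bar>lam $ i - lam $ j\<bar> / 2))" for \<rho>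
  have "\<forall>\<^sub>F \<rho> in at_right 0. small \<rho>" unfolding small_def[abs_def]
  proof (intro eventually_conj eventually_all_finite)
    show "\<forall>\<^sub>F x in at_right 0. i \<noteq> j \<longrightarrow> x < \<bar>lam $ i - lam $ j\<bar> / 2" for i j
      by (cases "i = j") (use less[of "\<bar>lam $ i - lam $ j\<bar> / 2"] sep[of i j] in auto)
    show "\<forall>\<^sub>F x in at_right 0. x < \<rho>' j / 2" for j by (rule less) (use rho'[of j] in simp)
    show "\<forall>\<^sub>F x in at_right 0. x < - lam $ j" for j by (rule less) (use lam_neg[of j] in simp)
  qed (use r in \<open>auto intro: less eventually_at_right_less\<close>)
  then have "\<exists>\<rho>. small \<rho>"
    by (rule eventually_happens'[OF trivial_limit_at_right_real])
  then obtain \<rho> where "small \<rho>" ..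
  then have rho: "0 < \<rho>" "\<rho> < r" "\<rho> < 1" and rho_j: "\<And>j. \<rho> < \<rho>' j / 2" "\<And>j. \<rho> < - lam $ j"
      and rho_sep: "\<And>i j. i \<noteq> j \<Longrightarrow> \<rho> < \<bar>lam $ i - lam $ j\<bar> / 2"
    unfolding small_def by blast+
  have lam_R: "- R + 1 \<le> lam $ j" for j using low[OF lam_ev adm0, of j] by simp
  have in_R: "x \<in> {-R..0}" if "\<bar>x - lam $ j\<bar> \<le> \<rho>" for x j
    using that lam_R[of j] rho rho_j(2)[of j] by auto
  \<comment> \<open>By Lagrange's identity the defect at \<open>x\<close> is \<open>- (x - lam $ j)\<close> times a quantity of constant sign.\<close>
  have sign: "\<exists>I>0. D0 x * f j d = - ((x - lam $ j) * I)" if x: "\<bar>x - lam $ j\<bar> \<le> \<rho>" for x j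
  proof -
    define g where "g = fst (shoot d (\<lambda>z. q0 z + x))"
    define g' where "g' = snd (shoot d (\<lambda>z. q0 z + x))"
    have g: "ivp_solution d (\<lambda>z. q0 z + x) g g'"
      unfolding g_def g'_def by (rule shoot_ivp[OF d cq0])
    have I: "0 < integral {0..d} (\<lambda>z. g z * f j z)"
      by (rule near[OF g f, of j]) (use x rho_j(1)[of j] rho in auto)
    have "((\<lambda>z. ((q0 z + x) - (q0 z + lam $ j)) * (g z * f j z)) has_integral
        g d * (f' j d - \<kappa>0 * f j d) - (g' d - \<kappa>0 * g d) * f j d) {0..d}"
      by (rule robin_defect_product[OF g f d])
    then have "integral {0..d} (\<lambda>z. ((q0 z + x) - (q0 z + lam $ j)) * (g z * f j z)) =
        g d * (f' j d - \<kappa>0 * f j d) - (g' d - \<kappa>0 * g d) * f j d"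
      by (rule integral_unique)
    moreover have "D0 x = g' d - \<kappa>0 * g d"
      by (simp add: D0_def D_def robin_defect_def g_def g'_def)
    ultimately have "D0 x * f j d = - ((x - lam $ j) * integral {0..d} (\<lambda>z. g z * f j z))"
      by (simp add: f_bd)
    with I show ?thesis by blast
  qed
  \<comment> \<open>Otherwise the defect could not be a nonzero multiple of \<open>x - lam $ j\<close>.\<close>
  have f_nz: "f j d \<noteq> 0" for j
  proof
    assume 0: "f j d = 0"
    obtain I where "I > 0" "D0 (lam $ j + \<rho>) * f j d = - (\<rho> * I)"
      using sign[of "lam $ j + \<rho>" j] rho by auto
    then show False using 0 rho by simp
  qed
  define S where "S = {-R..0} - (\<Union>j. {lam $ j - \<rho> <..< lam $ j + \<rho>})"
  have "compact S" unfolding S_def by (intro compact_diff open_UN) auto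
  moreover have "0 \<in> S" using rho_j(2) pos by (auto simp: S_def) (smt (verit))
  moreover have "continuous_on S (\<lambda>x. \<bar>D0 x\<bar>)"
    using Dcont[OF adm0] unfolding D0_def S_def by (intro continuous_intros) (auto elim: continuous_on_subset)
  ultimately obtain x0 where x0: "x0 \<in> S" "\<And>x. x \<in> S \<Longrightarrow> \<bar>D0 x0\<bar> \<le> \<bar>D0 x\<bar>"
    using continuous_attains_inf[of S "\<lambda>x. \<bar>D0 x\<bar>"] by auto
  define m where "m = \<bar>D0 x0\<bar>"
  have m: "0 < m"
  proof (rule ccontr)
    assume "\<not> 0 < m"
    then have "robin_eigenvalue d q0 \<kappa>0 x0" by (simp add: ev[OF q0] m_def D0_def)
    moreover from this have "x0 \<noteq> 0" using zero by auto
    ultimately have "x0 \<in> range (\<lambda>i. lam $ i)" unfolding range using x0(1) by (auto simp: S_def)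
    then obtain j where "x0 = lam $ j" by auto
    then have "x0 \<in> {lam $ j - \<rho> <..< lam $ j + \<rho>}" using rho(1) by simp
    then show False using x0(1) unfolding S_def by blast
  qed
  define e where "e = min \<rho> (m / (2 * C))"
  have e: "0 < e" "e \<le> \<rho>" "e \<le> 1" using rho m C by (auto simp: e_def)
  have Ce: "C * e \<le> m / 2"
  proof -
    have "e \<le> m / (2 * C)" by (simp add: e_def)
    then show ?thesis using C by (simp add: pos_le_divide_eq mult_ac)
  qed
  show ?thesis
  proof (intro exI[of _ e] conjI allI impI)
    show "0 < e" by (rule e(1))
    fix q \<kappa>
    assume q: "continuous_on {0..d} q" and "\<forall>z\<in>{0..d}. \<bar>q z - q0 z\<bar> \<le> e" "\<bar>\<kappa> - \<kappa>0\<bar> \<le> e"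
    then have "adm e q \<kappa>" by (auto simp: adm_def)
    note adm1 = adm_mono[OF this e(3)]
    have close: "\<bar>D q \<kappa> x - D0 x\<bar> \<le> m / 2" if "x \<in> {-R..0}" for x
    proof -
      have "\<bar>D q \<kappa> x - D0 x\<bar> \<le> C * e" unfolding D0_def
        using \<open>adm e q \<kappa>\<close> e by (intro lip[OF adm1 adm0 that that]) (auto simp: adm_def)
      then show ?thesis using Ce by simp
    qed
    have big: "m \<le> \<bar>D0 (lam $ j + s * \<rho>)\<bar>" if "s = 1 \<or> s = -1" for j s
    proof -
      have "lam $ j + s * \<rho> \<notin> {lam $ i - \<rho> <..< lam $ i + \<rho>}" for i
        using rho_sep[of i j] that by (cases "i = j") auto
      moreover have "lam $ j + s * \<rho> \<in> {-R..0}" by (rule in_R[of _ j]) (use that rho in auto)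
      ultimately show ?thesis using x0(2) by (auto simp: S_def m_def)
    qed
    have "\<exists>x. \<bar>x - lam $ j\<bar> \<le> \<rho> \<and> D q \<kappa> x = 0" for j
    proof -
      define h where "h = (\<lambda>x. - D q \<kappa> x * f j d)"
      have dev: "\<bar>h x - (- D0 x * f j d)\<bar> \<le> m / 2 * \<bar>f j d\<bar>" if "x \<in> {-R..0}" for x
      proof -
        have "h x - (- D0 x * f j d) = - ((D q \<kappa> x - D0 x) * f j d)" by (simp add: h_def algebra_simps)
        then have "\<bar>h x - (- D0 x * f j d)\<bar> = \<bar>D q \<kappa> x - D0 x\<bar> * \<bar>f j d\<bar>"
          by (simp only: abs_minus_cancel abs_mult)
        also have "\<dots> \<le> m / 2 * \<bar>f j d\<bar>" by (rule mult_right_mono[OF close[OF that]]) simp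
        finally show ?thesis .
      qed
      have size: "m * \<bar>f j d\<bar> \<le> \<bar>- D0 (lam $ j + s * \<rho>) * f j d\<bar>" if "s = 1 \<or> s = -1" for s
        unfolding abs_mult abs_minus_cancel by (rule mult_right_mono[OF big[OF that]]) simp
      have mf: "0 < m / 2 * \<bar>f j d\<bar>" using m f_nz[of j] by simp
      have "0 \<le> h (lam $ j + \<rho>)"
      proof -
        obtain I where I: "I > 0" "D0 (lam $ j + \<rho>) * f j d = - \<rho> * I"
          using sign[of "lam $ j + \<rho>" j] rho by auto
        have "\<rho> * I > 0" using I rho by simp
        then have "m * \<bar>f j d\<bar> \<le> - (D0 (lam $ j + \<rho>) * f j d)" using size[of 1] I by simp
        moreover have "\<bar>h (lam $ j + \<rho>) - (- D0 (lam $ j + \<rho>) * f j d)\<bar> \<le> m / 2 * \<bar>f j d\<bar>"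
          by (rule dev, rule in_R[of _ j]) (use rho in auto)
        ultimately show ?thesis using mf by (simp, linarith)
      qed
      moreover have "h (lam $ j - \<rho>) \<le> 0"
      proof -
        obtain I where I: "I > 0" "D0 (lam $ j - \<rho>) * f j d = \<rho> * I"
          using sign[of "lam $ j - \<rho>" j] rho by auto
        have "\<rho> * I > 0" using I rho by simp
        then have "m * \<bar>f j d\<bar> \<le> D0 (lam $ j - \<rho>) * f j d" using size[of "-1"] I by simp
        moreover have "\<bar>h (lam $ j - \<rho>) - (- D0 (lam $ j - \<rho>) * f j d)\<bar> \<le> m / 2 * \<bar>f j d\<bar>"
          by (rule dev, rule in_R[of _ j]) (use rho in auto)
        ultimately show ?thesis using mf by (simp, linarith)
      qed
      moreover have "continuous_on {lam $ j - \<rho>..lam $ j + \<rho>} h"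
        unfolding h_def
        by (intro continuous_intros continuous_on_subset[OF Dcont[OF adm1]]) (use in_R[of _ j] in auto)
      ultimately obtain x where "lam $ j - \<rho> \<le> x" "x \<le> lam $ j + \<rho>" "h x = 0"
        using IVT'[of h "lam $ j - \<rho>" 0 "lam $ j + \<rho>"] rho by auto
      then show ?thesis using f_nz[of j] by (intro exI[of _ x]) (auto simp: h_def)
    qed
    then obtain \<nu> where nu: "\<And>j. \<bar>\<nu> j - lam $ j\<bar> \<le> \<rho>" "\<And>j. D q \<kappa> (\<nu> j) = 0" by metis
    \<comment> \<open>Distinct zeros would have orthogonal eigenfunctions.\<close>
    have uniq: "x = y" if "\<bar>x - lam $ j\<bar> \<le> \<rho>" "\<bar>y - lam $ j\<bar> \<le> \<rho>" "D q \<kappa> x = 0" "D q \<kappa> y = 0" for x y j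
    proof -
      have cq: "continuous_on {0..d} (\<lambda>z. q z + \<mu>)" for \<mu> using q by (intro continuous_intros)
      define g where "g = (\<lambda>x. fst (shoot d (\<lambda>z. q z + x)))"
      define g' where "g' = (\<lambda>x. snd (shoot d (\<lambda>z. q z + x)))"
      have g: "ivp_solution d (\<lambda>z. q z + x) (g x) (g' x)" for x
        unfolding g_def g'_def by (rule shoot_ivp[OF d cq])
      have bd: "g' x d - \<kappa> * g x d = 0" "g' y d - \<kappa> * g y d = 0"
        using that(3,4) by (auto simp: D_def robin_defect_def g_def g'_def)
      have cl: "\<bar>q z + t - (q0 z + lam $ j)\<bar> \<le> \<rho>' j" if "\<bar>t - lam $ j\<bar> \<le> \<rho>" "z \<in> {0..d}" for t z
      proof -
        have "\<bar>q z - q0 z\<bar> \<le> \<rho>" using \<open>adm e q \<kappa>\<close> that(2) e(2) unfolding adm_def by force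
        then show ?thesis using that(1) rho_j(1)[of j] by linarith
      qed
      have "0 < integral {0..d} (\<lambda>z. g x z * g y z)"
        by (rule near[OF g g, where j = j]) (use cl that in auto)
      moreover have "((\<lambda>z. ((q z + x) - (q z + y)) * (g x z * g y z)) has_integral 0) {0..d}"
        using robin_defect_product[OF g g d, of x y \<kappa>] by (simp add: bd)
      from integral_unique[OF this] have "(x - y) * integral {0..d} (\<lambda>z. g x z * g y z) = 0"
        by simp
      ultimately show ?thesis by simp
    qed
    define \<mu> where "\<mu> = (\<chi> j. \<nu> j)"
    have "strict_mono (\<lambda>i. \<mu> $ i)"
    proof (rule strict_monoI)
      fix i j :: 'n assume "i < j"
      then have "lam $ i < lam $ j" using mono by (simp add: strict_mono_def)
      moreover have "\<rho> < \<bar>lam $ i - lam $ j\<bar> / 2" by (rule rho_sep) (use \<open>i < j\<close> in simp)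
      ultimately have "lam $ i + \<rho> < lam $ j - \<rho>" by (simp add: abs_if split: if_splits)
      moreover have "\<nu> i \<le> lam $ i + \<rho>" "lam $ j - \<rho> \<le> \<nu> j"
        using nu(1)[of i] nu(1)[of j] by (simp_all add: abs_le_iff)
      ultimately have "\<nu> i < \<nu> j" by simp
      then show "\<mu> $ i < \<mu> $ j" by (simp add: \<mu>_def)
    qed
    moreover have "range (\<lambda>i. \<mu> $ i) = {m. robin_eigenvalue d q \<kappa> m \<and> m < 0}"
    proof (intro equalityI subsetI)
      fix x assume "x \<in> range (\<lambda>i. \<mu> $ i)"
      then obtain j where "x = \<nu> j" by (auto simp: \<mu>_def)
      then show "x \<in> {m. robin_eigenvalue d q \<kappa> m \<and> m < 0}"
        using nu[of j] rho_j(2)[of j] by (auto simp: ev[OF q])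
    next
      fix x assume x: "x \<in> {m. robin_eigenvalue d q \<kappa> m \<and> m < 0}"
      then have xR: "x \<in> {-R..0}" using low[of q \<kappa> x] adm1 pos by auto
      have x0': "D q \<kappa> x = 0" using x by (simp add: ev[OF q])
      have "x \<notin> S"
      proof
        assume "x \<in> S"
        then have "m \<le> \<bar>D0 x\<bar>" using x0(2) by (simp add: m_def)
        then show False using close[OF xR] x0' m by auto
      qed
      then obtain j where "lam $ j - \<rho> < x" "x < lam $ j + \<rho>" using xR by (auto simp: S_def)
      then have "\<bar>x - lam $ j\<bar> \<le> \<rho>" by (simp add: abs_le_iff)
      then have "x = \<nu> j" using uniq[of x j "\<nu> j"] nu x0' by blast
      then show "x \<in> range (\<lambda>i. \<mu> $ i)" by (auto simp: \<mu>_def)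
    qed
    moreover have "\<bar>\<mu> $ i - lam $ i\<bar> < r" for i using nu(1)[of i] rho(2) by (simp add: \<mu>_def)
    ultimately show "\<exists>\<mu>::real^'n::{finite,linorder}. strict_mono (\<lambda>i. \<mu> $ i) \<and>
         range (\<lambda>i. \<mu> $ i) = {m. robin_eigenvalue d q \<kappa> m \<and> m < 0} \<and> (\<forall>i. \<bar>\<mu> $ i - lam $ i\<bar> < r)"
      by blast
  qed
qed

section \<open>Stream solutions for nearly linear vorticity\<close>

text \<open>The energy estimate for the difference to the solution of the linear equation with the same
  initial slope.\<close>

lemma ode2_near_linear:
  assumes ode: "ode2 d w w' r" and w0: "w 0 = 0" and d: "0 < d" and b: "0 < b" and \<eta>: "0 \<le> \<eta>"
    and r: "\<And>z. z \<in> {0<..<d} \<Longrightarrow> \<bar>r z + b * w z\<bar> \<le> \<eta>" and z: "z \<in> {0..d}"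
  shows "\<bar>w z - w' 0 * (sin (sqrt b * z) / sqrt b)\<bar> \<le> growth d b * \<eta>"
    and "\<bar>w' z - w' 0 * cos (sqrt b * z)\<bar> \<le> growth d b * \<eta>"
proof -
  have S: "ode2 d (\<lambda>z. sin (sqrt b * z) / sqrt b) (\<lambda>z. cos (sqrt b * z)) (\<lambda>z. - b * (sin (sqrt b * z) / sqrt b))"
    using b by (intro ode2_closed) (auto intro!: derivative_eq_intros simp: real_div_sqrt field_simps)
  note o = ode2_diff[OF ode ode2_cmult[OF S, of "w' 0"]]
  have "\<bar>r z - w' 0 * (- b * (sin (sqrt b * z) / sqrt b))\<bar>
      \<le> b * \<bar>w z - w' 0 * (sin (sqrt b * z) / sqrt b)\<bar> + \<eta>" if "z \<in> {0<..<d}" for z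
  proof -
    have "r z - w' 0 * (- b * (sin (sqrt b * z) / sqrt b)) =
       (r z + b * w z) - b * (w z - w' 0 * (sin (sqrt b * z) / sqrt b))" by (simp add: algebra_simps)
    also have "\<bar>\<dots>\<bar> \<le> \<eta> + \<bar>b * (w z - w' 0 * (sin (sqrt b * z) / sqrt b))\<bar>"
      using r[OF that] by linarith
    finally show ?thesis using b by (simp add: abs_mult)
  qed
  from ode2_energy_estimate[OF o d _ \<eta> this z] b w0
  show "\<bar>w z - w' 0 * (sin (sqrt b * z) / sqrt b)\<bar> \<le> growth d b * \<eta>"
    "\<bar>w' z - w' 0 * cos (sqrt b * z)\<bar> \<le> growth d b * \<eta>" by simp_all
qed

definition linear_stream' :: "real \<Rightarrow> real \<Rightarrow> real \<Rightarrow> real" where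
  "linear_stream' b d z = sqrt b * cos (sqrt b * z) / sin (sqrt b * d)"

lemma linear_stream_deriv:
  assumes "0 < b" "sin (sqrt b * d) \<noteq> 0"
  shows "(linear_stream b d has_real_derivative linear_stream' b d z) (at z within A)"
    and "(linear_stream' b d has_real_derivative - (b * linear_stream b d z)) (at z within A)"
  unfolding linear_stream_def[abs_def] linear_stream'_def[abs_def]
   by (auto intro!: derivative_eq_intros simp: assms less_imp_le)

lemma linear_stream_ode2:
  assumes "0 < b" "sin (sqrt b * d) \<noteq> 0"
  shows "ode2 d (linear_stream b d) (linear_stream' b d) (\<lambda>z. - (b * linear_stream b d z))"
  by (rule ode2_closed) (rule linear_stream_deriv[OF assms])+

text \<open>Shooting. The solution with initial slope \<open>a\<close> takes at \<open>d\<close> a value whose difference quotients in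
  \<open>a\<close> are close to those of the linear equation, namely to \<open>S = sin (sqrt b * d) / sqrt b\<close>, which is
  not zero. Hence \<open>a \<mapsto> a - (U a d - 1) / S\<close> is a contraction of the real line, and its unique fixed
  point is the only admissible slope. As \<open>a\<close> is arbitrary, uniqueness holds among all stream
  solutions and not just among those near the linear one.\<close>

theorem stream_solution_perturbation:
  assumes d: "0 < d" and b: "0 < b" and s: "sin (sqrt b * d) \<noteq> 0"
  shows "\<exists>e0>0. \<exists>C\<ge>0. \<forall>g e. 0 \<le> e \<longrightarrow> e \<le> e0 \<longrightarrow> (\<forall>x y. \<bar>g x - g y\<bar> \<le> e * \<bar>x - y\<bar>) \<longrightarrow> (\<forall>x. \<bar>g x\<bar> \<le> e) \<longrightarrow>
    (\<exists>u u'. ode2 d u u' (\<lambda>z. - (b * u z + g (u z))) \<and> stream_solution (\<lambda>p. b * p + g p) d u \<and>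
      (\<forall>z\<in>{0..d}. \<bar>u z - linear_stream b d z\<bar> \<le> C * e \<and> \<bar>u' z - linear_stream' b d z\<bar> \<le> C * e) \<and>
      (\<forall>v. stream_solution (\<lambda>p. b * p + g p) d v \<longrightarrow> (\<forall>z\<in>{0..d}. v z = u z)))"
proof -
  define S where "S = sin (sqrt b * d) / sqrt b"
  have S: "S \<noteq> 0" using s b by (simp add: S_def)
  define G where "G = growth d (b + 1)"
  define Gb where "Gb = growth d b"
  have G: "1 \<le> G" "1 \<le> Gb" unfolding G_def Gb_def using d b by (auto intro!: growth_ge_1)
  define e0 where "e0 = min 1 (\<bar>S\<bar> / (2 * (Gb * G)))"
  define C where "C = Gb + Gb / \<bar>S\<bar> + Gb / (\<bar>S\<bar> * sqrt b)"
  have e0: "0 < e0" "e0 \<le> 1" using S G by (auto simp: e0_def)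
  have C: "0 \<le> C" unfolding C_def using G b by (intro add_nonneg_nonneg) auto
  have dd: "d \<in> {0..d}" using d by simp
  show ?thesis
  proof (rule exI[of _ e0], intro conjI e0, rule exI[of _ C], intro conjI C allI impI)
    fix g :: "real \<Rightarrow> real" and e :: real
    assume e: "0 \<le> e" "e \<le> e0" and lip: "\<forall>x y. \<bar>g x - g y\<bar> \<le> e * \<bar>x - y\<bar>" and bd: "\<forall>x. \<bar>g x\<bar> \<le> e"
    have e1: "e \<le> 1" using e e0 by simp
    have gc: "continuous_on UNIV g"
    proof (rule continuous_onI)
      fix x \<epsilon> :: real assume "0 < \<epsilon>"
      have "dist (g y) (g x) \<le> \<epsilon>" if "dist y x < \<epsilon>" for y
      proof -
        have "\<bar>g y - g x\<bar> \<le> 1 * \<bar>y - x\<bar>" using lip e1 by (meson abs_ge_zero mult_right_mono order_trans)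
        then show ?thesis using that by (simp add: dist_real_def)
      qed
      then show "\<exists>t>0. \<forall>y\<in>UNIV. dist y x < t \<longrightarrow> dist (g y) (g x) \<le> \<epsilon>" using \<open>0 < \<epsilon>\<close> by blast
    qed
    have fc: "continuous_on {0..d} (\<lambda>z. b * f z + g (f z))" if "continuous_on {0..d} f" for f
      by (intro continuous_intros that continuous_on_compose2[OF gc that]) auto
    have fl: "\<bar>(b * x + g x) - (b * y + g y)\<bar> \<le> (b + 1) * \<bar>x - y\<bar>" for x y
    proof -
      have "\<bar>g x - g y\<bar> \<le> 1 * \<bar>x - y\<bar>" using lip e1 by (meson abs_ge_zero mult_right_mono order_trans)
      moreover have "(b * x + g x) - (b * y + g y) = b * (x - y) + (g x - g y)" by (simp add: algebra_simps)
      moreover have "\<bar>b * (x - y)\<bar> = b * \<bar>x - y\<bar>" using b by (simp add: abs_mult)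
      ultimately show ?thesis by (simp add: algebra_simps)
    qed
    define sol where "sol a u u' \<longleftrightarrow> u 0 = 0 \<and> u' 0 = a \<and>
        (\<forall>z\<in>{0..d}. (u has_real_derivative u' z) (at z within {0..d}) \<and>
                     (u' has_real_derivative - (b * u z + g (u z))) (at z within {0..d}))" for a u u'
    have "\<exists>u u'. sol a u u'" for a
    proof -
      obtain u u' where "u 0 = 0" "u' 0 = a"
        "\<And>z. z \<in> {0..d} \<Longrightarrow> (u has_real_derivative u' z) (at z within {0..d})"
        "\<And>z. z \<in> {0..d} \<Longrightarrow> (u' has_real_derivative - (b * u z + g (u z))) (at z within {0..d})"
        by (rule ivp_existence[OF d, of "b + 1" "\<lambda>z x. b * x + g x" a]) (use b fl fc in auto)
      then have "sol a u u'" unfolding sol_def by simp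
      then show ?thesis by blast
    qed
    then obtain U U' where U: "\<And>a. sol a (U a) (U' a)" by metis
    have ode: "ode2 d u u' (\<lambda>z. - (b * u z + g (u z)))" if "sol a u u'" for a u u'
      using that unfolding sol_def by (intro ode2_closed) auto
    have diff: "\<bar>u z - v z\<bar> \<le> G * \<bar>a - a'\<bar>"
        "\<bar>u d - v d - (a - a') * S\<bar> \<le> \<bar>S\<bar> / 2 * \<bar>a - a'\<bar>"
      if u: "sol a u u'" and v: "sol a' v v'" and z: "z \<in> {0..d}" for a a' u u' v v' z
    proof -
      note o = ode2_diff[OF ode[OF u] ode[OF v]]
      have i: "u 0 - v 0 = 0" "u' 0 - v' 0 = a - a'" using u v by (auto simp: sol_def)
      have w: "\<bar>u z - v z\<bar> \<le> G * \<bar>a - a'\<bar>" if z: "z \<in> {0..d}" for z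
      proof -
        have "\<bar>- (b * u y + g (u y)) - - (b * v y + g (v y))\<bar> \<le> (b + 1) * \<bar>u y - v y\<bar> + 0" for y
          using fl[of "u y" "v y"] by linarith
        from ode2_energy_estimate(1)[OF o d _ order_refl this z] b show ?thesis by (simp add: G_def i)
      qed
      then show "\<bar>u z - v z\<bar> \<le> G * \<bar>a - a'\<bar>" using z .
      have "\<bar>- (b * u z + g (u z)) - - (b * v z + g (v z)) + b * (u z - v z)\<bar> \<le> e * (G * \<bar>a - a'\<bar>)"
        if "z \<in> {0<..<d}" for z
      proof -
        have "- (b * u z + g (u z)) - - (b * v z + g (v z)) + b * (u z - v z) = g (v z) - g (u z)"
          by (simp add: algebra_simps)
        also have "\<bar>\<dots>\<bar> \<le> e * \<bar>u z - v z\<bar>" using lip by (metis abs_minus_commute)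
        also have "\<dots> \<le> e * (G * \<bar>a - a'\<bar>)" using w[of z] that e by (intro mult_left_mono) auto
        finally show ?thesis .
      qed
      from ode2_near_linear(1)[OF o i(1) d b _ this dd] G e
      have "\<bar>u d - v d - (a - a') * S\<bar> \<le> Gb * (e * (G * \<bar>a - a'\<bar>))" by (simp add: i S_def Gb_def)
      also have "\<dots> = (e * (Gb * G)) * \<bar>a - a'\<bar>" by simp
      also have "\<dots> \<le> \<bar>S\<bar> / 2 * \<bar>a - a'\<bar>"
      proof (rule mult_right_mono)
        have "e \<le> \<bar>S\<bar> / (2 * (Gb * G))" using e by (simp add: e0_def)
        moreover have "0 < 2 * (Gb * G)" using G by simp
        ultimately have "e * (2 * (Gb * G)) \<le> \<bar>S\<bar>" by (simp add: pos_le_divide_eq)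
        then show "e * (Gb * G) \<le> \<bar>S\<bar> / 2" by simp
      qed simp
      finally show "\<bar>u d - v d - (a - a') * S\<bar> \<le> \<bar>S\<bar> / 2 * \<bar>a - a'\<bar>" .
    qed
    define F where "F a = a - (U a d - 1) / S" for a
    have "\<exists>!a. F a = a"
    proof (rule banach_fix_type[of "1/2"])
      show "\<forall>x y. dist (F x) (F y) \<le> 1 / 2 * dist x y"
      proof (intro allI)
        fix x y
        have "F x - F y = - ((U x d - U y d - (x - y) * S) / S)"
          using S by (simp add: F_def field_simps)
        then have "\<bar>F x - F y\<bar> = \<bar>U x d - U y d - (x - y) * S\<bar> / \<bar>S\<bar>" by simp
        also have "\<dots> \<le> (\<bar>S\<bar> / 2 * \<bar>x - y\<bar>) / \<bar>S\<bar>"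
          by (rule divide_right_mono[OF diff(2)[OF U U dd]]) simp
        also have "\<dots> = 1 / 2 * \<bar>x - y\<bar>" using S by simp
        finally show "dist (F x) (F y) \<le> 1 / 2 * dist x y" by (simp add: dist_real_def)
      qed
    qed auto
    moreover have "F a = a \<longleftrightarrow> U a d = 1" for a using S by (simp add: F_def)
    ultimately obtain a where a: "U a d = 1" "\<And>a'. U a' d = 1 \<Longrightarrow> a' = a" by auto
    define u where "u = U a"
    define u' where "u' = U' a"
    have u: "sol a u u'" using U by (simp add: u_def u'_def)
    have ud: "u d = 1" unfolding u_def by (rule a(1))
    have strm: "stream_solution (\<lambda>p. b * p + g p) d u"
      unfolding stream_solution_def using u ud d by (intro conjI exI[of _ u']) (simp_all add: sol_def)
    have uniq: "v z = u z" if strm': "stream_solution (\<lambda>p. b * p + g p) d v" and z: "z \<in> {0..d}" for v z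
    proof -
      have v01: "v 0 = 0" "v d = 1"
        and ex: "\<exists>v'. \<forall>z\<in>{0..d}. (v has_real_derivative v' z) (at z within {0..d}) \<and>
          (v' has_real_derivative - (b * v z + g (v z))) (at z within {0..d})"
        using strm' by (simp_all only: stream_solution_def)
      from ex obtain v' where "\<forall>z\<in>{0..d}. (v has_real_derivative v' z) (at z within {0..d}) \<and>
          (v' has_real_derivative - (b * v z + g (v z))) (at z within {0..d})" ..
      then have v: "sol (v' 0) v v'" "v d = 1" unfolding sol_def using v01 by simp_all
      have eq: "v z = U (v' 0) z" if "z \<in> {0..d}" for z using diff(1)[OF v(1) U[of "v' 0"] that] by simp
      then have "v' 0 = a" using v(2) a(2) dd by metis
      then show ?thesis using eq[OF z] by (simp add: u_def)
    qed
    have est: "\<bar>u z - linear_stream b d z\<bar> \<le> C * e \<and> \<bar>u' z - linear_stream' b d z\<bar> \<le> C * e"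
      if z: "z \<in> {0..d}" for z
    proof -
      define t where "t = u' 0 - linear_stream' b d 0"
      note o = ode2_diff[OF ode[OF u] linear_stream_ode2[OF b s]]
      have i: "u 0 - linear_stream b d 0 = 0" using u by (simp add: sol_def linear_stream_def)
      have r: "\<bar>- (b * u z + g (u z)) - - (b * linear_stream b d z) + b * (u z - linear_stream b d z)\<bar> \<le> e" for z
        using bd by (simp add: algebra_simps)
      note nl = ode2_near_linear[OF o i d b e(1) r, folded t_def Gb_def]
      have "\<bar>t * S\<bar> \<le> Gb * e"
        using nl(1)[OF dd] ud s by (simp add: linear_stream_def S_def)
      then have t: "\<bar>t\<bar> \<le> Gb / \<bar>S\<bar> * e" using S by (simp add: abs_mult field_simps)
      have one: "\<bar>x * sin y\<bar> \<le> \<bar>x\<bar>" "\<bar>x * cos y\<bar> \<le> \<bar>x\<bar>" for x y :: real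
        by (simp_all add: abs_mult mult_left_le)
      have "\<bar>t * (sin (sqrt b * z) / sqrt b)\<bar> = \<bar>t * sin (sqrt b * z)\<bar> / sqrt b" using b by (simp add: abs_mult)
      also have "\<dots> \<le> (Gb / \<bar>S\<bar> * e) / sqrt b"
        using b by (intro divide_right_mono order_trans[OF one(1) t]) auto
      finally have p1: "\<bar>t * (sin (sqrt b * z) / sqrt b)\<bar> \<le> Gb / (\<bar>S\<bar> * sqrt b) * e" by simp
      have p2: "\<bar>t * cos (sqrt b * z)\<bar> \<le> Gb / \<bar>S\<bar> * e" by (rule order_trans[OF one(2) t])
      have q: "0 \<le> Gb / (\<bar>S\<bar> * sqrt b) * e" "0 \<le> Gb / \<bar>S\<bar> * e" using G e b by auto
      have Ce: "C * e = Gb * e + Gb / \<bar>S\<bar> * e + Gb / (\<bar>S\<bar> * sqrt b) * e"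
        by (simp add: C_def algebra_simps)
      have tri: "\<bar>x\<bar> \<le> p + q + r" "\<bar>x\<bar> \<le> p + r + q"
        if "\<bar>x - y\<bar> \<le> p" "\<bar>y\<bar> \<le> r" "0 \<le> q" for x y p q r :: real
        using that by linarith+
      show ?thesis unfolding Ce
        by (intro conjI tri(1)[OF nl(1)[OF z] p1 q(2)] tri(2)[OF nl(2)[OF z] p2 q(1)])
    qed
    show "\<exists>u u'. ode2 d u u' (\<lambda>z. - (b * u z + g (u z))) \<and> stream_solution (\<lambda>p. b * p + g p) d u \<and>
      (\<forall>z\<in>{0..d}. \<bar>u z - linear_stream b d z\<bar> \<le> C * e \<and> \<bar>u' z - linear_stream' b d z\<bar> \<le> C * e) \<and>
      (\<forall>v. stream_solution (\<lambda>p. b * p + g p) d v \<longrightarrow> (\<forall>z\<in>{0..d}. v z = u z))"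
      using ode[OF u] strm est uniq by blast
  qed
qed

section \<open>Smooth bump functions\<close>

lemma power_times_exp_minus_bound:
  fixes y :: real
  assumes "0 \<le> y"
  shows "y ^ n * exp (- y) \<le> fact n"
proof -
  have "y ^ n / fact n \<le> exp y"
  proof -
    have "(\<Sum>k\<in>{n}. y ^ k /\<^sub>R fact k) \<le> (\<Sum>k. y ^ k /\<^sub>R fact k)"
      by (rule sum_le_suminf[OF summable_exp_generic]) (use assms in auto)
    then show ?thesis by (simp add: exp_def scaleR_conv_of_real divide_inverse mult.commute)
  qed
  then show ?thesis by (simp add: exp_minus field_simps)
qed

text \<open>The functions \<open>s ^ i * t ^ j * exp (- s - t)\<close> with \<open>s = 1 / (x - a)\<close> and \<open>t = 1 / (b - x)\<close>, continued
  by zero. Their linear span is closed under differentiation, which gives smoothness without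
  computing higher derivatives.\<close>

definition bump_term :: "real \<Rightarrow> real \<Rightarrow> nat \<Rightarrow> nat \<Rightarrow> real \<Rightarrow> real" where
  "bump_term a b i j x = (if a < x \<and> x < b
     then (1 / (x - a)) ^ i * (1 / (b - x)) ^ j * exp (- (1 / (x - a)) - 1 / (b - x)) else 0)"

lemma bump_term_bound: 
  assumes "a < x" "x < b"
  shows "\<bar>bump_term a b i j x\<bar> \<le> fact (i + 2) * fact j * (x - a)\<^sup>2"
    and "\<bar>bump_term a b i j x\<bar> \<le> fact i * fact (j + 2) * (b - x)\<^sup>2"
proof -
  define s where "s = 1 / (x - a)"
  define t where "t = 1 / (b - x)"
  have st: "0 < s" "0 < t" using assms by (auto simp: s_def t_def)
  have e: "bump_term a b i j x = (s ^ i * exp (- s)) * (t ^ j * exp (- t))"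
    using assms by (simp add: bump_term_def s_def[symmetric] t_def[symmetric] exp_diff exp_minus field_simps)
  have pos: "0 \<le> bump_term a b i j x" unfolding e using st by simp
  have xs: "(x - a)\<^sup>2 = 1 / s\<^sup>2" "(b - x)\<^sup>2 = 1 / t\<^sup>2" by (simp_all add: s_def t_def power_divide)
  have "s ^ i * exp (- s) = (s ^ (i + 2) * exp (- s)) / s\<^sup>2" using st by (simp add: power2_eq_square)
  also have "\<dots> \<le> fact (i + 2) / s\<^sup>2"
    using st by (intro divide_right_mono power_times_exp_minus_bound) auto
  finally have "bump_term a b i j x \<le> (fact (i + 2) / s\<^sup>2) * fact j"
    unfolding e using st by (intro mult_mono power_times_exp_minus_bound) auto
  then show "\<bar>bump_term a b i j x\<bar> \<le> fact (i + 2) * fact j * (x - a)\<^sup>2" using pos by (simp add: xs)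
  have "t ^ j * exp (- t) = (t ^ (j + 2) * exp (- t)) / t\<^sup>2" using st by (simp add: power2_eq_square)
  also have "\<dots> \<le> fact (j + 2) / t\<^sup>2"
    using st by (intro divide_right_mono power_times_exp_minus_bound) auto
  finally have "bump_term a b i j x \<le> fact i * (fact (j + 2) / t\<^sup>2)"
    unfolding e using st by (intro mult_mono power_times_exp_minus_bound) auto
  then show "\<bar>bump_term a b i j x\<bar> \<le> fact i * fact (j + 2) * (b - x)\<^sup>2" using pos by (simp add: xs)
qed

text \<open>At the two endpoints of the support a bump term is differentiable for this reason.\<close>

lemma quadratic_bound_deriv_zero:
  fixes f :: "real \<Rightarrow> real"
  assumes "\<And>x. \<bar>f x\<bar> \<le> C * (x - c)\<^sup>2"
  shows "(f has_real_derivative 0) (at c)"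
proof -
  have f0: "f c = 0" using assms[of c] by simp
  have "((\<lambda>h. f (c + h) / h) \<longlongrightarrow> 0) (at 0)"
  proof (rule Lim_null_comparison)
    show "\<forall>\<^sub>F h in at 0. norm (f (c + h) / h) \<le> C * \<bar>h\<bar>"
    proof (rule always_eventually, rule allI)
      fix h
      have "\<bar>f (c + h)\<bar> \<le> C * h\<^sup>2" using assms[of "c + h"] by simp
      then have "\<bar>f (c + h)\<bar> / \<bar>h\<bar> \<le> C * h\<^sup>2 / \<bar>h\<bar>" by (intro divide_right_mono) auto
      also have "C * h\<^sup>2 / \<bar>h\<bar> = C * \<bar>h\<bar>" by (cases "h = 0") (auto simp: power2_eq_square abs_if)
      finally show "norm (f (c + h) / h) \<le> C * \<bar>h\<bar>" by simp
    qed
    show "((\<lambda>h. C * \<bar>h\<bar>) \<longlongrightarrow> 0) (at 0)" by (auto intro!: tendsto_eq_intros)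
  qed
  then show ?thesis by (simp add: DERIV_def f0)
qed

lemma bump_term_deriv:
  assumes ab: "a < b"
  shows "(bump_term a b i j has_real_derivative
     (- real i * bump_term a b (i + 1) j x + real j * bump_term a b i (j + 1) x +
      bump_term a b (i + 2) j x - bump_term a b i (j + 2) x)) (at x)"
proof -
  consider "x < a" | "x = a" | "a < x \<and> x < b" | "x = b" | "x > b" using ab by linarith
  then show ?thesis
  proof cases
    case 1
    have "((\<lambda>_. 0) has_real_derivative 0) (at x)" by simp
    moreover have "\<forall>\<^sub>F y in nhds x. 0 = bump_term a b i j y"
      using eventually_nhds_in_open[of "{..<a}" x] 1 by (auto elim!: eventually_mono simp: bump_term_def)
    ultimately have "(bump_term a b i j has_real_derivative 0) (at x)"
      using DERIV_cong_ev[of x x "\<lambda>_. 0" "bump_term a b i j" 0 0] by simp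
    then show ?thesis using 1 by (simp add: bump_term_def)
  next
    case 5
    have "((\<lambda>_. 0) has_real_derivative 0) (at x)" by simp
    moreover have "\<forall>\<^sub>F y in nhds x. 0 = bump_term a b i j y"
      using eventually_nhds_in_open[of "{b<..}" x] 5 by (auto elim!: eventually_mono simp: bump_term_def)
    ultimately have "(bump_term a b i j has_real_derivative 0) (at x)"
      using DERIV_cong_ev[of x x "\<lambda>_. 0" "bump_term a b i j" 0 0] by simp
    then show ?thesis using 5 by (simp add: bump_term_def)
  next
    case 2
    have "\<bar>bump_term a b i j y\<bar> \<le> fact (i + 2) * fact j * (y - a)\<^sup>2" for y
    proof (cases "a < y \<and> y < b")
      case True then show ?thesis using bump_term_bound(1) by blast
    next
      case False
      then have "bump_term a b i j y = 0" by (auto simp: bump_term_def)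
      then show ?thesis by simp
    qed
    from quadratic_bound_deriv_zero[OF this] have "(bump_term a b i j has_real_derivative 0) (at a)" .
    moreover have "bump_term a b k l a = 0" for k l by (simp add: bump_term_def)
    ultimately show ?thesis using 2 by simp
  next
    case 4
    have "\<bar>bump_term a b i j y\<bar> \<le> fact i * fact (j + 2) * (y - b)\<^sup>2" for y
    proof (cases "a < y \<and> y < b")
      case True then show ?thesis using bump_term_bound(2)[of a y b i j] by (simp add: power2_commute)
    next
      case False
      then have "bump_term a b i j y = 0" by (auto simp: bump_term_def)
      then show ?thesis by simp
    qed
    from quadratic_bound_deriv_zero[OF this] have "(bump_term a b i j has_real_derivative 0) (at b)" .
    moreover have "bump_term a b k l b = 0" for k l by (simp add: bump_term_def)
    ultimately show ?thesis using 4 by simp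
  next
    case 3
    define f where "f y = (1 / (y - a)) ^ i * (1 / (b - y)) ^ j * exp (- (1 / (y - a)) - 1 / (b - y))" for y
    have ds: "((\<lambda>y. 1 / (y - a)) has_real_derivative - (1 / (x - a))\<^sup>2) (at x)"
      using 3 by (auto intro!: derivative_eq_intros simp: power2_eq_square)
    have dt: "((\<lambda>y. 1 / (b - y)) has_real_derivative (1 / (b - x))\<^sup>2) (at x)"
      using 3 by (auto intro!: derivative_eq_intros simp: power2_eq_square)
    have pw: "real n * s ^ (n - 1) * s\<^sup>2 = real n * s ^ (n + 1)" for n and s :: real
      by (cases n) (auto simp: power2_eq_square)
    define s where "s = 1 / (x - a)"
    define t where "t = 1 / (b - x)"
    have "(f has_real_derivative
        (real i * s ^ (i - 1) * - s\<^sup>2 * t ^ j + s ^ i * (real j * t ^ (j - 1) * t\<^sup>2)) * exp (- s - t)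
        + s ^ i * t ^ j * (exp (- s - t) * (s\<^sup>2 - t\<^sup>2))) (at x)"
      unfolding f_def[abs_def] s_def t_def
      by (rule derivative_eq_intros ds dt refl)+ (simp add: algebra_simps)
    also have "(real i * s ^ (i - 1) * - s\<^sup>2 * t ^ j + s ^ i * (real j * t ^ (j - 1) * t\<^sup>2)) * exp (- s - t)
        + s ^ i * t ^ j * (exp (- s - t) * (s\<^sup>2 - t\<^sup>2)) =
        (- (real i * s ^ (i - 1) * s\<^sup>2) * t ^ j + s ^ i * (real j * t ^ (j - 1) * t\<^sup>2)) * exp (- s - t)
        + s ^ i * t ^ j * (exp (- s - t) * (s\<^sup>2 - t\<^sup>2))" by simp
    also have "\<dots> = - real i * (s ^ (i + 1) * t ^ j * exp (- s - t)) + real j * (s ^ i * t ^ (j + 1) * exp (- s - t))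
        + s ^ (i + 2) * t ^ j * exp (- s - t) - s ^ i * t ^ (j + 2) * exp (- s - t)"
      unfolding pw by (simp add: algebra_simps power2_eq_square)
    also have "\<dots> = - real i * bump_term a b (i + 1) j x + real j * bump_term a b i (j + 1) x +
      bump_term a b (i + 2) j x - bump_term a b i (j + 2) x"
      using 3 by (simp add: bump_term_def s_def t_def)
    finally have *: "(f has_real_derivative - real i * bump_term a b (i + 1) j x + real j * bump_term a b i (j + 1) x +
      bump_term a b (i + 2) j x - bump_term a b i (j + 2) x) (at x)" .
    have "\<forall>\<^sub>F y in nhds x. f y = bump_term a b i j y"
      using eventually_nhds_in_open[of "{a<..<b}" x] 3 by (auto elim!: eventually_mono simp: bump_term_def f_def)
    from DERIV_cong_ev[OF refl this refl] * show ?thesis by simp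
  qed
qed

inductive_set bump_span :: "real \<Rightarrow> real \<Rightarrow> (real \<Rightarrow> real) set" for a b where
  zero: "(\<lambda>_. 0) \<in> bump_span a b"
| add: "f \<in> bump_span a b \<Longrightarrow> (\<lambda>x. c * bump_term a b i j x + f x) \<in> bump_span a b"

lemma bump_span_deriv:
  assumes "f \<in> bump_span a b" and ab: "a < b"
  shows "\<exists>f'\<in>bump_span a b. \<forall>x. (f has_real_derivative f' x) (at x)"
  using assms(1)
proof induction
  case zero
  show ?case by (rule bexI[OF _ bump_span.zero]) auto
next
  case (add f c i j)
  then obtain f' where f': "f' \<in> bump_span a b" "\<And>x. (f has_real_derivative f' x) (at x)" by blast
  define g where "g = (\<lambda>x. (c * - real i) * bump_term a b (i + 1) j x + ((c * real j) * bump_term a b i (j + 1) x +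
      (c * bump_term a b (i + 2) j x + ((- c) * bump_term a b i (j + 2) x + f' x))))"
  have "g \<in> bump_span a b" unfolding g_def by (intro bump_span.add f')
  moreover have "((\<lambda>x. c * bump_term a b i j x + f x) has_real_derivative g x) (at x)" for x
  proof -
    have "((\<lambda>x. c * bump_term a b i j x + f x) has_real_derivative
      c * (- real i * bump_term a b (i + 1) j x + real j * bump_term a b i (j + 1) x +
      bump_term a b (i + 2) j x - bump_term a b i (j + 2) x) + f' x) (at x)"
      by (intro DERIV_add DERIV_cmult bump_term_deriv ab f')
    then show ?thesis by (simp add: g_def algebra_simps)
  qed
  ultimately show ?case by blast
qed

lemma bump_span_higher_deriv:
  assumes "f \<in> bump_span a b" and ab: "a < b"
  shows "(deriv ^^ n) f \<in> bump_span a b"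
proof (induction n)
  case (Suc n)
  obtain f' where f': "f' \<in> bump_span a b" "\<And>x. ((deriv ^^ n) f has_real_derivative f' x) (at x)"
    using bump_span_deriv[OF Suc ab] by blast
  then have "deriv ((deriv ^^ n) f) = f'" by (intro ext DERIV_imp_deriv)
  with f' show ?case by simp
qed (use assms in simp)

lemma bump_function_exists:
  fixes a b :: real
  assumes ab: "0 < a" "a < b" "b < 1"
  obtains \<omega> where "test_function_01 \<omega>" "\<And>x. 0 \<le> \<omega> x" "\<And>x. \<omega> x \<noteq> 0 \<longleftrightarrow> a < x \<and> x < b"
proof
  define \<omega> where "\<omega> = bump_term a b 0 0"
  have nz: "\<omega> x \<noteq> 0 \<longleftrightarrow> a < x \<and> x < b" for x by (simp add: \<omega>_def bump_term_def)
  show "\<omega> x \<noteq> 0 \<longleftrightarrow> a < x \<and> x < b" for x by (rule nz)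
  show "0 \<le> \<omega> x" for x by (simp add: \<omega>_def bump_term_def)
  have "\<omega> \<in> bump_span a b"
    using bump_span.add[OF bump_span.zero, of 1 a b 0 0] by (simp add: \<omega>_def)
  then have span: "(deriv ^^ n) \<omega> \<in> bump_span a b" for n using ab by (intro bump_span_higher_deriv)
  have "(deriv ^^ n) \<omega> differentiable (at x)" for n x
  proof -
    obtain f' where "\<And>x. ((deriv ^^ n) \<omega> has_real_derivative f' x) (at x)"
      using bump_span_deriv[OF span ab(2), of n] by blast
    then show ?thesis unfolding real_differentiable_def by (intro exI)
  qed
  moreover have "{x. \<omega> x \<noteq> 0} = {a<..<b}" by (simp add: nz set_eq_iff)
  then have "closure {x. \<omega> x \<noteq> 0} = {a..b}" using ab by simp
  moreover have "{a..b} \<subseteq> {0<..<1}" using ab by auto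
  ultimately show "test_function_01 \<omega>" unfolding test_function_01_def by simp
qed

section \<open>Summing over the branches of the stream\<close>

lemma sin_plus_nat_pi: "sin (x + real n * pi) = (-1) ^ n * sin x"
proof (induction n)
  case (Suc n)
  have "sin (x + real (Suc n) * pi) = sin ((x + real n * pi) + pi)" by (simp add: algebra_simps)
  also have "\<dots> = - sin (x + real n * pi)" by simp
  finally show ?case using Suc by simp
qed simp

text \<open>For \<open>\<theta>\<close> between \<open>K * \<pi>\<close> and \<open>(K + 1) * \<pi>\<close>, the solutions \<open>t\<close> of \<open>sin t / sin \<theta> = p\<close> in \<open>{0..\<theta>}\<close> lie in the
  half-periods of index \<open>K, K - 2, K - 4, \<dots>\<close>: in the last one at \<open>a + K * \<pi>\<close>, and in each earlier one,
  of index \<open>m\<close>, at \<open>a + m * \<pi>\<close> and \<open>(m + 1) * \<pi> - a\<close>. The sum of an even function over these points is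
  written with \<open>a - (m + 1) * \<pi>\<close> in place of the latter point, so that \<open>a\<close> only occurs as the base point of
  a translation; differentiation then commutes with the sum.\<close>

fun branch_sum :: "nat \<Rightarrow> (real \<Rightarrow> real) \<Rightarrow> real \<Rightarrow> real" where
  "branch_sum 0 F a = F a"
| "branch_sum (Suc 0) F a = F (a + pi)"
| "branch_sum (Suc (Suc K)) F a =
     branch_sum K F a + F (a + real (K + 2) * pi) + F (a - real (K + 1) * pi)"

lemma branch_sum_deriv:
  assumes "\<And>x. (F has_real_derivative F' x) (at x)"
  shows "(branch_sum K F has_real_derivative branch_sum K F' a) (at a)"
proof (induction K rule: induct_nat_012)
  case 0
  then show ?case using assms by simp
next
  case 1
  have "((\<lambda>x. F (x + pi)) has_real_derivative F' (a + pi) * 1) (at a)"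
    by (rule DERIV_chain2[OF assms]) (auto intro!: derivative_eq_intros)
  then show ?case by simp
next
  case (ge2 K)
  have s: "((\<lambda>x. F (x + c)) has_real_derivative F' (a + c) * 1) (at a)" for c
    by (rule DERIV_chain2[OF assms]) (auto intro!: derivative_eq_intros)
  have "((\<lambda>x. branch_sum K F x + F (x + real (K + 2) * pi) + F (x + - (real (K + 1) * pi))) has_real_derivative
      branch_sum K F' a + F' (a + real (K + 2) * pi) * 1 + F' (a + - (real (K + 1) * pi)) * 1) (at a)"
    by (intro DERIV_add s ge2)
  then show ?case by simp
qed

lemma branch_sum_sum: "branch_sum K (\<lambda>x. \<Sum>j\<in>J. c j * F j x) a = (\<Sum>j\<in>J. c j * branch_sum K (F j) a)"
  by (induction K "\<lambda>x. \<Sum>j\<in>J. c j * F j x" a rule: branch_sum.induct)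
     (simp_all add: sum.distrib algebra_simps)

lemma branch_sum_cont: "continuous_on UNIV F \<Longrightarrow> continuous_on A (branch_sum K F)"
proof (induction K F "0::real" rule: branch_sum.induct)
  case (1 F) then show ?case by (auto intro: continuous_on_subset)
next
  case (2 F) then show ?case by (auto intro!: continuous_on_compose2[OF 2] continuous_intros)
next
  case (3 K F)
  have "continuous_on A (\<lambda>x. branch_sum K F x + F (x + real (K + 2) * pi) + F (x - real (K + 1) * pi))"
    by (intro continuous_intros 3 continuous_on_compose2[OF 3(2)]) auto
  then show ?case by simp
qed

lemma integral_zero_on:
  fixes f :: "real \<Rightarrow> real"
  assumes "\<And>x. x \<in> {a..b} \<Longrightarrow> f x = 0"
  shows "integral {a..b} f = 0"
  using integral_cong[of "{a..b}" f "\<lambda>_. 0"] assms by simp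

text \<open>On half-periods of the wrong sign the argument of \<open>W\<close> is not positive and the integrand vanishes.
  Every other quarter period is a translate or a reflection of \<open>{0..\<pi>/2}\<close>.\<close>

lemma branch_integral:
  assumes W: "continuous_on UNIV W" "\<And>p. p \<le> 0 \<Longrightarrow> W p = 0" and s: "0 < s"
    and F: "continuous_on UNIV F" "\<And>x. F (- x) = F x"
  shows "integral {0..real K * pi + pi / 2} (\<lambda>t. W ((-1) ^ K * sin t / s) * F t) =
         integral {0..pi / 2} (\<lambda>a. W (sin a / s) * branch_sum K F a)"
proof -
  define f where "f K t = W ((-1) ^ K * sin t / s) * F t" for K and t :: real
  have cf: "continuous_on A (f K)" for A K
    unfolding f_def using s
    by (intro continuous_intros continuous_on_compose2[OF W(1)] continuous_on_subset[OF F(1)]) auto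
  have int: "f K integrable_on {a..b}" for K a b by (rule integrable_continuous_interval[OF cf])
  have up: "integral {real K * pi..real K * pi + pi / 2} (f K) =
       integral {0..pi/2} (\<lambda>a. W (sin a / s) * F (a + real K * pi))" for K
  proof -
    have "integral {real K * pi..real K * pi + pi / 2} (f K) =
        integral {0..pi/2} (\<lambda>x. f K (x + real K * pi))"
      using integral_shift_real_ivl[of "real K * pi" "real K * pi" "real K * pi + pi / 2" "f K"] by simp
    also have "\<dots> = integral {0..pi/2} (\<lambda>a. W (sin a / s) * F (a + real K * pi))"
      by (rule integral_cong)
         (simp add: f_def sin_plus_nat_pi mult.assoc[symmetric] power_mult_distrib[symmetric])
    finally show ?thesis .
  qed
  have zero: "integral {real (K + 1) * pi..real (K + 2) * pi} (f K) = 0" for K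
  proof (rule integral_zero_on)
    fix x assume x: "x \<in> {real (K + 1) * pi..real (K + 2) * pi}"
    define y where "y = x - real (K + 1) * pi"
    have "0 \<le> y" "y \<le> pi" using x by (auto simp: y_def algebra_simps)
    then have "0 \<le> sin y" by (rule sin_ge_zero)
    moreover have "(-1) ^ K * sin x = - sin y"
      using sin_plus_nat_pi[of y "K + 1"] by (simp add: y_def mult.assoc[symmetric] power_mult_distrib[symmetric])
    ultimately have "(-1) ^ K * sin x / s \<le> 0" using s by (simp add: divide_nonpos_pos)
    then show "f K x = 0" by (simp add: f_def W(2))
  qed
  have down: "integral {real K * pi + pi / 2..real (K + 1) * pi} (f K) =
      integral {0..pi/2} (\<lambda>a. W (sin a / s) * F (a - real (K + 1) * pi))" for K
  proof -
    have "integral {real K * pi + pi / 2..real (K + 1) * pi} (f K) =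
       integral {- (pi / 2)..0} (\<lambda>x. f K (x + real (K + 1) * pi))"
      using integral_shift_real_ivl[of "real K * pi + pi / 2" "real (K + 1) * pi" "real (K + 1) * pi" "f K"]
      by (simp add: algebra_simps)
    also have "\<dots> = integral {0..pi / 2} (\<lambda>x. f K (- x + real (K + 1) * pi))"
      using Henstock_Kurzweil_Integration.integral_reflect_real[of "pi/2" 0 "\<lambda>x. f K (- x + real (K + 1) * pi)"] by simp
    also have "\<dots> = integral {0..pi/2} (\<lambda>a. W (sin a / s) * F (a - real (K + 1) * pi))"
    proof (rule integral_cong)
      fix a :: real
      have "F (- a + real (K + 1) * pi) = F (a - real (K + 1) * pi)"
        using F(2)[of "a - real (K + 1) * pi"] by (simp add: algebra_simps)
      then show "f K (- a + real (K + 1) * pi) = W (sin a / s) * F (a - real (K + 1) * pi)"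
        unfolding f_def sin_plus_nat_pi by (simp add: mult.assoc[symmetric] power_mult_distrib[symmetric])
    qed
    finally show ?thesis .
  qed
  have ci: "(\<lambda>a. W (sin a / s) * H a) integrable_on {0..pi/2}" if "continuous_on UNIV H" for H
    by (intro integrable_continuous_interval continuous_intros continuous_on_compose2[OF W(1)]
        continuous_on_subset[OF that]) (use s in auto)
  have main: "integral {0..real K * pi + pi / 2} (f K) = integral {0..pi / 2} (\<lambda>a. W (sin a / s) * branch_sum K F a)"
  proof (induction K rule: induct_nat_012)
    case 0
    then show ?case using up[of 0] by simp
  next
    case 1
    have "integral {0..pi + pi / 2} (f 1) = integral {0..pi} (f 1) + integral {pi..pi + pi/2} (f 1)"
      by (rule Henstock_Kurzweil_Integration.integral_combine[symmetric]) (use int in auto)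
    moreover have "integral {0..pi} (f 1) = 0"
    proof (rule integral_zero_on)
      fix x assume "x \<in> {0..pi}"
      then have "0 \<le> sin x" by (intro sin_ge_zero) auto
      then have "- sin x / s \<le> 0" using s by (simp add: divide_nonpos_pos)
      then show "f 1 x = 0" using W(2) by (simp add: f_def)
    qed
    ultimately show ?case using up[of 1] by simp
  next
    case (ge2 K)
    let ?I = "\<lambda>a b. integral {a..b} (f K)"
    have f2: "f (Suc (Suc K)) = f K" by (simp add: f_def fun_eq_iff)
    have le: "0 \<le> real K * pi + pi / 2" "real K * pi + pi / 2 \<le> real (K + 1) * pi"
       "real (K + 1) * pi \<le> real (K + 2) * pi" "real (K + 2) * pi \<le> real (K + 2) * pi + pi / 2"
      by (auto simp: algebra_simps)
    have "?I 0 (real (K + 2) * pi + pi / 2) =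
       ?I 0 (real K * pi + pi / 2) + ?I (real K * pi + pi / 2) (real (K + 2) * pi + pi / 2)"
      by (rule Henstock_Kurzweil_Integration.integral_combine[OF _ _ int, symmetric]) (use le in linarith)+
    also have "?I (real K * pi + pi / 2) (real (K + 2) * pi + pi / 2) =
       ?I (real K * pi + pi / 2) (real (K + 1) * pi) + ?I (real (K + 1) * pi) (real (K + 2) * pi + pi / 2)"
      by (rule Henstock_Kurzweil_Integration.integral_combine[OF _ _ int, symmetric]) (use le in linarith)+
    also have "?I (real (K + 1) * pi) (real (K + 2) * pi + pi / 2) =
       ?I (real (K + 1) * pi) (real (K + 2) * pi) + ?I (real (K + 2) * pi) (real (K + 2) * pi + pi / 2)"
      by (rule Henstock_Kurzweil_Integration.integral_combine[OF _ _ int, symmetric]) (use le in linarith)+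
    finally have "?I 0 (real (K + 2) * pi + pi / 2) = integral {0..pi / 2} (\<lambda>a. W (sin a / s) * branch_sum K F a)
        + integral {0..pi/2} (\<lambda>a. W (sin a / s) * F (a - real (K + 1) * pi))
        + integral {0..pi/2} (\<lambda>a. W (sin a / s) * F (a + real (K + 2) * pi))"
      using ge2(1) zero[of K] down[of K] up[of "K + 2"] f2 by simp
    also have "\<dots> = integral {0..pi / 2} (\<lambda>a. W (sin a / s) * branch_sum K F a
        + W (sin a / s) * F (a - real (K + 1) * pi) + W (sin a / s) * F (a + real (K + 2) * pi))"
    proof -
      have c: "continuous_on UNIV (\<lambda>a. F (a + x))" "continuous_on UNIV (\<lambda>a. F (a - x))" for x
        by (intro continuous_on_compose2[OF F(1)] continuous_intros; simp)+
      note i = ci[OF branch_sum_cont[OF F(1)], of K] ci[OF c(1)] ci[OF c(2)]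
      show ?thesis
        by (simp only: Henstock_Kurzweil_Integration.integral_add[OF i(1) i(3)]
             Henstock_Kurzweil_Integration.integral_add[OF integrable_add[OF i(1) i(3)] i(2)])
    qed
    finally show ?case by (simp add: f2 algebra_simps)
  qed
  then show ?thesis unfolding f_def[abs_def] .
qed

text \<open>Between \<open>\<theta>\<close> and the midpoint \<open>K * \<pi> + \<pi>/2\<close> of its half-period the argument of \<open>W\<close> is at least \<open>1\<close>, so
  that the integral may end at either point.\<close>

lemma branch_integral_truncated:
  assumes W: "continuous_on UNIV W" "\<And>p. p \<le> 0 \<Longrightarrow> W p = 0" "\<And>p. 1 \<le> p \<Longrightarrow> W p = 0"
    and F: "continuous_on UNIV F" "\<And>x. F (- x) = F x"
    and \<theta>: "real K * pi < \<theta>" "\<theta> < real (K + 1) * pi"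
  shows "integral {0..\<theta>} (\<lambda>t. W (sin t / sin \<theta>) * F t) =
         integral {0..pi / 2} (\<lambda>a. W (sin a / \<bar>sin \<theta>\<bar>) * branch_sum K F a)"
proof -
  define y where "y = \<theta> - real K * pi"
  have y: "0 < y" "y < pi" using \<theta> by (auto simp: y_def algebra_simps)
  have sy: "0 < sin y" using y by (rule sin_gt_zero)
  have sth: "sin \<theta> = (-1) ^ K * sin y" using sin_plus_nat_pi[of y K] by (simp add: y_def)
  have abs: "\<bar>sin \<theta>\<bar> = sin y" using sy by (simp add: sth abs_mult)
  have quot: "sin t / sin \<theta> = (-1) ^ K * sin t / sin y" for t
    unfolding sth by (cases "even K") auto
  define f where "f t = W ((-1) ^ K * sin t / sin y) * F t" for t
  have cf: "continuous_on A f" for A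
    unfolding f_def using sy
    by (intro continuous_intros continuous_on_compose2[OF W(1)] continuous_on_subset[OF F(1)]) auto
  have int: "f integrable_on {a..b}" for a b by (rule integrable_continuous_interval[OF cf])
  have "0 \<le> real K * pi" by simp
  then have th0: "0 \<le> \<theta>" using \<theta>(1) by linarith
  have f0: "f t = 0" if t: "t \<in> {min \<theta> (real K * pi + pi / 2)..max \<theta> (real K * pi + pi / 2)}" for t
  proof -
    define x where "x = t - real K * pi"
    have "min y (pi/2) \<le> x" "x \<le> max y (pi/2)" using t by (auto simp: x_def y_def min_def max_def split: if_splits)
    then have "sin y \<le> sin x"
    proof (cases "y \<le> pi / 2")
      case True
      then show ?thesis using \<open>min y (pi/2) \<le> x\<close> \<open>x \<le> max y (pi/2)\<close> y by (intro sin_monotone_2pi_le) auto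
    next
      case False
      have "sin (pi - y) \<le> sin (pi - x)"
        using \<open>min y (pi/2) \<le> x\<close> \<open>x \<le> max y (pi/2)\<close> y False by (intro sin_monotone_2pi_le) auto
      then show ?thesis by simp
    qed
    moreover have "(-1) ^ K * sin t = sin x"
      using sin_plus_nat_pi[of x K] by (simp add: x_def mult.assoc[symmetric] power_mult_distrib[symmetric])
    ultimately have "1 \<le> (-1) ^ K * sin t / sin y" using sy by simp
    then show ?thesis by (simp add: f_def W(3))
  qed
  have "integral {0..\<theta>} f = integral {0..real K * pi + pi / 2} f"
  proof (cases "\<theta> \<le> real K * pi + pi / 2")
    case True
    have "integral {0..\<theta>} f + integral {\<theta>..real K * pi + pi / 2} f = integral {0..real K * pi + pi / 2} f"
      by (rule Henstock_Kurzweil_Integration.integral_combine[OF th0 True int])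
    moreover have "integral {\<theta>..real K * pi + pi / 2} f = 0"
      by (rule integral_zero_on) (use f0 True in auto)
    ultimately show ?thesis by simp
  next
    case False
    have "integral {0..real K * pi + pi / 2} f + integral {real K * pi + pi / 2..\<theta>} f = integral {0..\<theta>} f"
      by (rule Henstock_Kurzweil_Integration.integral_combine[OF _ _ int]) (use False in auto)
    moreover have "integral {real K * pi + pi / 2..\<theta>} f = 0"
      by (rule integral_zero_on) (use f0 False in auto)
    ultimately show ?thesis by simp
  qed
  then show ?thesis
    unfolding abs quot using branch_integral[OF W(1,2) sy F, of K] by (simp add: f_def[abs_def])
qed

section \<open>Independence of the branch sums\<close>

text \<open>The solution of \<open>f'' = - (\<tau> * f)\<close> with \<open>f 0 = 0\<close>, \<open>f' 0 = 1\<close>, for a parameter \<open>\<tau>\<close> of any sign. The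
  eigenfunctions of the unperturbed problem are of this form on the whole real line, where they
  are odd.\<close>

definition osc :: "real \<Rightarrow> real \<Rightarrow> real" where
  "osc \<tau> x = (if \<tau> > 0 then sin (sqrt \<tau> * x) / sqrt \<tau> else if \<tau> = 0 then x
             else sinh (sqrt (- \<tau>) * x) / sqrt (- \<tau>))"

definition osc' :: "real \<Rightarrow> real \<Rightarrow> real" where
  "osc' \<tau> x = (if \<tau> > 0 then cos (sqrt \<tau> * x) else if \<tau> = 0 then 1 else cosh (sqrt (- \<tau>) * x))"

lemma osc_deriv: "(osc \<tau> has_real_derivative osc' \<tau> x) (at x within A)"
proof -
  have s: "((\<lambda>x. sin (s * x) / s) has_real_derivative cos (s * x)) (at x within A)"
       "((\<lambda>x. sinh (s * x) / s) has_real_derivative cosh (s * x)) (at x within A)" if "0 < s" for s :: real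
    using that by (auto intro!: derivative_eq_intros)
  consider "\<tau> > 0" | "\<tau> = 0" | "\<tau> < 0" by linarith
  then show ?thesis
    by cases (use s[of "sqrt \<tau>"] s[of "sqrt (- \<tau>)"] in \<open>simp_all add: osc_def[abs_def] osc'_def\<close>)
qed

lemma osc'_deriv: "(osc' \<tau> has_real_derivative - (\<tau> * osc \<tau> x)) (at x within A)"
proof -
  have s: "((\<lambda>x. cos (s * x)) has_real_derivative - (s\<^sup>2 * (sin (s * x) / s))) (at x within A)"
       "((\<lambda>x. cosh (s * x)) has_real_derivative s\<^sup>2 * (sinh (s * x) / s)) (at x within A)" if "0 < s" for s :: real
    using that by (auto intro!: derivative_eq_intros simp: power2_eq_square)
  consider "\<tau> > 0" | "\<tau> = 0" | "\<tau> < 0" by linarith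
  then show ?thesis
    by cases (use s[of "sqrt \<tau>"] s[of "sqrt (- \<tau>)"] in \<open>simp_all add: osc_def osc'_def[abs_def]\<close>)
qed

lemma osc_minus: "osc \<tau> (- x) = - osc \<tau> x"
  by (simp add: osc_def)

lemma osc'_minus: "osc' \<tau> (- x) = osc' \<tau> x"
  by (simp add: osc'_def)

definition osc_sq' :: "real \<Rightarrow> real \<Rightarrow> real" where
  "osc_sq' \<tau> x = 2 * osc \<tau> x * osc' \<tau> x"

definition osc_sq'' :: "real \<Rightarrow> real \<Rightarrow> real" where
  "osc_sq'' \<tau> x = 2 * (osc' \<tau> x)\<^sup>2 - 2 * \<tau> * (osc \<tau> x)\<^sup>2"

lemma osc_sq_deriv: "((\<lambda>x. (osc \<tau> x)\<^sup>2) has_real_derivative osc_sq' \<tau> x) (at x)"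
  by (rule derivative_eq_intros osc_deriv refl)+ (simp add: osc_sq'_def)

lemma osc_sq'_deriv: "(osc_sq' \<tau> has_real_derivative osc_sq'' \<tau> x) (at x)"
  unfolding osc_sq'_def[abs_def]
  by (rule derivative_eq_intros osc_deriv osc'_deriv refl)+
     (simp add: osc_sq''_def power2_eq_square algebra_simps)

lemma osc_sq''_deriv: "(osc_sq'' \<tau> has_real_derivative - 4 * \<tau> * osc_sq' \<tau> x) (at x)"
  unfolding osc_sq''_def[abs_def]
  by (rule derivative_eq_intros osc_deriv osc'_deriv refl)+
     (simp add: osc_sq'_def power2_eq_square algebra_simps)

text \<open>The two points added in each recursion step have positive sum, so an odd increasing function has
  positive sum over them.\<close>

lemma branch_sum_pos:
  assumes mono: "strict_mono f" and odd: "\<And>x. f (- x) = - f x" and a: "(0::real) < a"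
  shows "0 < branch_sum K f a"
proof -
  have f0: "f 0 = 0" using odd[of 0] by simp
  have pos: "0 < f x" if "0 < x" for x using strict_monoD[OF mono that] f0 by simp
  show ?thesis
  proof (induction K rule: induct_nat_012)
    case (ge2 K)
    have "real (K + 1) * pi - a < a + real (K + 2) * pi"
      using a by (simp add: algebra_simps add_pos_pos)
    from strict_monoD[OF mono this] have "0 < f (a + real (K + 2) * pi) + f (a - real (K + 1) * pi)"
      using odd[of "a - real (K + 1) * pi"] by simp
    then show ?case using ge2(1) by simp
  qed (use pos[OF a] pos[OF add_pos_pos[OF a pi_gt_zero]] in auto)
qed

text \<open>Multiplied by \<open>2 * sin (2 * \<nu> * \<pi>)\<close>, the sum over each of the two families of points telescopes.\<close>

lemma branch_sum_sin:
  "2 * sin (2 * \<nu> * pi) * branch_sum K (\<lambda>x. sin (2 * \<nu> * x)) a =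
     (-1) ^ K * (cos (2 * \<nu> * (a - pi)) - cos (2 * \<nu> * a)) +
     (cos (2 * \<nu> * (a - real K * pi)) - cos (2 * \<nu> * (a + real (K + 1) * pi)))"
proof (induction K rule: induct_nat_012)
  have st: "2 * sin (2 * \<nu> * pi) * sin (2 * \<nu> * x) = cos (2 * \<nu> * (x - pi)) - cos (2 * \<nu> * (x + pi))" for x
  proof -
    have "2 * sin (2 * \<nu> * pi) * sin (2 * \<nu> * x) = cos (2 * \<nu> * x - 2 * \<nu> * pi) - cos (2 * \<nu> * x + 2 * \<nu> * pi)"
      using sin_times_sin[of "2 * \<nu> * x" "2 * \<nu> * pi"] by (simp add: mult_ac)
    then show ?thesis by (simp add: algebra_simps)
  qed
  {
    case 0
    show ?case using st[of a] by simp
  next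
    case 1
    show ?case using st[of "a + pi"] by (simp add: algebra_simps)
  next
    case (ge2 K)
    have "2 * sin (2 * \<nu> * pi) * branch_sum (Suc (Suc K)) (\<lambda>x. sin (2 * \<nu> * x)) a =
       2 * sin (2 * \<nu> * pi) * branch_sum K (\<lambda>x. sin (2 * \<nu> * x)) a
       + 2 * sin (2 * \<nu> * pi) * sin (2 * \<nu> * (a + real (K + 2) * pi))
       + 2 * sin (2 * \<nu> * pi) * sin (2 * \<nu> * (a - real (K + 1) * pi))"
      by (simp add: distrib_left)
    also have "\<dots> = ((-1) ^ K * (cos (2 * \<nu> * (a - pi)) - cos (2 * \<nu> * a)) +
     (cos (2 * \<nu> * (a - real K * pi)) - cos (2 * \<nu> * (a + real (K + 1) * pi))))
      + (cos (2 * \<nu> * (a + real (K + 2) * pi - pi)) - cos (2 * \<nu> * (a + real (K + 2) * pi + pi)))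
      + (cos (2 * \<nu> * (a - real (K + 1) * pi - pi)) - cos (2 * \<nu> * (a - real (K + 1) * pi + pi)))"
      unfolding ge2(1) st ..
    also have "a + real (K + 2) * pi - pi = a + real (K + 1) * pi" by (simp add: algebra_simps)
    also have "a + real (K + 2) * pi + pi = a + real (Suc (Suc K) + 1) * pi" by (simp add: algebra_simps)
    also have "a - real (K + 1) * pi - pi = a - real (Suc (Suc K)) * pi" by (simp add: algebra_simps)
    also have "a - real (K + 1) * pi + pi = a - real K * pi" by (simp add: algebra_simps)
    finally show ?case by simp
  }
qed

text \<open>For \<open>\<tau> \<le> 0\<close> the summed function is odd and increasing. For \<open>\<tau> = \<nu>\<^sup>2 > 0\<close> the closed form above is a
  combination \<open>X * sin (\<nu> * (2 * a - \<pi>)) + Y * sin (\<nu> * (2 * a + \<pi>))\<close> with \<open>X \<noteq> 0\<close>; if it vanished on an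
  interval together with its derivative, then \<open>X * sin (2 * \<nu> * \<pi>) = 0\<close>, which forces \<open>\<nu> = 1/2\<close>.\<close>

lemma branch_sum_osc_sq'_nonzero:
  assumes \<tau>: "\<tau> < 1" "\<tau> \<noteq> 1 / 4" and r: "0 < r"
  shows "\<exists>a\<in>{0<..<r}. branch_sum K (osc_sq' \<tau>) a \<noteq> 0"
proof (cases "\<tau> \<le> 0")
  case True
  have "strict_mono (osc_sq' \<tau>)"
  proof (rule strict_monoI)
    fix x y :: real assume "x < y"
    show "osc_sq' \<tau> x < osc_sq' \<tau> y"
    proof (rule DERIV_pos_imp_increasing[OF \<open>x < y\<close>])
      fix z
      have "0 < osc' \<tau> z" using True by (simp add: osc'_def cosh_real_pos)
      moreover have "2 * \<tau> * (osc \<tau> z)\<^sup>2 \<le> 0" using True mult_nonpos_nonneg[of "2 * \<tau>" "(osc \<tau> z)\<^sup>2"] by simp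
      ultimately have "0 < osc_sq'' \<tau> z" unfolding osc_sq''_def
        by (smt (verit) zero_less_power)
      then show "\<exists>y. (osc_sq' \<tau> has_real_derivative y) (at z) \<and> 0 < y" using osc_sq'_deriv by blast
    qed
  qed
  then have "0 < branch_sum K (osc_sq' \<tau>) (r / 2)"
    by (rule branch_sum_pos) (use r in \<open>auto simp: osc_sq'_def osc_minus osc'_minus\<close>)
  then show ?thesis using r by (intro bexI[of _ "r / 2"]) auto
next
  case False
  define \<nu> where "\<nu> = sqrt \<tau>"
  have nu: "0 < \<nu>" "\<nu> < 1" "\<nu>\<^sup>2 = \<tau>" using False \<tau> by (auto simp: \<nu>_def)
  have nu2: "\<nu> \<noteq> 1 / 2"
  proof
    assume h: "\<nu> = 1 / 2"
    have "(1 / 2)\<^sup>2 = \<tau>" using nu(3) unfolding h .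
    then show False using \<tau>(2) by (simp add: power_divide)
  qed
  have sq': "osc_sq' \<tau> x = 1 / \<nu> * sin (2 * \<nu> * x)" for x
    using False nu by (simp add: osc_sq'_def osc_def osc'_def \<nu>_def[symmetric] sin_double mult.assoc)
  have scale: "branch_sum K (osc_sq' \<tau>) a = 1 / \<nu> * branch_sum K (\<lambda>x. sin (2 * \<nu> * x)) a" for a
    unfolding sq'[abs_def] by (induction K rule: induct_nat_012) (simp_all add: algebra_simps add_divide_distrib)
  have snu: "0 < sin (\<nu> * pi)" using nu by (intro sin_gt_zero) auto
  have s2nu: "sin (2 * \<nu> * pi) \<noteq> 0"
  proof
    assume "sin (2 * \<nu> * pi) = 0"
    then have "cos (\<nu> * pi) = 0" using snu sin_double[of "\<nu> * pi"] by (simp add: mult.assoc)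
    moreover have "cos (pi / 2) = 0" by simp
    ultimately have "\<nu> * pi = pi / 2"
      by - (rule cos_inj_pi, use nu in auto)
    then show False using nu2 by simp
  qed
  define X where "X = (-1) ^ K * sin (\<nu> * pi)"
  define Y where "Y = sin (\<nu> * real (2 * K + 1) * pi)"
  define Z where "Z a = X * sin (\<nu> * (2 * a - pi)) + Y * sin (\<nu> * (2 * a + pi))" for a
  have cc: "cos x - cos y = 2 * (sin ((x + y) / 2) * sin ((y - x) / 2))" for x y :: real
    using cos_diff_cos[of x y] by (simp add: mult.assoc)
  have Z: "sin (2 * \<nu> * pi) * branch_sum K (\<lambda>x. sin (2 * \<nu> * x)) a = Z a" for a
  proof -
    have "cos (2 * \<nu> * (a - pi)) - cos (2 * \<nu> * a) = 2 * (sin (\<nu> * (2 * a - pi)) * sin (\<nu> * pi))"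
      unfolding cc by (intro arg_cong2[of _ _ _ _ "\<lambda>x y. 2 * (sin x * sin y)"]) (simp_all add: field_simps)
    moreover have "cos (2 * \<nu> * (a - real K * pi)) - cos (2 * \<nu> * (a + real (K + 1) * pi)) =
        2 * (sin (\<nu> * (2 * a + pi)) * sin (\<nu> * real (2 * K + 1) * pi))"
      unfolding cc by (intro arg_cong2[of _ _ _ _ "\<lambda>x y. 2 * (sin x * sin y)"]) (simp_all add: field_simps)
    ultimately show ?thesis using branch_sum_sin[of \<nu> K a] by (simp add: Z_def X_def Y_def algebra_simps)
  qed
  show ?thesis
  proof (rule ccontr)
    assume "\<not> ?thesis"
    then have "branch_sum K (osc_sq' \<tau>) a = 0" if "a \<in> {0<..<r}" for a using that by blast
    then have Z0: "Z a = 0" if "a \<in> {0<..<r}" for a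
      using that nu Z[of a] unfolding scale by simp
    define a where "a = r / 2"
    have a: "a \<in> {0<..<r}" using r by (simp add: a_def)
    have "(Z has_real_derivative 2 * \<nu> * (X * cos (\<nu> * (2 * a - pi)) + Y * cos (\<nu> * (2 * a + pi)))) (at a)"
      unfolding Z_def[abs_def]
      by (rule derivative_eq_intros refl)+ (simp add: algebra_simps)
    moreover have "(Z has_real_derivative 0) (at a)"
      by (rule has_field_derivative_transform_within_open[of "\<lambda>_. 0" _ _ "{0<..<r}"]) (use a Z0 in auto)
    ultimately have "2 * \<nu> * (X * cos (\<nu> * (2 * a - pi)) + Y * cos (\<nu> * (2 * a + pi))) = 0"
      using DERIV_unique by blast
    then have c: "X * cos (\<nu> * (2 * a - pi)) + Y * cos (\<nu> * (2 * a + pi)) = 0" using nu by simp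
    have z: "X * sin (\<nu> * (2 * a - pi)) + Y * sin (\<nu> * (2 * a + pi)) = 0" using Z0[OF a] by (simp add: Z_def)
    define p q where "p = \<nu> * (2 * a - pi)" "q = \<nu> * (2 * a + pi)"
    have "X * sin (p - q) = (X * sin p + Y * sin q) * cos q - (X * cos p + Y * cos q) * sin q"
      by (simp add: sin_diff algebra_simps)
    also have "\<dots> = 0" using c z by (simp add: p_q_def)
    finally have "X * sin (p - q) = 0" .
    moreover have "p - q = - (2 * \<nu> * pi)" by (simp add: p_q_def algebra_simps)
    ultimately have "X * sin (2 * \<nu> * pi) = 0" by simp
    then show False using s2nu snu by (simp add: X_def)
  qed
qed

lemma cos_plus_nat_pi: "cos (x + real n * pi) = (-1) ^ n * cos x"
proof (induction n)
  case (Suc n)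
  have "cos (x + real (Suc n) * pi) = cos ((x + real n * pi) + pi)" by (simp add: algebra_simps)
  also have "\<dots> = - cos (x + real n * pi)" by simp
  finally show ?case using Suc by simp
qed simp

lemma branch_sum_cos: "branch_sum K cos a = (-1) ^ K * cos a"
proof (induction K rule: induct_nat_012)
  case (ge2 K)
  have "cos (a - real (K + 1) * pi) = cos (- a + real (K + 1) * pi)"
    using cos_minus[of "a - real (K + 1) * pi"] by (simp add: algebra_simps)
  then have "cos (a - real (K + 1) * pi) = - ((-1) ^ K * cos a)"
    unfolding cos_plus_nat_pi by simp
  moreover have "cos (a + real (K + 2) * pi) = (-1) ^ K * cos a"
    unfolding cos_plus_nat_pi by simp
  ultimately show ?case using ge2(1) by simp
qed simp_all

lemma branch_sum_one_pos: "\<exists>n>0. \<forall>a. branch_sum K (\<lambda>_. 1) a = n"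
proof (induction K rule: induct_nat_012)
  case (ge2 K)
  then obtain n where "n > 0" "\<forall>a. branch_sum K (\<lambda>_. 1) a = n" by blast
  then show ?case by (intro exI[of _ "n + 2"]) auto
qed (auto intro: exI[of _ 1])

text \<open>Differentiating a linear relation twice multiplies each coefficient by the eigenvalue \<open>- e j\<close>.\<close>

lemma eigenfunctions_second_derivative_sum:
  fixes G :: "'j \<Rightarrow> real \<Rightarrow> real"
  assumes S: "open S"
    and G: "\<And>j x. (G j has_real_derivative H j x) (at x)"
    and H: "\<And>j x. (H j has_real_derivative - e j * G j x) (at x)"
    and R: "\<And>x. (R has_real_derivative R' x) (at x)" "\<And>x. (R' has_real_derivative R'' x) (at x)"
    and eq: "\<And>x. x \<in> S \<Longrightarrow> (\<Sum>j\<in>J. w j * G j x) = R x" and x: "x \<in> S"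
  shows "(\<Sum>j\<in>J. w j * (- e j * G j x)) = R'' x"
proof -
  have eq1: "(\<Sum>j\<in>J. w j * H j x) = R' x" if x: "x \<in> S" for x
  proof -
    have "((\<lambda>x. \<Sum>j\<in>J. w j * G j x) has_real_derivative (\<Sum>j\<in>J. w j * H j x)) (at x)"
      by (intro DERIV_sum DERIV_cmult G)
    then have "(R has_real_derivative (\<Sum>j\<in>J. w j * H j x)) (at x)"
      by (rule has_field_derivative_transform_within_open[OF _ S x eq])
    then show ?thesis using R(1) DERIV_unique by blast
  qed
  have "((\<lambda>x. \<Sum>j\<in>J. w j * H j x) has_real_derivative (\<Sum>j\<in>J. w j * (- e j * G j x))) (at x)"
    by (intro DERIV_sum DERIV_cmult H)
  then have "(R' has_real_derivative (\<Sum>j\<in>J. w j * (- e j * G j x))) (at x)"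
    by (rule has_field_derivative_transform_within_open[OF _ S x eq1])
  then show ?thesis using R(2) DERIV_unique by blast
qed

text \<open>Applying the second derivative plus \<open>e k\<close> to a relation removes the term of index \<open>k\<close> and multiplies
  the others by nonzero constants.\<close>

lemma eigenfunctions_independent:
  fixes G :: "'j \<Rightarrow> real \<Rightarrow> real"
  assumes J: "finite J" and inj: "inj_on e J" and S: "open S"
    and G: "\<And>j x. (G j has_real_derivative H j x) (at x)"
    and H: "\<And>j x. (H j has_real_derivative - e j * G j x) (at x)"
    and eq: "\<And>x. x \<in> S \<Longrightarrow> (\<Sum>j\<in>J. w j * G j x) = 0"
    and j: "j \<in> J" and x: "x \<in> S"
  shows "w j * G j x = 0"
  using J inj eq j x
proof (induction J arbitrary: w j x rule: finite_induct)
  case (insert k J)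
  have A: "(\<Sum>j\<in>insert k J. w j * (- e j * G j x)) = 0" if "x \<in> S" for x
    by (rule eigenfunctions_second_derivative_sum[OF S G H, where R = "\<lambda>_. 0" and R' = "\<lambda>_. 0" and R'' = "\<lambda>_. 0"])
       (use insert.prems(2) that in auto)
  have z: "w i * G i x = 0" if i: "i \<in> J" and x: "x \<in> S" for i x
  proof -
    have "(\<Sum>j\<in>J. (w j * (e k - e j)) * G j x) = 0" if x: "x \<in> S" for x
    proof -
      have "(\<Sum>j\<in>J. (w j * (e k - e j)) * G j x) = (\<Sum>j\<in>insert k J. (w j * (e k - e j)) * G j x)"
        using insert.hyps by simp
      also have "\<dots> = e k * (\<Sum>j\<in>insert k J. w j * G j x) + (\<Sum>j\<in>insert k J. w j * (- e j * G j x))"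
        unfolding sum_distrib_left sum.distrib[symmetric] by (rule sum.cong) (auto simp: algebra_simps)
      also have "\<dots> = 0" using A[OF x] insert.prems(2)[OF x] by simp
      finally show ?thesis .
    qed
    from insert.IH[OF _ this i x] insert.prems(1) have "(w i * (e k - e i)) * G i x = 0" by auto
    moreover have "e k \<noteq> e i" using insert.prems(1) insert.hyps i by (auto simp: inj_on_def)
    ultimately show ?thesis by simp
  qed
  have "w k * G k x = 0"
    using insert.prems(2)[OF insert.prems(4)] insert.hyps z[OF _ insert.prems(4)] by simp
  then show ?case using z insert.prems by auto
qed simp

text \<open>The second derivative plus \<open>1\<close> and then the second derivative plus \<open>4\<close> are applied to the derivative
  of the relation, which annihilates its right-hand side. The factor \<open>1 - 4 * \<tau> j\<close> produced by the first
  operator is lost only for \<open>\<tau> j = 1/4\<close>; then the square of the oscillator is \<open>2 - 2 * cos\<close>, and the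
  constant \<open>2\<close> has a nonzero branch sum, which no multiple of \<open>cos\<close> can compensate.\<close>

lemma branch_sums_independent:
  fixes c \<tau> :: "'j::finite \<Rightarrow> real"
  assumes \<tau>: "inj \<tau>" "\<And>j. \<tau> j < 1" and r: "0 < r" "r \<le> pi / 2"
    and eq: "\<And>a. a \<in> {0<..<r} \<Longrightarrow>
       (\<Sum>j\<in>UNIV. c j * branch_sum K (\<lambda>x. (osc (\<tau> j) x)\<^sup>2) a) = A * (cos a)\<^sup>2 + C * cos a"
  shows "c j = 0"
proof -
  define S where "S = {0<..<r}"
  have S: "open S" by (simp add: S_def)
  define F where "F = (\<lambda>j. branch_sum K (\<lambda>x. (osc (\<tau> j) x)\<^sup>2))"
  define G where "G = (\<lambda>j. branch_sum K (osc_sq' (\<tau> j)))"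
  define H where "H = (\<lambda>j. branch_sum K (osc_sq'' (\<tau> j)))"
  have F: "(F j has_real_derivative G j x) (at x)" for j x
    unfolding F_def G_def by (intro branch_sum_deriv osc_sq_deriv)
  have G: "(G j has_real_derivative H j x) (at x)" for j x
    unfolding G_def H_def by (intro branch_sum_deriv osc_sq'_deriv)
  have H: "(H j has_real_derivative - (4 * \<tau> j) * G j x) (at x)" for j x
  proof -
    have "branch_sum K (\<lambda>x. - 4 * \<tau> j * osc_sq' (\<tau> j) x) x = - (4 * \<tau> j) * G j x"
      using branch_sum_sum[of K "\<lambda>_. - 4 * \<tau> j" "\<lambda>_. osc_sq' (\<tau> j)" "{()}" x] by (simp add: G_def)
    then show ?thesis using branch_sum_deriv[OF osc_sq''_deriv, of K "\<tau> j" x] by (simp add: H_def)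
  qed
  have e0: "(\<Sum>j\<in>UNIV. c j * F j x) = A * (cos x)\<^sup>2 + C * cos x" if "x \<in> S" for x
    using eq[of x] that by (simp add: F_def S_def)
  have e1: "(\<Sum>j\<in>UNIV. c j * G j x) = - A * sin (2 * x) - C * sin x" if x: "x \<in> S" for x
  proof -
    have "((\<lambda>x. \<Sum>j\<in>UNIV. c j * F j x) has_real_derivative (\<Sum>j\<in>UNIV. c j * G j x)) (at x)"
      by (intro DERIV_sum DERIV_cmult F)
    then have "((\<lambda>x. A * (cos x)\<^sup>2 + C * cos x) has_real_derivative (\<Sum>j\<in>UNIV. c j * G j x)) (at x)"
      by (rule has_field_derivative_transform_within_open[OF _ S x e0])
    moreover have "((\<lambda>x. A * (cos x)\<^sup>2 + C * cos x) has_real_derivative - A * sin (2 * x) - C * sin x) (at x)"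
      by (rule derivative_eq_intros refl)+ (simp add: sin_double)
    ultimately show ?thesis by (rule DERIV_unique)
  qed
  have e2: "(\<Sum>j\<in>UNIV. c j * (- (4 * \<tau> j) * G j x)) = 4 * A * sin (2 * x) + C * sin x" if x: "x \<in> S" for x
    by (rule eigenfunctions_second_derivative_sum[OF S G H _ _ e1 x,
          where R' = "\<lambda>x. - 2 * A * cos (2 * x) - C * cos x"])
       (auto intro!: derivative_eq_intros)
  have e3: "(\<Sum>j\<in>UNIV. (c j * (1 - 4 * \<tau> j)) * G j x) = 3 * A * sin (2 * x)" if x: "x \<in> S" for x
  proof -
    have "(\<Sum>j\<in>UNIV. (c j * (1 - 4 * \<tau> j)) * G j x) =
       (\<Sum>j\<in>UNIV. c j * G j x) + (\<Sum>j\<in>UNIV. c j * (- (4 * \<tau> j) * G j x))"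
      unfolding sum.distrib[symmetric] by (rule sum.cong) (auto simp: algebra_simps)
    then show ?thesis using e1[OF x] e2[OF x] by simp
  qed
  have e4: "(\<Sum>j\<in>UNIV. (c j * (1 - 4 * \<tau> j)) * (- (4 * \<tau> j) * G j x)) = - 12 * A * sin (2 * x)" if x: "x \<in> S" for x
    by (rule eigenfunctions_second_derivative_sum[OF S G H _ _ e3 x, where R' = "\<lambda>x. 6 * A * cos (2 * x)"])
       (auto intro!: derivative_eq_intros)
  have e5: "(\<Sum>j\<in>UNIV. (c j * (1 - 4 * \<tau> j) * (4 - 4 * \<tau> j)) * G j x) = 0" if x: "x \<in> S" for x
  proof -
    have "(\<Sum>j\<in>UNIV. (c j * (1 - 4 * \<tau> j) * (4 - 4 * \<tau> j)) * G j x) =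
       4 * (\<Sum>j\<in>UNIV. (c j * (1 - 4 * \<tau> j)) * G j x) + (\<Sum>j\<in>UNIV. (c j * (1 - 4 * \<tau> j)) * (- (4 * \<tau> j) * G j x))"
      unfolding sum.distrib[symmetric] sum_distrib_left by (rule sum.cong) (auto simp: algebra_simps)
    then show ?thesis using e3[OF x] e4[OF x] by simp
  qed
  have inj4: "inj_on (\<lambda>j. 4 * \<tau> j) UNIV" using \<tau>(1) by (auto simp: inj_on_def)
  have c0: "c j = 0" if nq: "\<tau> j \<noteq> 1 / 4" for j
  proof -
    obtain x where x: "x \<in> S" "G j x \<noteq> 0"
      using branch_sum_osc_sq'_nonzero[OF \<tau>(2) nq r(1), of K] by (auto simp: S_def G_def)
    have "(c j * (1 - 4 * \<tau> j) * (4 - 4 * \<tau> j)) * G j x = 0"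
      by (rule eigenfunctions_independent[OF finite inj4 S G H e5 UNIV_I x(1)])
    then show ?thesis using x(2) nq \<tau>(2)[of j] by auto
  qed
  show ?thesis
  proof (cases "\<tau> j = 1 / 4")
    case True
    \<comment> \<open>All other coefficients vanish, and so does \<open>A\<close>: in \<open>e3\<close> the left-hand side is zero.\<close>
    have others: "c i = 0" if "i \<noteq> j" for i
      by (rule c0) (use True that \<tau>(1) in \<open>auto simp: inj_def\<close>)
    have single: "(\<Sum>i\<in>UNIV. f i) = f j" if "\<And>i. i \<noteq> j \<Longrightarrow> f i = 0" for f :: "'j \<Rightarrow> real"
      using sum.remove[of UNIV j f] that by simp
    have x2: "r / 2 \<in> S" "r / 3 \<in> S" using r by (auto simp: S_def)
    have "0 < sin (2 * (r / 2))" by (rule sin_gt_zero) (use r in auto)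
    moreover have "3 * A * sin (2 * (r / 2)) = 0"
      using e3[OF x2(1)] by (subst (asm) single) (use others True in auto)
    ultimately have A: "A = 0" by simp
    obtain n where n: "n > 0" "\<And>a. branch_sum K (\<lambda>_. 1) a = n" using branch_sum_one_pos by metis
    have Fj: "F j a = 2 * n - 2 * ((-1) ^ K * cos a)" for a
    proof -
      have half: "sqrt (1 / 4 :: real) = 1 / 2" by (simp add: real_sqrt_divide)
      have "(osc (\<tau> j) x)\<^sup>2 = 2 * 1 + (- 2) * cos x" for x
        using cos_double_sin[of "x / 2"] by (simp add: True osc_def half power_divide power2_eq_square)
      then have "F j a = branch_sum K (\<lambda>x. \<Sum>i\<in>UNIV. (if i then 2 else - 2) * (if i then (\<lambda>_. 1) else cos) x) a"
        by (simp add: F_def UNIV_bool)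
      then show ?thesis using n(2) unfolding branch_sum_sum by (simp add: UNIV_bool branch_sum_cos)
    qed
    have "c j * (2 * n) = (C + 2 * c j * (-1) ^ K) * cos x" if "x \<in> S" for x
      using e0[OF that] unfolding A by (subst (asm) single) (use others in \<open>auto simp: Fj algebra_simps\<close>)
    note two = this[OF x2(1)] this[OF x2(2)]
    have "cos (r / 2) < cos (r / 3)" by (rule cos_monotone_0_pi) (use r pi_gt_zero in auto)
    then have "C + 2 * c j * (-1) ^ K = 0" using two by auto
    then have "c j * (2 * n) = 0" using two by simp
    then show ?thesis using n by simp
  qed (rule c0)
qed


lemma test_function_01_props:
  assumes "test_function_01 \<omega>"
  shows "(\<omega> has_real_derivative deriv \<omega> x) (at x)"
    and "continuous_on UNIV \<omega>" and "continuous_on UNIV (deriv \<omega>)"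
    and "x \<le> 0 \<or> 1 \<le> x \<Longrightarrow> \<omega> x = 0" and "x \<le> 0 \<or> 1 \<le> x \<Longrightarrow> deriv \<omega> x = 0"
proof -
  have diff: "(deriv ^^ n) \<omega> differentiable (at x)" for n x
    using assms by (simp add: test_function_01_def)
  have der: "(\<omega> has_real_derivative deriv \<omega> x) (at x)" for x
    using diff[of 0 x] by (simp add: DERIV_deriv_iff_real_differentiable)
  then show "(\<omega> has_real_derivative deriv \<omega> x) (at x)" .
  show "continuous_on UNIV \<omega>" by (rule DERIV_continuous_on[OF has_field_derivative_at_within[OF der]])
  have der2: "(deriv \<omega> has_real_derivative deriv (deriv \<omega>) x) (at x)" for x
    using diff[of 1 x] by (simp add: DERIV_deriv_iff_real_differentiable)
  show "continuous_on UNIV (deriv \<omega>)"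
    by (rule DERIV_continuous_on[OF has_field_derivative_at_within[OF der2]])
  assume x: "x \<le> 0 \<or> 1 \<le> x"
  have nc: "x \<notin> closure {x. \<omega> x \<noteq> 0}"
    using assms x unfolding test_function_01_def by force
  then show w0: "\<omega> x = 0" using closure_subset[of "{x. \<omega> x \<noteq> 0}"] by blast
  have "(\<omega> has_real_derivative 0) (at x)"
    by (rule has_field_derivative_transform_within_open[of "\<lambda>_. 0" _ _ "- closure {x. \<omega> x \<noteq> 0}"])
       (use nc closure_subset[of "{x. \<omega> x \<noteq> 0}"] in auto)
  then show "deriv \<omega> x = 0" by (rule DERIV_imp_deriv)
qed

text \<open>The fundamental lemma of the calculus of variations in the variable \<open>a\<close>, for test functions of the
  variable \<open>p = sin a / sin r\<close>, which increases from \<open>0\<close> to \<open>1\<close>.\<close>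

lemma continuous_zero_by_bumps:
  assumes Z: "continuous_on {0..r} Z" and r: "0 < r" "r < pi / 2"
    and hyp: "\<And>\<omega>. test_function_01 \<omega> \<Longrightarrow> integral {0..r} (\<lambda>a. \<omega> (sin a / sin r) * Z a) = 0"
    and a: "a \<in> {0<..<r}"
  shows "Z a = 0"
proof (rule ccontr)
  assume nz: "Z a \<noteq> 0"
  have sr: "0 < sin r" using r by (intro sin_gt_zero) auto
  have mono: "sin x < sin y \<longleftrightarrow> x < y" if "x \<in> {0..r}" "y \<in> {0..r}" for x y
    using that r by (intro sin_mono_less_eq) auto
  define sg where "sg = sgn (Z a)"
  have "continuous (at a) Z"
    using Z a by (intro continuous_on_interior[of "{0..r}"]) (auto simp: interior_atLeastAtMost_real)
  then have "continuous (at a) (\<lambda>x. sg * Z x)" by (intro continuous_intros)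
  moreover have "0 < sg * Z a" using nz by (simp add: sg_def sgn_if)
  ultimately have "\<forall>\<^sub>F x in nhds a. 0 < sg * Z x"
    by (metis (no_types) continuous_within eventually_nhds_conv_at order_tendstoD(1))
  then obtain \<delta> where \<delta>: "0 < \<delta>" "\<And>x. dist x a < \<delta> \<Longrightarrow> 0 < sg * Z x"
    by (auto simp: eventually_nhds_metric)
  define l where "l = max (a - \<delta> / 2) (a / 2)"
  define u where "u = min (a + \<delta> / 2) ((a + r) / 2)"
  have lu: "0 < l" "l < a" "a < u" "u < r" using a \<delta>(1) by (auto simp: l_def u_def min_def max_def)
  have pos: "0 < sg * Z x" if "l < x" "x < u" for x
    using that \<delta>(1) by (intro \<delta>(2)) (auto simp: l_def u_def dist_real_def)
  have "0 < sin l / sin r" "sin l / sin r < sin u / sin r" "sin u / sin r < 1"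
    using mono[of 0 l] mono[of l u] mono[of u r] lu sr by (auto simp: divide_strict_right_mono)
  then obtain \<omega> where w: "test_function_01 \<omega>" "\<And>x. 0 \<le> \<omega> x"
     "\<And>x. \<omega> x \<noteq> 0 \<longleftrightarrow> sin l / sin r < x \<and> x < sin u / sin r"
    using bump_function_exists by blast
  have supp: "\<omega> (sin x / sin r) \<noteq> 0 \<longleftrightarrow> l < x \<and> x < u" if "x \<in> {0..r}" for x
    using that mono[of l x] mono[of x u] lu sr by (simp add: w(3) divide_less_cancel)
  have c: "continuous_on {0..r} (\<lambda>x. sg * (\<omega> (sin x / sin r) * Z x))"
    by (intro continuous_intros continuous_on_compose2[OF test_function_01_props(2)[OF w(1)]] Z) (use sr in auto)
  have nn: "0 \<le> sg * (\<omega> (sin x / sin r) * Z x)" if "x \<in> {0..r}" for x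
  proof (cases "l < x \<and> x < u")
    case True
    then have "0 \<le> \<omega> (sin x / sin r) * (sg * Z x)" using pos[of x] by (intro mult_nonneg_nonneg[OF w(2)]) auto
    then show ?thesis by (simp add: mult_ac)
  next
    case False
    then have "\<omega> (sin x / sin r) = 0" using supp[OF that] by blast
    then show ?thesis by simp
  qed
  have "integral {0..r} (\<lambda>x. sg * (\<omega> (sin x / sin r) * Z x)) = 0" using hyp[OF w(1)] by simp
  then have "sg * (\<omega> (sin a / sin r) * Z a) = 0" using integral_eq_0_iff[OF c r(1) nn] a by auto
  then show False using supp[of a] a lu nz by (simp add: sg_def sgn_if split: if_splits)
qed

text \<open>After summation over the branches the hypothesis reads
  \<open>\<integral> (deriv \<omega> p * F a - A * n * p * \<omega> p) = 0\<close> with \<open>p = sin a / s\<close>, where \<open>F\<close> is the branch sum of the squares and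
  \<open>n\<close> the number of branches. Since \<open>deriv \<omega> p * cos a / s\<close> is the derivative of \<open>\<omega> p\<close>, integration by
  parts with \<open>Y = s * F / cos\<close> and the fundamental lemma give \<open>Y' = - A * n * p\<close>, which is integrated
  explicitly.\<close>

theorem vorticity_functionals_independent:
  fixes c \<tau> :: "'j::finite \<Rightarrow> real"
  assumes \<tau>: "inj \<tau>" "\<And>j. \<tau> j < 1"
    and \<theta>: "0 < \<theta>" "sin \<theta> \<noteq> 0" "cos \<theta> \<noteq> 0"
    and hyp: "\<And>\<omega>. test_function_01 \<omega> \<Longrightarrow>
       integral {0..\<theta>} (\<lambda>t. deriv \<omega> (sin t / sin \<theta>) * (\<Sum>j\<in>UNIV. c j * (osc (\<tau> j) t)\<^sup>2)) =
       A * integral {0..\<theta>} (\<lambda>t. sin t / sin \<theta> * \<omega> (sin t / sin \<theta>))"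
  shows "c j = 0"
proof -
  define K where "K = nat \<lfloor>\<theta> / pi\<rfloor>"
  have "real K \<le> \<theta> / pi" "\<theta> / pi < real K + 1" using \<theta>(1) by (auto simp: K_def)
  then have K: "real K * pi \<le> \<theta>" "\<theta> < real (K + 1) * pi" by (auto simp: field_simps)
  have "real K * pi \<noteq> \<theta>" using \<theta>(2) sin_npi[of K] by blast
  with K have K: "real K * pi < \<theta>" "\<theta> < real (K + 1) * pi" by auto
  define s where "s = \<bar>sin \<theta>\<bar>"
  have "0 < (cos \<theta>)\<^sup>2" using \<theta>(3) by simp
  then have "(sin \<theta>)\<^sup>2 < 1" using sin_cos_squared_add[of \<theta>] by linarith
  then have "s < 1" unfolding s_def by (simp only: abs_square_less_1)
  moreover have "0 < s" using \<theta>(2) by (simp add: s_def)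
  ultimately have s: "0 < s" "s < 1" by auto
  define r where "r = arcsin s"
  have sr: "sin r = s" using s by (simp add: r_def)
  have r: "0 < r" "r < pi / 2"
    using arcsin_less_arcsin[of 0 s] arcsin_less_arcsin[of s 1] s by (auto simp: r_def)
  define \<Phi> where "\<Phi> t = (\<Sum>j\<in>UNIV. c j * (osc (\<tau> j) t)\<^sup>2)" for t
  define \<Phi>' where "\<Phi>' t = (\<Sum>j\<in>UNIV. c j * osc_sq' (\<tau> j) t)" for t
  define \<Phi>'' where "\<Phi>'' t = (\<Sum>j\<in>UNIV. c j * osc_sq'' (\<tau> j) t)" for t
  have d\<Phi>: "(\<Phi> has_real_derivative \<Phi>' t) (at t)" for t
    unfolding \<Phi>_def[abs_def] \<Phi>'_def by (intro DERIV_sum DERIV_cmult osc_sq_deriv)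
  have d\<Phi>': "(\<Phi>' has_real_derivative \<Phi>'' t) (at t)" for t
    unfolding \<Phi>'_def[abs_def] \<Phi>''_def by (intro DERIV_sum DERIV_cmult osc_sq'_deriv)
  define F where "F = branch_sum K \<Phi>"
  define F' where "F' = branch_sum K \<Phi>'"
  have dF: "(F has_real_derivative F' t) (at t)" for t
    unfolding F_def F'_def by (intro branch_sum_deriv d\<Phi>)
  have cF: "continuous_on B F" "continuous_on B F'" for B
    unfolding F_def F'_def
    by (rule branch_sum_cont[OF DERIV_continuous_on[OF has_field_derivative_at_within[OF d\<Phi>]]], rule branch_sum_cont[OF DERIV_continuous_on[OF has_field_derivative_at_within[OF d\<Phi>']]])
  obtain n where n: "\<And>a. branch_sum K (\<lambda>_. 1) a = n" using branch_sum_one_pos by metis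
  define Y where "Y a = s * F a / cos a" for a
  define Y' where "Y' a = s * (F' a * cos a + F a * sin a) / (cos a)\<^sup>2" for a
  have cpos: "0 < cos a" if "a \<in> {0..r}" for a using that r by (intro cos_gt_zero_pi) auto
  have dY: "(Y has_real_derivative Y' a) (at a)" if "a \<in> {0..r}" for a
    unfolding Y_def[abs_def] Y'_def
    by (rule derivative_eq_intros dF refl)+ (use cpos[OF that] in \<open>simp_all add: power2_eq_square algebra_simps\<close>)
  define Z where "Z a = Y' a + A * n * (sin a / s)" for a
  have cY': "continuous_on {0..r} Y'"
    unfolding Y'_def[abs_def] using cpos by (intro continuous_intros cF) force
  then have cZ: "continuous_on {0..r} Z"
    unfolding Z_def[abs_def] using s by (intro continuous_intros) auto
  have key: "integral {0..r} (\<lambda>a. \<omega> (sin a / sin r) * Z a) = 0" if w: "test_function_01 \<omega>" for \<omega>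
  proof -
    note wp = test_function_01_props[OF w]
    have c\<Phi>: "continuous_on UNIV \<Phi>" by (rule DERIV_continuous_on[OF has_field_derivative_at_within[OF d\<Phi>]])
    have I1: "integral {0..\<theta>} (\<lambda>t. deriv \<omega> (sin t / sin \<theta>) * \<Phi> t) =
        integral {0..pi / 2} (\<lambda>a. deriv \<omega> (sin a / s) * F a)"
      unfolding s_def F_def
      by (rule branch_integral_truncated[OF wp(3) _ _ c\<Phi> _ K]) (auto simp: wp(5) \<Phi>_def osc_minus)
    have I2: "integral {0..\<theta>} (\<lambda>t. sin t / sin \<theta> * \<omega> (sin t / sin \<theta>)) =
        integral {0..pi / 2} (\<lambda>a. (sin a / s) * \<omega> (sin a / s) * n)"
      using branch_integral_truncated[of "\<lambda>p. p * \<omega> p" "\<lambda>_. 1" K \<theta>] K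
      by (simp add: wp(4) n s_def continuous_on_mult continuous_on_id wp(2))
    have cs: "continuous_on B (\<lambda>a. \<omega> (sin a / s))" "continuous_on B (\<lambda>a. deriv \<omega> (sin a / s))" for B
      using s by (auto intro!: continuous_intros continuous_on_compose2[OF wp(2)] continuous_on_compose2[OF wp(3)])
    have trunc: "integral {0..pi / 2} f = integral {0..r} f"
      if "continuous_on {0..pi/2} f" "\<And>a. a \<in> {r..pi/2} \<Longrightarrow> f a = 0" for f :: "real \<Rightarrow> real"
    proof -
      have "integral {0..r} f + integral {r..pi/2} f = integral {0..pi/2} f"
        by (rule Henstock_Kurzweil_Integration.integral_combine)
           (use r in \<open>auto intro: integrable_continuous_interval that(1)\<close>)
      moreover have "integral {r..pi/2} f = 0" by (rule integral_zero_on) (rule that(2))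
      ultimately show ?thesis by simp
    qed
    have ge1: "1 \<le> sin a / s" if "a \<in> {r..pi/2}" for a
    proof -
      have "sin r \<le> sin a" using that r by (intro sin_monotone_2pi_le) auto
      then show ?thesis using s sr by simp
    qed
    have J1: "integral {0..pi / 2} (\<lambda>a. deriv \<omega> (sin a / s) * F a) = integral {0..r} (\<lambda>a. deriv \<omega> (sin a / s) * F a)"
    proof (rule trunc)
      show "deriv \<omega> (sin a / s) * F a = 0" if "a \<in> {r..pi/2}" for a
        using wp(5)[of "sin a / s"] ge1[OF that] by simp
    qed (intro continuous_on_mult cs cF)
    have J2: "integral {0..pi / 2} (\<lambda>a. (sin a / s) * \<omega> (sin a / s) * n) = integral {0..r} (\<lambda>a. (sin a / s) * \<omega> (sin a / s) * n)"
    proof (rule trunc)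
      show "sin a / s * \<omega> (sin a / s) * n = 0" if "a \<in> {r..pi/2}" for a
        using wp(4)[of "sin a / s"] ge1[OF that] by simp
    qed (use s in \<open>auto intro!: continuous_intros cs\<close>)
    have "((\<lambda>a. deriv \<omega> (sin a / s) * F a + \<omega> (sin a / s) * Y' a) has_integral
       \<omega> (sin r / s) * Y r - \<omega> (sin 0 / s) * Y 0) {0..r}"
    proof (rule fundamental_theorem_of_calculus)
      show "0 \<le> r" using r by simp
      fix a assume a: "a \<in> {0..r}"
      have "((\<lambda>a. \<omega> (sin a / s)) has_real_derivative deriv \<omega> (sin a / s) * (cos a / s)) (at a)"
        by (rule DERIV_chain2[OF wp(1)]) (use s in \<open>auto intro!: derivative_eq_intros\<close>)
      then have "((\<lambda>a. \<omega> (sin a / s) * Y a) has_real_derivative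
          deriv \<omega> (sin a / s) * (cos a / s) * Y a + Y' a * \<omega> (sin a / s)) (at a)"
        by (rule DERIV_mult) (rule dY[OF a])
      also have "deriv \<omega> (sin a / s) * (cos a / s) * Y a = deriv \<omega> (sin a / s) * F a"
        using s cpos[OF a] by (simp add: Y_def)
      finally have "((\<lambda>a. \<omega> (sin a / s) * Y a) has_real_derivative
          deriv \<omega> (sin a / s) * F a + \<omega> (sin a / s) * Y' a) (at a)" by (simp add: mult.commute)
      then show "((\<lambda>a. \<omega> (sin a / s) * Y a) has_vector_derivative
          deriv \<omega> (sin a / s) * F a + \<omega> (sin a / s) * Y' a) (at a within {0..r})"
        unfolding has_real_derivative_iff_has_vector_derivative[symmetric]
        by (rule has_field_derivative_at_within)
    qed
    then have "integral {0..r} (\<lambda>a. deriv \<omega> (sin a / s) * F a + \<omega> (sin a / s) * Y' a) = 0"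
      using s sr wp(4)[of 0] wp(4)[of 1] by (simp add: integral_unique)
    moreover have "integral {0..r} (\<lambda>a. deriv \<omega> (sin a / s) * F a + \<omega> (sin a / s) * Y' a) =
       integral {0..r} (\<lambda>a. deriv \<omega> (sin a / s) * F a) + integral {0..r} (\<lambda>a. \<omega> (sin a / s) * Y' a)"
      by (intro Henstock_Kurzweil_Integration.integral_add integrable_continuous_interval continuous_on_mult cs cF cY')
    moreover have "integral {0..r} (\<lambda>a. deriv \<omega> (sin a / s) * F a) = A * integral {0..r} (\<lambda>a. (sin a / s) * \<omega> (sin a / s) * n)"
      using hyp[OF w] unfolding \<Phi>_def[symmetric] I1 I2 J1 J2 .
    moreover have "integral {0..r} (\<lambda>a. \<omega> (sin a / sin r) * Z a) =
        integral {0..r} (\<lambda>a. A * ((sin a / s) * \<omega> (sin a / s) * n) + \<omega> (sin a / s) * Y' a)"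
      by (rule integral_cong) (simp add: Z_def sr algebra_simps)
    moreover have "\<dots> = integral {0..r} (\<lambda>a. A * ((sin a / s) * \<omega> (sin a / s) * n)) + integral {0..r} (\<lambda>a. \<omega> (sin a / s) * Y' a)"
      by (intro Henstock_Kurzweil_Integration.integral_add integrable_continuous_interval continuous_intros cs cF cY')
         (use s in auto)
    ultimately show ?thesis by simp
  qed
  have Z0: "Z a = 0" if "a \<in> {0<..<r}" for a
    by (rule continuous_zero_by_bumps[OF cZ r key that])
  have "((\<lambda>a. Y a - A * n / s * cos a) has_real_derivative 0) (at a within {0<..<r})" if a: "a \<in> {0<..<r}" for a
  proof -
    have "a \<in> {0..r}" using a by auto
    from dY[OF this] have "((\<lambda>a. Y a - A * n / s * cos a) has_real_derivative Y' a - A * n / s * (- sin a)) (at a)"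
      by (intro DERIV_diff DERIV_cmult) (auto intro!: derivative_eq_intros)
    moreover have "Y' a - A * n / s * (- sin a) = 0" using Z0[OF a] by (simp add: Z_def)
    ultimately show ?thesis by (simp add: has_field_derivative_at_within)
  qed
  then obtain C where C: "\<And>a. a \<in> {0<..<r} \<Longrightarrow> Y a - A * n / s * cos a = C"
    using has_field_derivative_zero_constant[of "{0<..<r}" "\<lambda>a. Y a - A * n / s * cos a"] by auto
  have "(\<Sum>j\<in>UNIV. c j * branch_sum K (\<lambda>x. (osc (\<tau> j) x)\<^sup>2) a) = A * n / s\<^sup>2 * (cos a)\<^sup>2 + C / s * cos a"
    if a: "a \<in> {0<..<r}" for a
  proof -
    have "0 < cos a" using a by (intro cpos) auto
    then have "F a = Y a * cos a / s" using s by (simp add: Y_def)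
    also have "\<dots> = (A * n / s * cos a + C) * cos a / s" using C[OF a] by (simp add: algebra_simps)
    also have "\<dots> = A * n / s\<^sup>2 * (cos a)\<^sup>2 + C / s * cos a" by (simp add: power2_eq_square algebra_simps add_divide_distrib)
    finally show ?thesis unfolding F_def \<Phi>_def[abs_def] branch_sum_sum .
  qed
  from branch_sums_independent[OF \<tau> r(1) less_imp_le[OF r(2)] this] show ?thesis .
qed

section \<open>The eigenvalue map\<close>

lemma deriv_on_depth_eq:
  assumes "(u has_real_derivative D) (at d within {0..d})" "0 < d"
  shows "deriv_on_depth d u d = D"
  unfolding deriv_on_depth_def
  by (rule vector_derivative_within_cbox[of 0 d, unfolded box_real])
     (use assms in \<open>auto simp: has_real_derivative_iff_has_vector_derivative\<close>)

lemma deriv_on_depth_cong: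
  assumes "(u has_real_derivative D) (at d within {0..d})" "0 < d" "\<And>z. z \<in> {0..d} \<Longrightarrow> v z = u z"
  shows "deriv_on_depth d v d = deriv_on_depth d u d"
proof -
  have "(v has_real_derivative D) (at d within {0..d})"
    by (rule has_field_derivative_transform_within[OF assms(1), of 1]) (use assms in auto)
  then show ?thesis using deriv_on_depth_eq assms(1,2) by simp
qed

lemma sl_eigenvalue_iff_robin:
  assumes "\<And>z. z \<in> {0<..<d} \<Longrightarrow> q z = deriv \<omega> (u z)"
  shows "sl_eigenvalue \<omega> d u \<mu> \<longleftrightarrow> robin_eigenvalue d q (kappa \<omega> d u) \<mu>"
proof -
  have "ode2 d f f' (\<lambda>z. - ((q z + \<mu>) * f z)) \<longleftrightarrow>
     (\<forall>z\<in>{0..d}. (f has_real_derivative f' z) (at z within {0..d})) \<and> continuous_on {0..d} f' \<and>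
     (\<forall>z\<in>{0<..<d}. (f' has_real_derivative - deriv \<omega> (u z) * f z - \<mu> * f z) (at z))" for f f'
  proof -
    have "- ((q z + \<mu>) * f z) = - deriv \<omega> (u z) * f z - \<mu> * f z" if "z \<in> {0<..<d}" for z
      using assms[OF that] by (simp add: algebra_simps)
    then show ?thesis unfolding ode2_def by simp
  qed
  then show ?thesis unfolding sl_eigenvalue_def robin_eigenvalue_def by (simp add: conj_assoc)
qed

text \<open>At the least index where the vectors differ, the smaller of the two values is missed by the
  other vector.\<close>

lemma strict_mono_vec_unique:
  fixes x y :: "real^'n::{finite,linorder}"
  assumes x: "strict_mono (\<lambda>i. x $ i)" and y: "strict_mono (\<lambda>i. y $ i)"
    and r: "range (\<lambda>i. x $ i) = range (\<lambda>i. y $ i)"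
  shows "x = y"
proof (rule ccontr)
  assume "x \<noteq> y"
  define D where "D = {i. x $ i \<noteq> y $ i}"
  have "D \<noteq> {}" using \<open>x \<noteq> y\<close> by (auto simp: D_def vec_eq_iff)
  define i where "i = Min D"
  have i: "x $ i \<noteq> y $ i" using Min_in[of D] \<open>D \<noteq> {}\<close> by (simp add: i_def D_def)
  have below: "x $ k = y $ k" if "k < i" for k
  proof (rule ccontr)
    assume "x $ k \<noteq> y $ k"
    then have "i \<le> k" unfolding i_def by (intro Min_le) (auto simp: D_def)
    then show False using that by simp
  qed
  have no: False if f: "strict_mono (\<lambda>i. f $ i)" and g: "strict_mono (\<lambda>i. g $ i)"
      and r: "f $ i \<in> range (\<lambda>i. g $ i)"
      and lt: "f $ i < g $ i" and b: "\<And>k. k < i \<Longrightarrow> f $ k = g $ k" for f g :: "real^'n::{finite,linorder}"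
  proof -
    obtain k where k: "f $ i = g $ k" using r by auto
    show False
    proof (cases "k < i")
      case True
      then show False using b[OF True] k strict_monoD[OF f True] by simp
    next
      case False
      then have "g $ i \<le> g $ k" using strict_mono_less_eq[OF g] by simp
      then show False using lt k by simp
    qed
  qed
  show False
  proof (cases "x $ i < y $ i")
    case True
    have "x $ i \<in> range (\<lambda>i. y $ i)" unfolding r[symmetric] by simp
    from no[OF x y this True below] show False .
  next
    case False
    then have "y $ i < x $ i" using i by simp
    moreover have "y $ i \<in> range (\<lambda>i. x $ i)" unfolding r by simp
    ultimately show False using no[OF y x] below by force
  qed
qed

lemma test_function_01_deriv:
  assumes "test_function_01 \<omega>"
  shows "test_function_01 (deriv \<omega>)"
proof -
  have s: "{x. deriv \<omega> x \<noteq> 0} \<subseteq> closure {x. \<omega> x \<noteq> 0}"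
  proof
    fix x assume x: "x \<in> {x. deriv \<omega> x \<noteq> 0}"
    show "x \<in> closure {x. \<omega> x \<noteq> 0}"
    proof (rule ccontr)
      assume nc: "x \<notin> closure {x. \<omega> x \<noteq> 0}"
      have "(\<omega> has_real_derivative 0) (at x)"
        by (rule has_field_derivative_transform_within_open[of "\<lambda>_. 0" _ _ "- closure {x. \<omega> x \<noteq> 0}"])
           (use nc closure_subset[of "{x. \<omega> x \<noteq> 0}"] in auto)
      then show False using x DERIV_imp_deriv by fastforce
    qed
  qed
  then have c: "closure {x. deriv \<omega> x \<noteq> 0} \<subseteq> closure {x. \<omega> x \<noteq> 0}" by (simp add: closure_minimal)
  have K: "compact (closure {x. \<omega> x \<noteq> 0})" "closure {x. \<omega> x \<noteq> 0} \<subseteq> {0<..<1}"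
    and sm: "\<And>n x. (deriv ^^ n) \<omega> differentiable (at x)" using assms by (auto simp: test_function_01_def)
  have "(deriv ^^ n) (deriv \<omega>) differentiable (at x)" for n x
    using sm[of "Suc n" x] by (simp add: funpow_swap1)
  moreover have "compact (closure {x. deriv \<omega> x \<noteq> 0})"
    using closed_Int_compact[OF closed_closure K(1)] c by (metis Int_absorb2)
  ultimately show ?thesis unfolding test_function_01_def using c K(2) by blast
qed

lemma test_function_01_lin:
  assumes f: "test_function_01 f" and g: "test_function_01 g"
  shows "test_function_01 (\<lambda>x. a * f x + c * g x)"
proof -
  have sf: "\<And>n x. (deriv ^^ n) f differentiable (at x)" and Kf: "compact (closure {x. f x \<noteq> 0})" "closure {x. f x \<noteq> 0} \<subseteq> {0<..<1}"
    and sg: "\<And>n x. (deriv ^^ n) g differentiable (at x)" and Kg: "compact (closure {x. g x \<noteq> 0})" "closure {x. g x \<noteq> 0} \<subseteq> {0<..<1}"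
    using f g by (auto simp: test_function_01_def)
  have d: "((\<lambda>x. a * (deriv ^^ n) f x + c * (deriv ^^ n) g x) has_real_derivative
      a * deriv ((deriv ^^ n) f) x + c * deriv ((deriv ^^ n) g) x) (at x)" for n x
    using sf[of n x] sg[of n x] by (intro DERIV_add DERIV_cmult) (simp_all add: DERIV_deriv_iff_real_differentiable)
  have e: "(deriv ^^ n) (\<lambda>x. a * f x + c * g x) = (\<lambda>x. a * (deriv ^^ n) f x + c * (deriv ^^ n) g x)" for n
  proof (induction n)
    case (Suc n)
    have "deriv (\<lambda>x. a * (deriv ^^ n) f x + c * (deriv ^^ n) g x) = (\<lambda>x. a * deriv ((deriv ^^ n) f) x + c * deriv ((deriv ^^ n) g) x)"
      by (intro ext DERIV_imp_deriv d)
    then show ?case using Suc by simp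
  qed simp
  have "{x. a * f x + c * g x \<noteq> 0} \<subseteq> closure {x. f x \<noteq> 0} \<union> closure {x. g x \<noteq> 0}"
  proof
    fix x assume "x \<in> {x. a * f x + c * g x \<noteq> 0}"
    then have "x \<in> {x. f x \<noteq> 0} \<or> x \<in> {x. g x \<noteq> 0}" by auto
    then show "x \<in> closure {x. f x \<noteq> 0} \<union> closure {x. g x \<noteq> 0}"
      using closure_subset[of "{x. f x \<noteq> 0}"] closure_subset[of "{x. g x \<noteq> 0}"] by blast
  qed
  then have cl: "closure {x. a * f x + c * g x \<noteq> 0} \<subseteq> closure {x. f x \<noteq> 0} \<union> closure {x. g x \<noteq> 0}"
    by (intro closure_minimal) auto
  have "compact (closure {x. a * f x + c * g x \<noteq> 0})"
    using closed_Int_compact[OF closed_closure compact_Un[OF Kf(1) Kg(1)]] cl by (metis Int_absorb2)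
  moreover have "(deriv ^^ n) (\<lambda>x. a * f x + c * g x) differentiable (at x)" for n x
    unfolding e real_differentiable_def by (rule exI) (rule d)
  ultimately show ?thesis unfolding test_function_01_def using cl Kf(2) Kg(2) by blast
qed

lemma test_function_01_lipschitz:
  assumes w: "test_function_01 \<omega>"
  shows "\<exists>B\<ge>0. \<forall>x y. \<bar>\<omega> x\<bar> \<le> B \<and> \<bar>\<omega> x - \<omega> y\<bar> \<le> B * \<bar>x - y\<bar>"
proof -
  note p = test_function_01_props[OF w]
  have b: "\<exists>M\<ge>0. \<forall>x. \<bar>f x\<bar> \<le> M" if c: "continuous_on UNIV f" and z: "\<And>x. x \<le> 0 \<or> 1 \<le> x \<Longrightarrow> f x = 0"
    for f :: "real \<Rightarrow> real"
  proof -
    have "bounded (f ` {0..1})"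
      by (intro compact_imp_bounded compact_continuous_image continuous_on_subset[OF c]) auto
    then obtain M where M: "\<forall>y\<in>f ` {0..1}. norm y \<le> M" by (auto simp: bounded_iff)
    have "\<bar>f x\<bar> \<le> \<bar>M\<bar>" for x
    proof (cases "x \<in> {0..1}")
      case True then show ?thesis using M by force
    next
      case False then show ?thesis using z[of x] by auto
    qed
    then show ?thesis by (intro exI[of _ "\<bar>M\<bar>"]) auto
  qed
  obtain M1 where M1: "0 \<le> M1" "\<And>x. \<bar>\<omega> x\<bar> \<le> M1" using b[OF p(2) p(4)] by blast
  obtain M2 where M2: "0 \<le> M2" "\<And>x. \<bar>deriv \<omega> x\<bar> \<le> M2" using b[OF p(3) p(5)] by blast
  have lip: "\<bar>\<omega> x - \<omega> y\<bar> \<le> M2 * \<bar>x - y\<bar>" for x y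
    using field_differentiable_bound[of UNIV \<omega> "deriv \<omega>" M2 x y] p(1) M2 by auto
  show ?thesis
  proof (intro exI[of _ "M1 + M2"] conjI allI)
    show "0 \<le> M1 + M2" using M1 M2 by simp
    show "\<bar>\<omega> x\<bar> \<le> M1 + M2" for x using M1(2)[of x] M2(1) by simp
    show "\<bar>\<omega> x - \<omega> y\<bar> \<le> (M1 + M2) * \<bar>x - y\<bar>" for x y
      by (rule order_trans[OF lip]) (use M1 in \<open>auto intro: mult_right_mono\<close>)
  qed
qed

lemma integral_tendsto_uniform:
  fixes F :: "'a \<Rightarrow> real \<Rightarrow> real"
  assumes u: "uniform_limit {0..d} F G N" and c: "\<forall>\<^sub>F x in N. continuous_on {0..d} (F x)"
    and G: "continuous_on {0..d} G" and d: "0 < d"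
  shows "((\<lambda>x. integral {0..d} (F x)) \<longlongrightarrow> integral {0..d} G) N"
proof (rule tendstoI)
  fix e :: real assume e: "0 < e"
  have "\<forall>\<^sub>F x in N. \<forall>z\<in>{0..d}. dist (F x z) (G z) < e / (2 * d)"
    using u e d by (simp add: uniform_limit_iff)
  with c show "\<forall>\<^sub>F x in N. dist (integral {0..d} (F x)) (integral {0..d} G) < e"
  proof eventually_elim
    case (elim x)
    have i: "F x integrable_on {0..d}" "G integrable_on {0..d}"
      by (intro integrable_continuous_interval elim G)+
    have "integral {0..d} (F x) - integral {0..d} G = integral {0..d} (\<lambda>z. F x z - G z)"
      by (rule Henstock_Kurzweil_Integration.integral_diff[symmetric]) (rule i)+
    moreover have "norm (integral {0..d} (\<lambda>z. F x z - G z)) \<le> integral {0..d} (\<lambda>z. e / (2 * d))"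
      using elim(2) by (intro integral_norm_bound_integral integrable_diff i) (auto simp: dist_real_def less_imp_le)
    ultimately have "norm (integral {0..d} (F x) - integral {0..d} G) \<le> e / 2" using d by simp
    then show ?case using e by (simp add: dist_norm)
  qed
qed

lemma uniform_limit_by_bound:
  fixes F :: "'a \<Rightarrow> 'b \<Rightarrow> real"
  assumes "\<forall>\<^sub>F x in N. \<forall>z\<in>S. \<bar>F x z - G z\<bar> \<le> h x" "(h \<longlongrightarrow> 0) N"
  shows "uniform_limit S F G N"
  unfolding uniform_limit_iff
proof (intro allI impI)
  fix e :: real assume "0 < e"
  then have "\<forall>\<^sub>F x in N. h x < e" using assms(2) by (rule order_tendstoD(2)[rotated])
  with assms(1) show "\<forall>\<^sub>F x in N. \<forall>z\<in>S. dist (F x z) (G z) < e"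
    by eventually_elim (force simp: dist_real_def)
qed

text \<open>A function with \<open>f x - f 0 = (\<Sum>k. x $ k * g k x)\<close> is differentiable at \<open>0\<close> as soon as the factors \<open>g k\<close>
  have limits there; no estimate of a remainder is needed.\<close>

lemma has_derivative_from_linear_factors:
  fixes f :: "real^'n \<Rightarrow> real"
  assumes f: "\<forall>\<^sub>F x in at 0. f x - f 0 = (\<Sum>k\<in>UNIV. x $ k * g k x)"
    and g: "\<And>k. (g k \<longlongrightarrow> G k) (at 0)"
  shows "(f has_derivative (\<lambda>h. \<Sum>k\<in>UNIV. h $ k * G k)) (at 0)"
  unfolding has_derivative_at
proof
  show "bounded_linear (\<lambda>h::real^'n. \<Sum>k\<in>UNIV. h $ k * G k)"
    by (intro bounded_linear_sum bounded_linear_mult_const bounded_linear_vec_nth)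
  show "(\<lambda>h. norm (f (0 + h) - f 0 - (\<Sum>k\<in>UNIV. h $ k * G k)) / norm h) \<midarrow>0\<rightarrow> 0"
  proof (rule Lim_null_comparison)
    show "\<forall>\<^sub>F h in at 0. norm (norm (f (0 + h) - f 0 - (\<Sum>k\<in>UNIV. h $ k * G k)) / norm h)
        \<le> (\<Sum>k\<in>UNIV. \<bar>g k h - G k\<bar>)"
      using f
    proof eventually_elim
      case (elim h)
      have "f (0 + h) - f 0 - (\<Sum>k\<in>UNIV. h $ k * G k) = (\<Sum>k\<in>UNIV. h $ k * (g k h - G k))"
        using elim by (simp add: sum_subtractf right_diff_distrib)
      also have "norm \<dots> \<le> (\<Sum>k\<in>UNIV. norm h * \<bar>g k h - G k\<bar>)"
        by (rule sum_norm_le) (auto simp: abs_mult intro!: mult_right_mono component_le_norm_cart)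
      also have "\<dots> = norm h * (\<Sum>k\<in>UNIV. \<bar>g k h - G k\<bar>)" by (simp add: sum_distrib_left)
      finally show ?case
        by (cases "h = 0") (auto simp: pos_divide_le_eq mult.commute intro: sum_nonneg)
    qed
    have "((\<lambda>h. \<Sum>k\<in>UNIV. \<bar>g k h - G k\<bar>) \<longlongrightarrow> (\<Sum>k\<in>UNIV. \<bar>G k - G k\<bar>)) (at 0)"
      by (intro tendsto_intros g)
    then show "((\<lambda>h. \<Sum>k\<in>UNIV. \<bar>g k h - G k\<bar>) \<longlongrightarrow> 0) (at 0)" by simp
  qed
qed


lemma osc_ivp_solution: "ivp_solution d (\<lambda>_. \<tau>) (osc \<tau>) (osc' \<tau>)"
proof -
  have "osc \<tau> 0 = 0" "osc' \<tau> 0 = 1" by (simp_all add: osc_def osc'_def)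
  then show ?thesis unfolding ivp_solution_def
    by (intro conjI ode2_closed osc_deriv osc'_deriv)
qed

text \<open>The divided difference of \<open>\<lambda>s. 1 / s\<^sup>2 - b / s\<close>, which is \<open>\<kappa>\<close> as a function of the slope of the
  stream at \<open>d\<close>, the vorticity at \<open>1\<close> being always \<open>b\<close>.\<close>

definition kappa_slope :: "real \<Rightarrow> real \<Rightarrow> real \<Rightarrow> real" where
  "kappa_slope b s t = b / (t * s) - (t + s) / (t\<^sup>2 * s\<^sup>2)"

lemma kappa_slope:
  assumes "s \<noteq> 0" "t \<noteq> 0"
  shows "(1 / t\<^sup>2 - b / t) - (1 / s\<^sup>2 - b / s) = (t - s) * kappa_slope b s t"
  using assms by (simp add: kappa_slope_def field_simps power2_eq_square)

text \<open>The derivative of the eigenvalue \<open>m\<close> in the direction of the vorticity perturbation \<open>\<omega>\<close>. The first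
  integral comes from the change of the potential, the second one from the change of \<open>\<kappa>\<close> caused by
  the change of the slope of the stream.\<close>

definition response :: "real \<Rightarrow> real \<Rightarrow> real \<Rightarrow> (real \<Rightarrow> real) \<Rightarrow> real" where
  "response b d m \<omega> =
     - (integral {0..d} (\<lambda>z. deriv \<omega> (linear_stream b d z) * (osc (b + m) z)\<^sup>2)
        - kappa_slope b (linear_stream' b d d) (linear_stream' b d d) * (osc (b + m) d)\<^sup>2 *
          integral {0..d} (\<lambda>z. linear_stream b d z * \<omega> (linear_stream b d z)))
     / integral {0..d} (\<lambda>z. (osc (b + m) z)\<^sup>2)"

lemma osc_square_integral_pos:
  assumes d: "0 < d"
  shows "0 < integral {0..d} (\<lambda>z. (osc \<tau> z)\<^sup>2)"
proof -
  have c: "continuous_on {0..d} (osc \<tau>)" by (rule DERIV_continuous_on[OF osc_deriv])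
  obtain z where "z \<in> {0..d}" "osc \<tau> z \<noteq> 0" using ivp_solution_nontrivial[OF osc_ivp_solution d] by blast
  then show ?thesis using continuous_square_integral_pos[OF c] d by blast
qed

text \<open>The two exact identities behind the expansion are combined in the step \<open>ident\<close>; the rest of the
  proof transfers the perturbation theorems to the objects of the statement and passes to the
  limit in the factors \<open>g k\<close>.\<close>

theorem eigenvalue_map_first_order:
  fixes b d :: real and lam :: "real^'n::{finite,linorder}" and \<omega> :: "'n \<Rightarrow> real \<Rightarrow> real"
  assumes d: "0 < d" and b: "0 < b" and sn: "sin (sqrt b * d) \<noteq> 0" and cn: "cos (sqrt b * d) \<noteq> 0"
    and lam: "negative_eigenvalue_vector (linear_vorticity b) d (linear_stream b d) lam"
    and zero: "\<not> sl_eigenvalue (linear_vorticity b) d (linear_stream b d) 0"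
    and test: "\<And>k. test_function_01 (\<omega> k)"
  shows "\<forall>\<^sub>F \<delta> in nhds 0. T_well_defined b d \<omega> \<delta>"
    and "\<And>j. ((\<lambda>\<delta>. T_map b d \<omega> \<delta> $ j) has_derivative
               (\<lambda>h. \<Sum>k\<in>UNIV. h $ k * response b d (lam $ j) (\<omega> k))) (at 0)"
proof -
  define u0 u0' where "u0 = linear_stream b d" "u0' = linear_stream' b d"
  note u0_defs = this
  define s0 where "s0 = u0' d"
  have s0: "s0 \<noteq> 0" using sn cn b by (simp add: s0_def u0_defs linear_stream'_def)
  note du0 = linear_stream_deriv[OF b sn, folded u0_defs]
  note ou0 = linear_stream_ode2[OF b sn, folded u0_defs]
  have u0e: "u0 0 = 0" "u0 d = 1" using sn by (simp_all add: u0_defs linear_stream_def)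
  define \<kappa>0 where "\<kappa>0 = 1 / s0\<^sup>2 - b / s0"
  have kap0: "kappa (linear_vorticity b) d u0 = \<kappa>0"
    unfolding kappa_def \<kappa>0_def s0_def deriv_on_depth_eq[OF du0(1) d] by (simp add: linear_vorticity_def)
  have dlin: "deriv (linear_vorticity b) p = b" for p
    by (rule DERIV_imp_deriv) (auto simp: linear_vorticity_def[abs_def] intro!: derivative_eq_intros)
  have base: "sl_eigenvalue (linear_vorticity b) d u0 m \<longleftrightarrow> robin_eigenvalue d (\<lambda>_. b) \<kappa>0 m" for m
    using sl_eigenvalue_iff_robin[of d "\<lambda>_. b" "linear_vorticity b" u0 m] dlin by (simp add: kap0)
  have mono: "strict_mono (\<lambda>i. lam $ i)"
    and range: "range (\<lambda>i. lam $ i) = {m. robin_eigenvalue d (\<lambda>_. b) \<kappa>0 m \<and> m < 0}"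
    using lam by (simp_all add: negative_eigenvalue_vector_def u0_defs(1)[symmetric] base)
  have zero': "\<not> robin_eigenvalue d (\<lambda>_. b) \<kappa>0 0" using zero by (simp add: u0_defs(1)[symmetric] base)
  have "\<exists>B\<ge>0. \<forall>x y. \<bar>\<omega> k x\<bar> \<le> B \<and> \<bar>\<omega> k x - \<omega> k y\<bar> \<le> B * \<bar>x - y\<bar>" for k
    by (rule test_function_01_lipschitz[OF test])
  then obtain B1 where B1: "\<And>k. 0 \<le> B1 k" "\<And>k x. \<bar>\<omega> k x\<bar> \<le> B1 k"
    "\<And>k x y. \<bar>\<omega> k x - \<omega> k y\<bar> \<le> B1 k * \<bar>x - y\<bar>" by metis
  have "\<exists>B\<ge>0. \<forall>x y. \<bar>deriv (\<omega> k) x\<bar> \<le> B \<and> \<bar>deriv (\<omega> k) x - deriv (\<omega> k) y\<bar> \<le> B * \<bar>x - y\<bar>" for k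
    by (rule test_function_01_lipschitz[OF test_function_01_deriv[OF test]])
  then obtain B2 where B2: "\<And>k. 0 \<le> B2 k" "\<And>k x. \<bar>deriv (\<omega> k) x\<bar> \<le> B2 k"
    "\<And>k x y. \<bar>deriv (\<omega> k) x - deriv (\<omega> k) y\<bar> \<le> B2 k * \<bar>x - y\<bar>" by metis
  define M where "M = (\<Sum>k\<in>UNIV. B1 k + B2 k)"
  have M0: "0 \<le> M" unfolding M_def by (intro sum_nonneg add_nonneg_nonneg B1 B2)
  have comb: "\<bar>\<Sum>k\<in>UNIV. \<delta> $ k * f k\<bar> \<le> M * norm \<delta> * c"
    if f: "\<And>k. \<bar>f k\<bar> \<le> (B1 k + B2 k) * c" for \<delta> :: "real^'n::{finite,linorder}" and f c
  proof -
    have "\<bar>\<Sum>k\<in>UNIV. \<delta> $ k * f k\<bar> \<le> (\<Sum>k\<in>UNIV. norm \<delta> * ((B1 k + B2 k) * c))"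
      unfolding real_norm_def[symmetric]
      by (rule sum_norm_le) (auto simp: abs_mult intro!: mult_mono component_le_norm_cart f)
    also have "\<dots> = M * norm \<delta> * c" by (simp add: M_def sum_distrib_left sum_distrib_right mult_ac)
    finally show ?thesis .
  qed
  define pert where "pert \<delta> p = (\<Sum>k\<in>UNIV. \<delta> $ k * \<omega> k p)" for \<delta> p
  define pert' where "pert' \<delta> p = (\<Sum>k\<in>UNIV. \<delta> $ k * deriv (\<omega> k) p)" for \<delta> p
  have PV: "perturbed_vorticity b \<omega> \<delta> = (\<lambda>p. b * p + pert \<delta> p)" for \<delta>
    by (simp add: perturbed_vorticity_def[abs_def] pert_def[abs_def])
  have bd: "\<bar>pert \<delta> x\<bar> \<le> M * norm \<delta>" for \<delta> x
    using comb[of "\<lambda>k. \<omega> k x" 1 \<delta>] B1(2)[of _ x] B2(1) unfolding pert_def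
    by (simp add: add_increasing2)
  have bd': "\<bar>pert' \<delta> x\<bar> \<le> M * norm \<delta>" for \<delta> x
    using comb[of "\<lambda>k. deriv (\<omega> k) x" 1 \<delta>] B2(2)[of _ x] B1(1) unfolding pert'_def
    by (simp add: add_increasing)
  have lip: "\<bar>pert \<delta> x - pert \<delta> y\<bar> \<le> M * norm \<delta> * \<bar>x - y\<bar>" for \<delta> x y
  proof -
    have "\<bar>\<omega> k x - \<omega> k y\<bar> \<le> (B1 k + B2 k) * \<bar>x - y\<bar>" for k
      by (rule order_trans[OF B1(3)]) (use B2(1) in \<open>auto intro: mult_right_mono\<close>)
    from comb[OF this, of \<delta>] show ?thesis by (simp add: pert_def right_diff_distrib sum_subtractf)
  qed
  have dPV: "deriv (perturbed_vorticity b \<omega> \<delta>) p = b + pert' \<delta> p" for \<delta> p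
  proof (rule DERIV_imp_deriv)
    have "((\<lambda>p. b * p + (\<Sum>k\<in>UNIV. \<delta> $ k * \<omega> k p)) has_real_derivative
        b * 1 + (\<Sum>k\<in>UNIV. \<delta> $ k * deriv (\<omega> k) p)) (at p)"
      by (intro DERIV_add DERIV_cmult DERIV_ident DERIV_sum test_function_01_props(1)[OF test])
    then show "(perturbed_vorticity b \<omega> \<delta> has_real_derivative b + pert' \<delta> p) (at p)"
      by (simp add: perturbed_vorticity_def[abs_def] pert'_def)
  qed
  have PV1: "perturbed_vorticity b \<omega> \<delta> 1 = b" for \<delta>
    using test_function_01_props(4)[OF test, of 1] by (simp add: perturbed_vorticity_def)
  have pc: "continuous_on UNIV (pert' \<delta>)" for \<delta>
    unfolding pert'_def[abs_def] by (intro continuous_intros test_function_01_props(3)[OF test])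
  obtain e0 C where e0: "0 < e0" and C: "0 \<le> C" and
    strm: "\<And>g e. 0 \<le> e \<Longrightarrow> e \<le> e0 \<Longrightarrow> (\<forall>x y. \<bar>g x - g y\<bar> \<le> e * \<bar>x - y\<bar>) \<Longrightarrow> (\<forall>x. \<bar>g x\<bar> \<le> e) \<Longrightarrow>
    (\<exists>u u'. ode2 d u u' (\<lambda>z. - (b * u z + g (u z))) \<and> stream_solution (\<lambda>p. b * p + g p) d u \<and>
      (\<forall>z\<in>{0..d}. \<bar>u z - u0 z\<bar> \<le> C * e \<and> \<bar>u' z - u0' z\<bar> \<le> C * e) \<and>
      (\<forall>v. stream_solution (\<lambda>p. b * p + g p) d v \<longrightarrow> (\<forall>z\<in>{0..d}. v z = u z)))"
    using stream_solution_perturbation[OF d b sn, folded u0_defs] by (elim exE conjE) (rule that; blast)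
  \<comment> \<open>\<open>good \<delta> u u'\<close>: \<open>u\<close> is the unique stream solution for \<open>\<delta>\<close>, with derivative \<open>u'\<close> and the expected
      distance to the linear stream.\<close>
  define good where "good \<delta> u u' \<longleftrightarrow> ode2 d u u' (\<lambda>z. - (b * u z + pert \<delta> (u z))) \<and>
      stream_solution (perturbed_vorticity b \<omega> \<delta>) d u \<and>
      (\<forall>z\<in>{0..d}. \<bar>u z - u0 z\<bar> \<le> C * (M * norm \<delta>) \<and> \<bar>u' z - u0' z\<bar> \<le> C * (M * norm \<delta>)) \<and>
      (\<forall>v. stream_solution (perturbed_vorticity b \<omega> \<delta>) d v \<longrightarrow> (\<forall>z\<in>{0..d}. v z = u z))" for \<delta> u u'
  have "\<exists>u u'. M * norm \<delta> \<le> e0 \<longrightarrow> good \<delta> u u'" for \<delta>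
  proof (cases "M * norm \<delta> \<le> e0")
    case True
    have "\<exists>u u'. good \<delta> u u'"
      unfolding good_def PV by (rule strm[OF _ True]) (simp_all add: M0 lip bd)
    then show ?thesis by simp
  qed simp
  then obtain U U' where UU: "\<And>\<delta>. M * norm \<delta> \<le> e0 \<Longrightarrow> good \<delta> (U \<delta>) (U' \<delta>)" by metis
  have norm0: "((\<lambda>\<delta>::real^'n::{finite,linorder}. c * (M * norm \<delta>)) \<longlongrightarrow> 0) (nhds 0)" for c
  proof -
    have "((\<lambda>\<delta>::real^'n::{finite,linorder}. c * (M * norm \<delta>)) \<longlongrightarrow> c * (M * norm (0::real^'n::{finite,linorder}))) (nhds 0)"
      by (intro tendsto_intros filterlim_ident)
    then show ?thesis by simp
  qed
  have normlt: "\<forall>\<^sub>F \<delta>::real^'n::{finite,linorder} in nhds 0. c * (M * norm \<delta>) < e" if "0 < e" for c e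
    using order_tendstoD(2)[OF norm0 that] .
  have evgood: "\<forall>\<^sub>F \<delta> in nhds 0. good \<delta> (U \<delta>) (U' \<delta>)"
    using normlt[OF e0, of 1] by eventually_elim (simp add: UU)
  define q where "q \<delta> z = b + pert' \<delta> (U \<delta> z)" for \<delta> z
  define s where "s \<delta> = U' \<delta> d" for \<delta>
  define \<kappa> where "\<kappa> \<delta> = 1 / (s \<delta>)\<^sup>2 - b / s \<delta>" for \<delta>
  have dd: "d \<in> {0..d}" "0 \<in> {0..d}" using d by auto
  have s_lim: "(s \<longlongrightarrow> s0) (nhds 0)"
  proof -
    have "\<forall>\<^sub>F \<delta> in nhds 0. norm (s \<delta> - s0) \<le> C * (M * norm \<delta>)"
      using evgood by eventually_elim (use dd in \<open>simp add: good_def s_def s0_def\<close>)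
    then have "((\<lambda>\<delta>. s \<delta> - s0) \<longlongrightarrow> 0) (nhds 0)" using norm0 by (rule Lim_null_comparison)
    then show ?thesis by (simp add: LIM_zero_iff)
  qed
  have s_nz: "\<forall>\<^sub>F \<delta> in nhds 0. s \<delta> \<noteq> 0" using tendsto_imp_eventually_ne[OF s_lim s0] .
  have k_lim: "(\<kappa> \<longlongrightarrow> \<kappa>0) (nhds 0)"
    unfolding \<kappa>_def[abs_def] \<kappa>0_def using s0 by (intro tendsto_intros s_lim) auto
  have U_ode: "ode2 d (U \<delta>) (U' \<delta>) (\<lambda>z. - (b * U \<delta> z + pert \<delta> (U \<delta> z)))" if "good \<delta> (U \<delta>) (U' \<delta>)" for \<delta>
    using that by (simp add: good_def)
  have q_cont: "continuous_on {0..d} (q \<delta>)" if "good \<delta> (U \<delta>) (U' \<delta>)" for \<delta>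
    unfolding q_def[abs_def]
    by (intro continuous_intros continuous_on_compose2[OF pc ode2_cont(1)[OF U_ode[OF that]]]) auto
  have q_close: "\<bar>q \<delta> z - b\<bar> \<le> M * norm \<delta>" for \<delta> z using bd' by (simp add: q_def)
  have slope: "deriv_on_depth d v d = s \<delta>"
    if g: "good \<delta> (U \<delta>) (U' \<delta>)" and v: "\<And>z. z \<in> {0..d} \<Longrightarrow> v z = U \<delta> z" for \<delta> v
  proof -
    have D: "(U \<delta> has_real_derivative U' \<delta> d) (at d within {0..d})"
      using U_ode[OF g] dd by (auto simp: ode2_def)
    show ?thesis using deriv_on_depth_cong[OF D d v] deriv_on_depth_eq[OF D d] by (simp add: s_def)
  qed
  have robin: "sl_eigenvalue (perturbed_vorticity b \<omega> \<delta>) d v m \<longleftrightarrow> robin_eigenvalue d (q \<delta>) (\<kappa> \<delta>) m"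
    if g: "good \<delta> (U \<delta>) (U' \<delta>)" and v: "\<And>z. z \<in> {0..d} \<Longrightarrow> v z = U \<delta> z" for \<delta> v m
  proof -
    have sl: "deriv_on_depth d v d = s \<delta>" by (rule slope[OF g]) (rule v)
    have "kappa (perturbed_vorticity b \<omega> \<delta>) d v = \<kappa> \<delta>"
      unfolding kappa_def \<kappa>_def PV1 sl ..
    moreover have "q \<delta> z = deriv (perturbed_vorticity b \<omega> \<delta>) (v z)" if "z \<in> {0<..<d}" for z
      using v[of z] that by (simp add: q_def dPV)
    ultimately show ?thesis using sl_eigenvalue_iff_robin by metis
  qed
  define T where "T = T_map b d \<omega>"
  define eigvec where "eigvec \<delta> \<mu> \<longleftrightarrow> strict_mono (\<lambda>i. \<mu> $ i) \<and>
         range (\<lambda>i. \<mu> $ i) = {m. robin_eigenvalue d (q \<delta>) (\<kappa> \<delta>) m \<and> m < 0}"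
    for \<delta> and \<mu> :: "real^'n::{finite,linorder}"
  \<comment> \<open>The description in the definition of the map denotes, because the stream solution is unique
      and an increasing enumeration is determined by its range.\<close>
  have T_eq: "T \<delta> = \<mu>" if g: "good \<delta> (U \<delta>) (U' \<delta>)" and mu: "eigvec \<delta> \<mu>" for \<delta> \<mu>
    unfolding T_def T_map_def
  proof (rule the_equality)
    have "negative_eigenvalue_vector (perturbed_vorticity b \<omega> \<delta>) d (U \<delta>) \<mu>"
      using mu robin[OF g refl] by (simp add: negative_eigenvalue_vector_def eigvec_def)
    then show "\<exists>u. stream_solution (perturbed_vorticity b \<omega> \<delta>) d u \<and>
        negative_eigenvalue_vector (perturbed_vorticity b \<omega> \<delta>) d u \<mu>"
      using g by (auto simp: good_def)
    fix \<nu> :: "real^'n::{finite,linorder}"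
    assume "\<exists>u. stream_solution (perturbed_vorticity b \<omega> \<delta>) d u \<and>
        negative_eigenvalue_vector (perturbed_vorticity b \<omega> \<delta>) d u \<nu>"
    then obtain v where v: "stream_solution (perturbed_vorticity b \<omega> \<delta>) d v"
        "negative_eigenvalue_vector (perturbed_vorticity b \<omega> \<delta>) d v \<nu>" by blast
    have "\<And>z. z \<in> {0..d} \<Longrightarrow> v z = U \<delta> z" using g v(1) by (simp add: good_def)
    from robin[OF g this] v(2) have "eigvec \<delta> \<nu>" by (simp add: negative_eigenvalue_vector_def eigvec_def)
    then show "\<nu> = \<mu>" using mu strict_mono_vec_unique[of \<nu> \<mu>] by (simp add: eigvec_def)
  qed
  have T_near: "\<forall>\<^sub>F \<delta> in nhds 0. good \<delta> (U \<delta>) (U' \<delta>) \<and> eigvec \<delta> (T \<delta>) \<and> (\<forall>i. \<bar>T \<delta> $ i - lam $ i\<bar> < r)"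
    if r: "0 < r" for r
  proof -
    obtain e where e: "0 < e" and pp:
      "\<forall>q \<kappa>. continuous_on {0..d} q \<longrightarrow> (\<forall>z\<in>{0..d}. \<bar>q z - b\<bar> \<le> e) \<longrightarrow> \<bar>\<kappa> - \<kappa>0\<bar> \<le> e \<longrightarrow>
       (\<exists>\<mu>::real^'n::{finite,linorder}. strict_mono (\<lambda>i. \<mu> $ i) \<and>
         range (\<lambda>i. \<mu> $ i) = {m. robin_eigenvalue d q \<kappa> m \<and> m < 0} \<and> (\<forall>i. \<bar>\<mu> $ i - lam $ i\<bar> < r))"
      using robin_eigenvalues_perturbation[OF d continuous_on_const mono range zero' r]
      by (elim exE conjE) (rule that)
    have "\<forall>\<^sub>F \<delta> in nhds 0. dist (\<kappa> \<delta>) \<kappa>0 < e" using k_lim e by (rule tendstoD)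
    with evgood normlt[OF e, of 1] show ?thesis
    proof eventually_elim
      case (elim \<delta>)
      have "\<bar>q \<delta> z - b\<bar> \<le> e" for z using q_close[of \<delta> z] elim(2) by simp
      moreover have "\<bar>\<kappa> \<delta> - \<kappa>0\<bar> \<le> e" using elim(3) by (simp add: dist_real_def)
      ultimately have "\<exists>\<mu>. eigvec \<delta> \<mu> \<and> (\<forall>i. \<bar>\<mu> $ i - lam $ i\<bar> < r)"
        using pp[rule_format, OF q_cont[OF elim(1)], of "\<kappa> \<delta>"] by (simp add: eigvec_def conj_assoc)
      then obtain \<mu> where mu: "eigvec \<delta> \<mu>" "\<forall>i. \<bar>\<mu> $ i - lam $ i\<bar> < r" by blast
      then show ?case using T_eq[OF elim(1) mu(1)] elim(1) by simp
    qed
  qed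
  have T_lim: "((\<lambda>\<delta>. T \<delta> $ i) \<longlongrightarrow> lam $ i) (nhds 0)" for i
  proof (rule tendstoI)
    fix e :: real assume "0 < e"
    from T_near[OF this] show "\<forall>\<^sub>F \<delta> in nhds 0. dist (T \<delta> $ i) (lam $ i) < e"
      by eventually_elim (simp add: dist_real_def)
  qed
  have T0: "T 0 $ i = lam $ i" for i
  proof (rule ccontr)
    assume "T 0 $ i \<noteq> lam $ i"
    then have "0 < \<bar>T 0 $ i - lam $ i\<bar>" by simp
    from eventually_nhds_x_imp_x[OF T_near[OF this]] show False by auto
  qed
  show "\<forall>\<^sub>F \<delta> in nhds 0. T_well_defined b d \<omega> \<delta>"
    using T_near[of 1, OF zero_less_one] s_nz
  proof eventually_elim
    case (elim \<delta>)
    then have g: "good \<delta> (U \<delta>) (U' \<delta>)" and ev: "eigvec \<delta> (T \<delta>)" by auto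
    show ?case unfolding T_well_defined_def T_def[symmetric]
    proof (intro exI conjI)
      show "stream_solution (perturbed_vorticity b \<omega> \<delta>) d (U \<delta>)" using g by (simp add: good_def)
      show "\<forall>v. stream_solution (perturbed_vorticity b \<omega> \<delta>) d v \<longrightarrow> (\<forall>z\<in>{0..d}. v z = U \<delta> z)"
        using g by (simp add: good_def)
      show "deriv_on_depth d (U \<delta>) d \<noteq> 0" using slope[OF g refl] elim(2) by simp
      show "negative_eigenvalue_vector (perturbed_vorticity b \<omega> \<delta>) d (U \<delta>) (T \<delta>)"
        using ev robin[OF g refl] by (simp add: negative_eigenvalue_vector_def eigvec_def)
    qed
  qed
  show "((\<lambda>\<delta>. T_map b d \<omega> \<delta> $ j) has_derivative
               (\<lambda>h. \<Sum>k\<in>UNIV. h $ k * response b d (lam $ j) (\<omega> k))) (at 0)" for j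
  proof -
    define \<phi>0 where "\<phi>0 = osc (b + lam $ j)"
    define \<phi>0' where "\<phi>0' = osc' (b + lam $ j)"
    define F where "F \<delta> = fst (shoot d (\<lambda>z. q \<delta> z + T \<delta> $ j))" for \<delta>
    define F' where "F' \<delta> = snd (shoot d (\<lambda>z. q \<delta> z + T \<delta> $ j))" for \<delta>
    have phi0: "ivp_solution d (\<lambda>_. b + lam $ j) \<phi>0 \<phi>0'"
      unfolding \<phi>0_def \<phi>0'_def by (rule osc_ivp_solution)
    have F: "ivp_solution d (\<lambda>z. q \<delta> z + T \<delta> $ j) (F \<delta>) (F' \<delta>)" if "good \<delta> (U \<delta>) (U' \<delta>)" for \<delta>
      unfolding F_def F'_def by (rule shoot_ivp[OF d]) (intro continuous_intros q_cont that)
    have "robin_eigenvalue d (\<lambda>_. b) \<kappa>0 (lam $ j)" using range by auto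
    then have phi0_bd: "\<phi>0' d = \<kappa>0 * \<phi>0 d"
      by (subst (asm) robin_eigenvalue_iff[OF phi0 d continuous_on_const])
    have F_bd: "F' \<delta> d = \<kappa> \<delta> * F \<delta> d" if g: "good \<delta> (U \<delta>) (U' \<delta>)" and e: "eigvec \<delta> (T \<delta>)" for \<delta>
    proof -
      have "robin_eigenvalue d (q \<delta>) (\<kappa> \<delta>) (T \<delta> $ j)" using e unfolding eigvec_def by blast
      then show ?thesis by (simp add: robin_eigenvalue_iff[OF F[OF g] d q_cont[OF g]])
    qed
    have cphi0: "continuous_on {0..d} \<phi>0" using phi0 ode2_cont(1) unfolding ivp_solution_def by blast
    have cF: "continuous_on {0..d} (F \<delta>)" if "good \<delta> (U \<delta>) (U' \<delta>)" for \<delta>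
      using F[OF that] ode2_cont(1) unfolding ivp_solution_def by blast
    have cU: "continuous_on {0..d} (U \<delta>)" if "good \<delta> (U \<delta>) (U' \<delta>)" for \<delta>
      using ode2_cont(1)[OF U_ode[OF that]] .
    have cu0: "continuous_on {0..d} u0" using ode2_cont(1)[OF ou0] .
    have cw: "continuous_on {0..d} (\<lambda>z. \<omega> k (v z))" "continuous_on {0..d} (\<lambda>z. deriv (\<omega> k) (v z))"
      if "continuous_on {0..d} v" for k v
      using continuous_on_compose2[OF test_function_01_props(2)[OF test] that]
        continuous_on_compose2[OF test_function_01_props(3)[OF test] that] by auto
    have bnd: "bounded (f ` {0..d})" if "continuous_on {0..d} f" for f :: "real \<Rightarrow> real"
      using that by (intro compact_imp_bounded compact_continuous_image) auto
    define A where "A = \<bar>b + lam $ j\<bar> + 2"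
    have A: "0 \<le> A" by (simp add: A_def)
    have ulF: "uniform_limit {0..d} F \<phi>0 (nhds 0)"
    proof (rule uniform_limit_by_bound)
      have "((\<lambda>\<delta>. (growth d A)\<^sup>2 * (1 * (M * norm \<delta>) + \<bar>T \<delta> $ j - lam $ j\<bar>)) \<longlongrightarrow>
         (growth d A)\<^sup>2 * (0 + \<bar>lam $ j - lam $ j\<bar>)) (nhds 0)"
        by (intro tendsto_intros norm0 T_lim)
      then show "((\<lambda>\<delta>. (growth d A)\<^sup>2 * (1 * (M * norm \<delta>) + \<bar>T \<delta> $ j - lam $ j\<bar>)) \<longlongrightarrow> 0) (nhds 0)" by simp
      show "\<forall>\<^sub>F \<delta> in nhds 0. \<forall>z\<in>{0..d}. \<bar>F \<delta> z - \<phi>0 z\<bar> \<le> (growth d A)\<^sup>2 * (1 * (M * norm \<delta>) + \<bar>T \<delta> $ j - lam $ j\<bar>)"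
        using T_near[OF zero_less_one] normlt[OF zero_less_one, of 1]
      proof eventually_elim
        case (elim \<delta>)
        then have g: "good \<delta> (U \<delta>) (U' \<delta>)" and t: "\<bar>T \<delta> $ j - lam $ j\<bar> < 1" by auto
        show ?case
        proof
          fix z assume z: "z \<in> {0..d}"
          show "\<bar>F \<delta> z - \<phi>0 z\<bar> \<le> (growth d A)\<^sup>2 * (1 * (M * norm \<delta>) + \<bar>T \<delta> $ j - lam $ j\<bar>)"
          proof (rule ivp_solution_lipschitz(1)[OF F[OF g] phi0 d A _ _ _ _ z])
            show "0 \<le> 1 * (M * norm \<delta>) + \<bar>T \<delta> $ j - lam $ j\<bar>" using M0 by simp
            have tri: "\<bar>y + x\<bar> \<le> \<bar>y\<bar> + \<bar>x\<bar>" for x y :: real by (rule abs_triangle_ineq)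
            show dist: "\<bar>q \<delta> z + T \<delta> $ j - (b + lam $ j)\<bar> \<le> 1 * (M * norm \<delta>) + \<bar>T \<delta> $ j - lam $ j\<bar>" for z
            proof -
              have "q \<delta> z + T \<delta> $ j - (b + lam $ j) = (q \<delta> z - b) + (T \<delta> $ j - lam $ j)" by simp
              then show ?thesis using tri[of "q \<delta> z - b" "T \<delta> $ j - lam $ j"] q_close[of \<delta> z] by simp
            qed
            show "\<bar>q \<delta> z + T \<delta> $ j\<bar> \<le> A" for z
            proof -
              have "\<bar>q \<delta> z + T \<delta> $ j\<bar> \<le> \<bar>b + lam $ j\<bar> + \<bar>q \<delta> z + T \<delta> $ j - (b + lam $ j)\<bar>"
                using tri[of "b + lam $ j" "q \<delta> z + T \<delta> $ j - (b + lam $ j)"] by simp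
              also have "\<dots> \<le> \<bar>b + lam $ j\<bar> + 2" using dist[of z] t elim(2) by simp
              finally show ?thesis by (simp add: A_def)
            qed
            show "\<bar>b + lam $ j\<bar> \<le> A" by (simp add: A_def)
          qed
        qed
      qed
    qed
    have ulw: "uniform_limit {0..d} (\<lambda>\<delta> z. \<omega> k (U \<delta> z)) (\<lambda>z. \<omega> k (u0 z)) (nhds 0)"
      and uldw: "uniform_limit {0..d} (\<lambda>\<delta> z. deriv (\<omega> k) (U \<delta> z)) (\<lambda>z. deriv (\<omega> k) (u0 z)) (nhds 0)" for k
    proof -
      have close: "\<forall>\<^sub>F \<delta> in nhds 0. \<forall>z\<in>{0..d}. \<bar>f (U \<delta> z) - f (u0 z)\<bar> \<le> (B * C) * (M * norm \<delta>)"
        if f: "\<And>x y. \<bar>f x - f y\<bar> \<le> B * \<bar>x - y\<bar>" "0 \<le> B" for f and B :: real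
        using evgood
      proof eventually_elim
        case (elim \<delta>)
        show ?case
        proof
          fix z assume z: "z \<in> {0..d}"
          have "\<bar>f (U \<delta> z) - f (u0 z)\<bar> \<le> B * \<bar>U \<delta> z - u0 z\<bar>" by (rule f)
          also have "\<dots> \<le> B * (C * (M * norm \<delta>))"
            using elim z f(2) by (intro mult_left_mono) (simp_all add: good_def)
          finally show "\<bar>f (U \<delta> z) - f (u0 z)\<bar> \<le> (B * C) * (M * norm \<delta>)" by (simp add: mult.assoc)
        qed
      qed
      show "uniform_limit {0..d} (\<lambda>\<delta> z. \<omega> k (U \<delta> z)) (\<lambda>z. \<omega> k (u0 z)) (nhds 0)"
        by (rule uniform_limit_by_bound[OF close[OF B1(3) B1(1)] norm0])
      show "uniform_limit {0..d} (\<lambda>\<delta> z. deriv (\<omega> k) (U \<delta> z)) (\<lambda>z. deriv (\<omega> k) (u0 z)) (nhds 0)"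
        by (rule uniform_limit_by_bound[OF close[OF B2(3) B2(1)] norm0])
    qed
    have ulc: "uniform_limit {0..d} (\<lambda>_. f) f (nhds 0)" for f :: "real \<Rightarrow> real"
      by (rule uniform_limit_const)
    define I where "I \<delta> = integral {0..d} (\<lambda>z. F \<delta> z * \<phi>0 z)" for \<delta>
    define a where "a k \<delta> = integral {0..d} (\<lambda>z. deriv (\<omega> k) (U \<delta> z) * (F \<delta> z * \<phi>0 z))" for k \<delta>
    define e where "e k \<delta> = integral {0..d} (\<lambda>z. u0 z * \<omega> k (U \<delta> z))" for k \<delta>
    define I0 where "I0 = integral {0..d} (\<lambda>z. \<phi>0 z * \<phi>0 z)"
    define a0 where "a0 k = integral {0..d} (\<lambda>z. deriv (\<omega> k) (u0 z) * (\<phi>0 z * \<phi>0 z))" for k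
    define e0 where "e0 k = integral {0..d} (\<lambda>z. u0 z * \<omega> k (u0 z))" for k
    have cpp: "continuous_on {0..d} (\<lambda>z. \<phi>0 z * \<phi>0 z)" by (intro continuous_intros cphi0)
    have ulpp: "uniform_limit {0..d} (\<lambda>\<delta> z. F \<delta> z * \<phi>0 z) (\<lambda>z. \<phi>0 z * \<phi>0 z) (nhds 0)"
      by (rule uniform_lim_mult[OF ulF ulc bnd[OF cphi0] bnd[OF cphi0]])
    have I_lim: "(I \<longlongrightarrow> I0) (nhds 0)"
      unfolding I_def[abs_def] I0_def
      by (rule integral_tendsto_uniform[OF ulpp _ cpp d])
         (use evgood in eventually_elim, intro continuous_intros cF cphi0)
    have a_lim: "(a k \<longlongrightarrow> a0 k) (nhds 0)" for k
      unfolding a_def[abs_def] a0_def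
      by (rule integral_tendsto_uniform[OF uniform_lim_mult[OF uldw ulpp bnd[OF cw(2)[OF cu0]] bnd[OF cpp]] _
            continuous_on_mult[OF cw(2)[OF cu0] cpp] d])
         (use evgood in eventually_elim, intro continuous_intros cF cphi0 cw cU)
    have e_lim: "(e k \<longlongrightarrow> e0 k) (nhds 0)" for k
      unfolding e_def[abs_def] e0_def
      by (rule integral_tendsto_uniform[OF uniform_lim_mult[OF ulc ulw bnd[OF cu0] bnd[OF cw(1)[OF cu0]]] _
            continuous_on_mult[OF cu0 cw(1)[OF cu0]] d])
         (use evgood in eventually_elim, intro continuous_intros cF cu0 cw cU)
    have F_lim: "((\<lambda>\<delta>. F \<delta> d) \<longlongrightarrow> \<phi>0 d) (nhds 0)" by (rule tendsto_uniform_limitI[OF ulF dd(1)])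
    have I0: "0 < I0" unfolding I0_def \<phi>0_def using osc_square_integral_pos[OF d] by (simp add: power2_eq_square)
    define H where "H \<delta> = kappa_slope b s0 (s \<delta>)" for \<delta>
    have H_lim: "(H \<longlongrightarrow> kappa_slope b s0 s0) (nhds 0)"
      unfolding H_def[abs_def] kappa_slope_def using s0 by (intro tendsto_intros s_lim) auto
    define g where "g k \<delta> = - (a k \<delta> - H \<delta> * (F \<delta> d * \<phi>0 d) * e k \<delta>) / I \<delta>" for k \<delta>
    have g_lim: "(g k \<longlongrightarrow> response b d (lam $ j) (\<omega> k)) (nhds 0)" for k
    proof -
      have "(g k \<longlongrightarrow> - (a0 k - kappa_slope b s0 s0 * (\<phi>0 d * \<phi>0 d) * e0 k) / I0) (nhds 0)"
        unfolding g_def[abs_def] using I0 by (intro tendsto_intros a_lim H_lim F_lim e_lim I_lim) auto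
      then show ?thesis
        by (simp add: response_def a0_def e0_def I0_def s0_def u0_defs \<phi>0_def power2_eq_square)
    qed
    have comb_int: "integral {0..d} (\<lambda>z. (\<Sum>k\<in>UNIV. \<delta> $ k * w k z) * h z) = (\<Sum>k\<in>UNIV. \<delta> $ k * integral {0..d} (\<lambda>z. w k z * h z))"
      if c: "\<And>k. continuous_on {0..d} (w k)" "continuous_on {0..d} h"
      for \<delta> :: "real^'n::{finite,linorder}" and w h
    proof -
      have "integral {0..d} (\<lambda>z. (\<Sum>k\<in>UNIV. \<delta> $ k * w k z) * h z) =
          integral {0..d} (\<lambda>z. \<Sum>k\<in>UNIV. \<delta> $ k * (w k z * h z))"
        by (simp add: sum_distrib_right mult.assoc)
      also have "\<dots> = (\<Sum>k\<in>UNIV. integral {0..d} (\<lambda>z. \<delta> $ k * (w k z * h z)))"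
        by (intro integral_sum integrable_continuous_interval continuous_intros c) auto
      finally show ?thesis by simp
    qed
    have ident: "T \<delta> $ j - lam $ j = (\<Sum>k\<in>UNIV. \<delta> $ k * g k \<delta>)"
      if g: "good \<delta> (U \<delta>) (U' \<delta>)" and ev: "eigvec \<delta> (T \<delta>)" and sz: "s \<delta> \<noteq> 0" and Iz: "I \<delta> \<noteq> 0" for \<delta>
    proof -
      have st: "U \<delta> 0 = 0" "U \<delta> d = 1" using g by (simp_all add: good_def stream_solution_def)
      \<comment> \<open>The change of the slope, from Lagrange's identity for the perturbed and the linear stream.\<close>
      have "((\<lambda>z. - (b * U \<delta> z + pert \<delta> (U \<delta> z)) * u0 z - U \<delta> z * - (b * u0 z)) has_integral
           (U' \<delta> d * u0 d - U \<delta> d * u0' d) - (U' \<delta> 0 * u0 0 - U \<delta> 0 * u0' 0)) {0..d}"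
        by (rule lagrange_identity[OF U_ode[OF g] ou0 d])
      moreover have "(\<lambda>z. - (b * U \<delta> z + pert \<delta> (U \<delta> z)) * u0 z - U \<delta> z * - (b * u0 z)) =
          (\<lambda>z. - (pert \<delta> (U \<delta> z) * u0 z))" by (auto simp: algebra_simps)
      moreover have "(U' \<delta> d * u0 d - U \<delta> d * u0' d) - (U' \<delta> 0 * u0 0 - U \<delta> 0 * u0' 0) = s \<delta> - s0"
        using st u0e by (simp add: s_def s0_def)
      ultimately have "((\<lambda>z. - (pert \<delta> (U \<delta> z) * u0 z)) has_integral s \<delta> - s0) {0..d}" by simp
      then have "integral {0..d} (\<lambda>z. - (pert \<delta> (U \<delta> z) * u0 z)) = s \<delta> - s0" by (rule integral_unique)
      then have sdiff: "s \<delta> - s0 = - (\<Sum>k\<in>UNIV. \<delta> $ k * e k \<delta>)"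
        using comb_int[of "\<lambda>k z. \<omega> k (U \<delta> z)" u0 \<delta>] cw(1)[OF cU[OF g]] cu0
        by (simp add: pert_def e_def mult.commute)
      \<comment> \<open>The change of the eigenvalue: the perturbed eigenfunction fails the unperturbed boundary
          condition exactly by the change of \<open>\<kappa>\<close>.\<close>
      have "((\<lambda>z. ((q \<delta> z + T \<delta> $ j) - (b + lam $ j)) * (F \<delta> z * \<phi>0 z)) has_integral
          F \<delta> d * (\<phi>0' d - \<kappa>0 * \<phi>0 d) - (F' \<delta> d - \<kappa>0 * F \<delta> d) * \<phi>0 d) {0..d}"
        by (rule robin_defect_product[OF F[OF g] phi0 d])
      moreover have "(\<lambda>z. ((q \<delta> z + T \<delta> $ j) - (b + lam $ j)) * (F \<delta> z * \<phi>0 z)) =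
          (\<lambda>z. pert' \<delta> (U \<delta> z) * (F \<delta> z * \<phi>0 z) + (T \<delta> $ j - lam $ j) * (F \<delta> z * \<phi>0 z))"
        by (auto simp: q_def algebra_simps)
      moreover have "F \<delta> d * (\<phi>0' d - \<kappa>0 * \<phi>0 d) - (F' \<delta> d - \<kappa>0 * F \<delta> d) * \<phi>0 d = - ((\<kappa> \<delta> - \<kappa>0) * (F \<delta> d * \<phi>0 d))"
        using phi0_bd F_bd[OF g ev] by (simp add: algebra_simps)
      ultimately have e1: "integral {0..d} (\<lambda>z. pert' \<delta> (U \<delta> z) * (F \<delta> z * \<phi>0 z) + (T \<delta> $ j - lam $ j) * (F \<delta> z * \<phi>0 z)) =
          - ((\<kappa> \<delta> - \<kappa>0) * (F \<delta> d * \<phi>0 d))"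
        by (simp add: integral_unique)
      have e2: "integral {0..d} (\<lambda>z. pert' \<delta> (U \<delta> z) * (F \<delta> z * \<phi>0 z) + (T \<delta> $ j - lam $ j) * (F \<delta> z * \<phi>0 z)) =
          integral {0..d} (\<lambda>z. pert' \<delta> (U \<delta> z) * (F \<delta> z * \<phi>0 z)) + integral {0..d} (\<lambda>z. (T \<delta> $ j - lam $ j) * (F \<delta> z * \<phi>0 z))"
        by (intro Henstock_Kurzweil_Integration.integral_add integrable_continuous_interval continuous_intros
            cF[OF g] cphi0 continuous_on_compose2[OF pc cU[OF g]]) auto
      have e3: "integral {0..d} (\<lambda>z. pert' \<delta> (U \<delta> z) * (F \<delta> z * \<phi>0 z)) = (\<Sum>k\<in>UNIV. \<delta> $ k * a k \<delta>)"
        using comb_int[of "\<lambda>k z. deriv (\<omega> k) (U \<delta> z)" "\<lambda>z. F \<delta> z * \<phi>0 z" \<delta>] cw(2)[OF cU[OF g]]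
          continuous_on_mult[OF cF[OF g] cphi0]
        by (simp add: pert'_def a_def)
      have e4: "\<kappa> \<delta> - \<kappa>0 = (s \<delta> - s0) * H \<delta>"
        unfolding \<kappa>_def \<kappa>0_def H_def by (rule kappa_slope[OF s0 sz])
      have e5: "integral {0..d} (\<lambda>z. (T \<delta> $ j - lam $ j) * (F \<delta> z * \<phi>0 z)) = (T \<delta> $ j - lam $ j) * I \<delta>"
        by (simp add: I_def)
      have "(T \<delta> $ j - lam $ j) * I \<delta> = - ((s \<delta> - s0) * H \<delta> * (F \<delta> d * \<phi>0 d)) - (\<Sum>k\<in>UNIV. \<delta> $ k * a k \<delta>)"
        using e1 unfolding e2 e3 e4 e5 by (simp only: eq_diff_eq add.commute)
      also have "\<dots> = (\<Sum>k\<in>UNIV. \<delta> $ k * e k \<delta>) * H \<delta> * (F \<delta> d * \<phi>0 d) - (\<Sum>k\<in>UNIV. \<delta> $ k * a k \<delta>)"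
        unfolding sdiff by simp
      also have "\<dots> = (\<Sum>k\<in>UNIV. \<delta> $ k * g k \<delta> * I \<delta>)"
        unfolding sum_distrib_right sum_subtractf[symmetric]
        by (rule sum.cong) (use Iz in \<open>auto simp: g_def field_simps\<close>)
      finally have "(T \<delta> $ j - lam $ j) * I \<delta> = (\<Sum>k\<in>UNIV. \<delta> $ k * g k \<delta>) * I \<delta>"
        by (simp add: sum_distrib_right)
      then show ?thesis using Iz by simp
    qed
    have I_nz: "\<forall>\<^sub>F \<delta> in nhds 0. I \<delta> \<noteq> 0" using tendsto_imp_eventually_ne[OF I_lim] I0 by simp
    have "\<forall>\<^sub>F \<delta> in nhds 0. T \<delta> $ j - T 0 $ j = (\<Sum>k\<in>UNIV. \<delta> $ k * g k \<delta>)"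
      using T_near[OF zero_less_one] s_nz I_nz
    proof eventually_elim
      case (elim \<delta>)
      then show ?case using ident[of \<delta>] by (simp add: T0)
    qed
    then have "\<forall>\<^sub>F \<delta> in at 0. T \<delta> $ j - T 0 $ j = (\<Sum>k\<in>UNIV. \<delta> $ k * g k \<delta>)"
      by (simp add: eventually_nhds_conv_at)
    moreover have "(g k \<longlongrightarrow> response b d (lam $ j) (\<omega> k)) (at 0)" for k
      by (rule tendsto_mono[OF _ g_lim]) (simp add: at_within_def)
    ultimately show ?thesis unfolding T_def[symmetric] by (rule has_derivative_from_linear_factors)
  qed
qed

section \<open>Perturbations with prescribed responses\<close>

lemma test_integrals_cont:
  assumes w: "test_function_01 \<omega>" and u: "continuous_on {0..d} u"
  shows "continuous_on {0..d} (\<lambda>z. \<omega> (u z))" "continuous_on {0..d} (\<lambda>z. deriv \<omega> (u z))"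
  using continuous_on_compose2[OF test_function_01_props(2)[OF w] u]
    continuous_on_compose2[OF test_function_01_props(3)[OF w] u] by auto

lemma response_linear:
  assumes d: "0 < d" and b: "0 < b" and sn: "sin (sqrt b * d) \<noteq> 0"
    and f: "test_function_01 f" and g: "test_function_01 g"
  shows "response b d m (\<lambda>x. a * f x + c * g x) = a * response b d m f + c * response b d m g"
proof -
  let ?u = "linear_stream b d"
  let ?p = "osc (b + m)"
  have cu: "continuous_on {0..d} ?u"
    by (rule DERIV_continuous_on[OF linear_stream_deriv(1)[OF b sn]])
  have cp: "continuous_on {0..d} ?p" by (rule DERIV_continuous_on[OF osc_deriv])
  have dd: "deriv (\<lambda>x. a * f x + c * g x) = (\<lambda>x. a * deriv f x + c * deriv g x)"
    by (intro ext DERIV_imp_deriv DERIV_add DERIV_cmult test_function_01_props(1) f g)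
  have lin: "integral {0..d} (\<lambda>z. a * F z + c * G z) = a * integral {0..d} F + c * integral {0..d} G"
    if "continuous_on {0..d} F" "continuous_on {0..d} G" for F G :: "real \<Rightarrow> real"
  proof -
    have "integral {0..d} (\<lambda>z. a * F z + c * G z) = integral {0..d} (\<lambda>z. a * F z) + integral {0..d} (\<lambda>z. c * G z)"
      by (intro Henstock_Kurzweil_Integration.integral_add integrable_continuous_interval continuous_intros that)
    then show ?thesis by simp
  qed
  define A where "A h = integral {0..d} (\<lambda>z. deriv h (?u z) * (?p z)\<^sup>2)" for h
  define B where "B h = integral {0..d} (\<lambda>z. ?u z * h (?u z))" for h
  have 1: "A (\<lambda>x. a * f x + c * g x) = a * A f + c * A g"
  proof -
    have "A (\<lambda>x. a * f x + c * g x) =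
       integral {0..d} (\<lambda>z. a * (deriv f (?u z) * (?p z)\<^sup>2) + c * (deriv g (?u z) * (?p z)\<^sup>2))"
      unfolding A_def dd by (rule integral_cong) (simp add: algebra_simps)
    also have "\<dots> = a * A f + c * A g" unfolding A_def
      by (rule lin) (intro continuous_on_mult continuous_on_power cp test_integrals_cont[OF f cu] test_integrals_cont[OF g cu] cu)+
    finally show ?thesis .
  qed
  have 2: "B (\<lambda>x. a * f x + c * g x) = a * B f + c * B g"
  proof -
    have "B (\<lambda>x. a * f x + c * g x) = integral {0..d} (\<lambda>z. a * (?u z * f (?u z)) + c * (?u z * g (?u z)))"
      unfolding B_def by (rule integral_cong) (simp add: algebra_simps)
    also have "\<dots> = a * B f + c * B g" unfolding B_def
      by (rule lin) (intro continuous_on_mult continuous_on_power cp test_integrals_cont[OF f cu] test_integrals_cont[OF g cu] cu)+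
    finally show ?thesis .
  qed
  have r: "response b d m h =
     - (A h - kappa_slope b (linear_stream' b d d) (linear_stream' b d d) * (osc (b + m) d)\<^sup>2 * B h)
     / integral {0..d} (\<lambda>z. (osc (b + m) z)\<^sup>2)" for h
    by (simp add: response_def A_def B_def)
  show ?thesis unfolding r 1 2 by (simp add: algebra_simps add_divide_distrib diff_divide_distrib)
qed

lemma osc_rescale:
  assumes "0 < b"
  shows "osc \<sigma> (t / sqrt b) = osc (\<sigma> / b) t / sqrt b"
  using assms by (auto simp: osc_def real_sqrt_divide zero_less_divide_iff real_sqrt_minus)

lemma integral_rescale:
  fixes f :: "real \<Rightarrow> real"
  assumes f: "continuous_on {0..d} f" and \<beta>: "0 < \<beta>"
  shows "integral {0..\<beta> * d} (\<lambda>t. f (t / \<beta>)) = \<beta> * integral {0..d} f"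
proof -
  have "(f has_integral integral {0..d} f) {0..d}"
    by (intro integrable_integral integrable_continuous_interval f)
  from has_integral_stretch_real[OF this, of "1 / \<beta>"] \<beta>
  have "((\<lambda>t. f (t / \<beta>)) has_integral \<beta> * integral {0..d} f) ((\<lambda>x. x * \<beta>) ` {0..d})" by simp
  moreover have "(\<lambda>x. x * \<beta>) ` {0..d} = {0..\<beta> * d}"
  proof -
    have "(\<lambda>x. \<beta> * x) ` {0..d} = {\<beta> * 0..\<beta> * d}"
      using \<beta> by (subst image_mult_atLeastAtMost) auto
    then show ?thesis by (simp add: mult.commute)
  qed
  ultimately show ?thesis by (simp add: integral_unique)
qed

text \<open>The response vectors form a subspace. A vector orthogonal to it gives a relation to which
  the independence theorem applies after rescaling the interval by \<open>sqrt b\<close>.\<close>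

theorem responses_span:
  fixes lam :: "real^'n::{finite,linorder}"
  assumes d: "0 < d" and b: "0 < b" and sn: "sin (sqrt b * d) \<noteq> 0" and cn: "cos (sqrt b * d) \<noteq> 0"
    and lam: "strict_mono (\<lambda>i. lam $ i)" "\<And>i. lam $ i < 0"
  obtains \<omega> :: "'n \<Rightarrow> real \<Rightarrow> real" where "\<And>k. test_function_01 (\<omega> k)"
    "\<And>j k. response b d (lam $ j) (\<omega> k) = (if j = k then 1 else 0)"
proof -
  define R where "R f = (\<chi> j. response b d (lam $ j) f)" for f
  define V where "V = R ` Collect test_function_01"
  have Rlin: "R (\<lambda>x. a * f x + c * g x) = a *\<^sub>R R f + c *\<^sub>R R g"
    if "test_function_01 f" "test_function_01 g" for a c f g
    using response_linear[OF d b sn that] by (simp add: R_def vec_eq_iff)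
  \<comment> \<open>Any test function serves to represent the zero vector.\<close>
  obtain f0 where f0: "test_function_01 f0" 
    by (rule bump_function_exists[of "1/4" "1/2"]) (simp, simp, simp, rule that)
  have "subspace V"
  proof (rule subspaceI)
    have "0 = R (\<lambda>x. 0 * f0 x + 0 * f0 x)" using Rlin[OF f0 f0, of 0 0] by simp
    then show "0 \<in> V" unfolding V_def using test_function_01_lin[OF f0 f0, of 0 0] by blast
    fix x y assume "x \<in> V" "y \<in> V"
    then obtain f g where fg: "test_function_01 f" "test_function_01 g" "x = R f" "y = R g" by (auto simp: V_def)
    have "x + y = R (\<lambda>x. 1 * f x + 1 * g x)" using Rlin[OF fg(1,2), of 1 1] fg by simp
    then show "x + y \<in> V" unfolding V_def using test_function_01_lin[OF fg(1,2), of 1 1] by blast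
  next
    fix c x assume "x \<in> V"
    then obtain f where f: "test_function_01 f" "x = R f" by (auto simp: V_def)
    have "c *\<^sub>R x = R (\<lambda>x. c * f x + 0 * f x)" using Rlin[OF f(1) f(1), of c 0] f by simp
    then show "c *\<^sub>R x \<in> V" unfolding V_def using test_function_01_lin[OF f(1) f(1), of c 0] by blast
  qed
  have "V = UNIV"
  proof (rule ccontr)
    assume "V \<noteq> UNIV"
    then have "span V \<noteq> UNIV" using \<open>subspace V\<close> by (simp add: span_eq_iff[THEN iffD2])
    then obtain c where c: "c \<noteq> 0" "span V \<subseteq> {x. c \<bullet> x = 0}"
      using span_not_univ_subset_hyperplane by blast
    have ortho: "(\<Sum>j\<in>UNIV. c $ j * response b d (lam $ j) f) = 0" if "test_function_01 f" for f
    proof -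
      have "R f \<in> span V" using that by (intro span_base) (auto simp: V_def)
      then show ?thesis using c(2) by (auto simp: inner_vec_def R_def)
    qed
    define \<beta> where "\<beta> = sqrt b"
    have \<beta>: "0 < \<beta>" "\<beta>\<^sup>2 = b" using b by (auto simp: \<beta>_def)
    let ?u = "linear_stream b d"
    have cu: "continuous_on {0..d} ?u"
      by (rule DERIV_continuous_on[OF linear_stream_deriv(1)[OF b sn]])
    have cp: "continuous_on {0..d} (osc \<sigma>)" for \<sigma> by (rule DERIV_continuous_on[OF osc_deriv])
    define I where "I j = integral {0..d} (\<lambda>z. (osc (b + lam $ j) z)\<^sup>2)" for j
    have I: "0 < I j" for j unfolding I_def by (rule osc_square_integral_pos[OF d])
    define H where "H = kappa_slope b (linear_stream' b d d) (linear_stream' b d d)"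
    define A where "A = (\<Sum>j\<in>UNIV. c $ j / I j * (H * (osc (b + lam $ j) d)\<^sup>2))"
    define \<tau> where "\<tau> j = (b + lam $ j) / b" for j
    have key: "integral {0..\<beta> * d} (\<lambda>t. deriv \<omega> (sin t / sin (\<beta> * d)) * (\<Sum>j\<in>UNIV. (c $ j / I j / b) * (osc (\<tau> j) t)\<^sup>2)) =
       A * integral {0..\<beta> * d} (\<lambda>t. sin t / sin (\<beta> * d) * \<omega> (sin t / sin (\<beta> * d)))"
      if w: "test_function_01 \<omega>" for \<omega>
    proof -
      note cw = test_integrals_cont[OF w cu]
      define X where "X j = integral {0..d} (\<lambda>z. deriv \<omega> (?u z) * (osc (b + lam $ j) z)\<^sup>2)" for j
      define Y where "Y = integral {0..d} (\<lambda>z. ?u z * \<omega> (?u z))"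
      have u: "?u (t / \<beta>) = sin t / sin (\<beta> * d)" for t using \<beta> by (simp add: linear_stream_def \<beta>_def[symmetric])
      have o: "(osc (b + lam $ j) (t / \<beta>))\<^sup>2 = (osc (\<tau> j) t)\<^sup>2 / b" for j t
        using osc_rescale[OF b, of "b + lam $ j" t] \<beta> by (simp add: \<beta>_def[symmetric] \<tau>_def power_divide)
      have "integral {0..\<beta> * d} (\<lambda>t. deriv \<omega> (sin t / sin (\<beta> * d)) * (\<Sum>j\<in>UNIV. (c $ j / I j / b) * (osc (\<tau> j) t)\<^sup>2)) =
        integral {0..\<beta> * d} (\<lambda>t. (\<lambda>z. \<Sum>j\<in>UNIV. c $ j / I j * (deriv \<omega> (?u z) * (osc (b + lam $ j) z)\<^sup>2)) (t / \<beta>))"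
        by (rule integral_cong) (simp add: u o sum_distrib_left mult_ac)
      also have "\<dots> = \<beta> * integral {0..d} (\<lambda>z. \<Sum>j\<in>UNIV. c $ j / I j * (deriv \<omega> (?u z) * (osc (b + lam $ j) z)\<^sup>2))"
        by (rule integral_rescale) (intro continuous_intros cw cp \<beta>)+
      also have "integral {0..d} (\<lambda>z. \<Sum>j\<in>UNIV. c $ j / I j * (deriv \<omega> (?u z) * (osc (b + lam $ j) z)\<^sup>2)) =
          (\<Sum>j\<in>UNIV. integral {0..d} (\<lambda>z. c $ j / I j * (deriv \<omega> (?u z) * (osc (b + lam $ j) z)\<^sup>2)))"
        by (intro integral_sum integrable_continuous_interval continuous_intros cw cp) auto
      also have "\<dots> = (\<Sum>j\<in>UNIV. c $ j / I j * X j)" by (simp add: X_def)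
      also have "\<dots> = A * Y"
      proof -
        have "0 = (\<Sum>j\<in>UNIV. c $ j / I j * X j - c $ j / I j * (H * (osc (b + lam $ j) d)\<^sup>2) * Y)"
        proof -
          have "0 = - (\<Sum>j\<in>UNIV. c $ j * response b d (lam $ j) \<omega>)" using ortho[OF w] by simp
          also have "\<dots> = (\<Sum>j\<in>UNIV. c $ j / I j * X j - c $ j / I j * (H * (osc (b + lam $ j) d)\<^sup>2) * Y)"
            unfolding sum_negf[symmetric]
            by (rule sum.cong) (simp_all add: response_def X_def Y_def I_def[symmetric] H_def[symmetric] diff_divide_distrib right_diff_distrib mult_ac)
          finally show ?thesis .
        qed
        then show ?thesis by (simp add: sum_subtractf A_def sum_distrib_right)
      qed
      also have "\<beta> * (A * Y) = A * (\<beta> * Y)" by simp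
      also have "\<beta> * Y = integral {0..\<beta> * d} (\<lambda>t. (\<lambda>z. ?u z * \<omega> (?u z)) (t / \<beta>))"
        unfolding Y_def by (rule integral_rescale[symmetric]) (intro continuous_intros cw cu \<beta>)+
      finally show ?thesis by (simp add: u)
    qed
    have "c $ j / I j / b = 0" for j
    proof (rule vorticity_functionals_independent[OF _ _ _ _ _ key])
      show "inj \<tau>" using b strict_mono_eq[OF lam(1)] by (auto simp: inj_def \<tau>_def)
      show "\<tau> j < 1" for j using b lam(2)[of j] by (simp add: \<tau>_def)
      show "0 < \<beta> * d" using \<beta> d by simp
      show "sin (\<beta> * d) \<noteq> 0" "cos (\<beta> * d) \<noteq> 0" using sn cn by (auto simp: \<beta>_def)
    qed
    moreover have "I j \<noteq> 0" for j using I[of j] by simp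
    ultimately have "c $ j = 0" for j using b by simp
    then show False using c(1) by (simp add: vec_eq_iff)
  qed
  then have "\<exists>f. test_function_01 f \<and> R f = axis k 1" for k by (metis V_def UNIV_I imageE mem_Collect_eq)
  then obtain \<omega> where w: "\<And>k. test_function_01 (\<omega> k)" "\<And>k. R (\<omega> k) = axis k 1" by metis
  show thesis
  proof (rule that[OF w(1)])
    fix j k
    have "response b d (lam $ j) (\<omega> k) = R (\<omega> k) $ j" by (simp add: R_def)
    then show "response b d (lam $ j) (\<omega> k) = (if j = k then 1 else 0)" by (simp add: w(2) axis_def)
  qed
qed

theorem theorem3p1:
  fixes b d :: real and lam :: "real^'n::{finite,linorder}"
  assumes "CARD('n) > 1" and "d > 0" and "b > 0"
    and "\<forall>j::nat. j \<ge> 1 \<longrightarrow> sqrt b \<noteq> pi * real j / (2 * d)"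
    and "negative_eigenvalue_vector (linear_vorticity b) d (linear_stream b d) lam"
    and "\<forall>\<mu>. sl_eigenvalue (linear_vorticity b) d (linear_stream b d) \<mu> \<and>
             \<mu> \<notin> range (\<lambda>i. lam $ i) \<longrightarrow> \<mu> > 0"
  shows "\<exists>\<omega> :: 'n \<Rightarrow> real \<Rightarrow> real.
           (\<forall>k. test_function_01 (\<omega> k)) \<and>
           (\<forall>\<^sub>F \<delta> in nhds 0. T_well_defined b d \<omega> \<delta>) \<and>
           T_map b d \<omega> differentiable (at 0) \<and>
           invertible (jacobian (T_map b d \<omega>) (at 0))"
proof -
  have neg: "lam $ i < 0" for i using assms(5) by (auto simp: negative_eigenvalue_vector_def)
  have mono: "strict_mono (\<lambda>i. lam $ i)" using assms(5) by (simp add: negative_eigenvalue_vector_def)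
  \<comment> \<open>The excluded values of \<open>sqrt b\<close> are those for which the sine or the cosine of \<open>sqrt b * d\<close> vanishes.\<close>
  have "sin (2 * (sqrt b * d)) \<noteq> 0"
  proof
    assume "sin (2 * (sqrt b * d)) = 0"
    then obtain i :: int where i: "2 * (sqrt b * d) = of_int i * pi" by (auto simp: sin_zero_iff_int2)
    have "0 < 2 * (sqrt b * d)" using assms(2,3) by simp
    then have "0 < i" unfolding i by (simp add: zero_less_mult_iff)
    define j where "j = nat i"
    have j: "j \<ge> 1" "real j = of_int i" using \<open>0 < i\<close> by (auto simp: j_def)
    have "sqrt b = pi * real j / (2 * d)" using i assms(2) by (simp add: j field_simps)
    then show False using assms(4) j(1) by blast
  qed
  then have sn: "sin (sqrt b * d) \<noteq> 0" and cn: "cos (sqrt b * d) \<noteq> 0" by (auto simp: sin_double)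
  have zero: "\<not> sl_eigenvalue (linear_vorticity b) d (linear_stream b d) 0"
  proof
    assume "sl_eigenvalue (linear_vorticity b) d (linear_stream b d) 0"
    moreover have "0 \<notin> range (\<lambda>i. lam $ i)" using neg by (auto simp: less_le)
    ultimately show False using assms(6) by blast
  qed
  obtain \<omega> :: "'n \<Rightarrow> real \<Rightarrow> real" where w: "\<And>k. test_function_01 (\<omega> k)"
    "\<And>j k. response b d (lam $ j) (\<omega> k) = (if j = k then 1 else 0)"
    using responses_span[OF assms(2,3) sn cn mono neg] by blast
  note first = eigenvalue_map_first_order[where \<omega> = \<omega>, OF assms(2,3) sn cn assms(5) zero w(1)]
  have comp: "((\<lambda>\<delta>. T_map b d \<omega> \<delta> $ j) has_derivative (\<lambda>h. h $ j)) (at 0)" for j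
  proof -
    have "(\<Sum>k\<in>UNIV. h $ k * response b d (lam $ j) (\<omega> k)) = h $ j" for h :: "real^'n::{finite,linorder}"
      by (simp add: w(2) if_distrib cong: if_cong)
    then show ?thesis using first(2)[of j] by simp
  qed
  have der: "(T_map b d \<omega> has_derivative (\<lambda>h. h)) (at 0)"
    unfolding has_derivative_componentwise_within[of "T_map b d \<omega>"]
    using comp by (auto simp: Basis_vec_def inner_axis)
  have "jacobian (T_map b d \<omega>) (at 0) = mat 1"
    unfolding jacobian_def frechet_derivative_at[OF der, symmetric]
    by (simp add: matrix_def mat_def axis_def vec_eq_iff)
  then have "invertible (jacobian (T_map b d \<omega>) (at 0))" by (simp add: invertible_def exI[of _ "mat 1"])
  with w(1) first(1) der show ?thesis unfolding differentiable_def by blast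
qed

end
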